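(* For each $n$ let $\mathbb{G}_n$ be a simple graph on $[n]$ with degrees $d_1,\dots,d_n$, average degree $\overline d$, adjacency matrix $\mathbf{G}_n$, and let $\mathbf{Q}=\mathbf{G}_n/\overline d$. Let $\beta=1$ and $\boldsymbol{\mu}\in\Xi(\mathcal{C}_n,s,A)$, where $\mathcal{C}_n$ is a class of subsets of $[n]$ of size $s$. Suppose $\overline d\gg\sqrt n(\log n)^5$, $sA\gg n^{1/4}$, $\max_{i\in[n]}|d_i/\overline d-1|\lesssim\sqrt{\frac{\log n}{\overline d}}$, and $\limsup_{n\to\infty}\lambda_2(\mathbf{Q})<1$. Then there exists a constant $\delta>0$ such that $$\lim_{n\to\infty}\mathbb{P}_{\beta,\mathbf{Q},\boldsymbol{\mu}}\big(n^{1/4}\overline{\mathbf{X}}\ge\delta k_n\big)=1,\qquad k_n:=\big(n^{-1/4}sA\big)^{1/3}.$$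
   Context: Ising model: for a symmetric real $n\times n$ matrix $\mathbf{Q}$ with zero diagonal, $\beta\in\mathbb{R}$ and $\boldsymbol{\mu}\in\mathbb{R}^n$, $\mathbb{P}_{\beta,\mathbf{Q},\boldsymbol{\mu}}$ is the law on $\{\pm1\}^n$ with $\mathbb{P}_{\beta,\mathbf{Q},\boldsymbol{\mu}}(\mathbf{X}=\mathbf{x})=\frac{1}{Z_n(\beta,\mathbf{Q},\boldsymbol{\mu})}\exp\big(\frac{\beta}{2}\mathbf{x}^\top\mathbf{Q}\mathbf{x}+\boldsymbol{\mu}^\top\mathbf{x}\big)$, where $Z_n(\beta,\mathbf{Q},\boldsymbol{\mu})$ is the normalizing constant; $\overline{\mathbf{X}}=\frac1n\sum_iX_i$. Here $s=s_n\in[n]=\{1,\dots,n\}$ with $s\le n^{1-\upsilon}$ for some fixed $\upsilon>0$, $A=A_n>0$, and $\Xi(\mathcal{C}_n,s,A)=\{\boldsymbol{\mu}\in\mathbb{R}_+^n:\ \mathrm{supp}(\boldsymbol{\mu})\in\mathcal{C}_n,\ \min_{i\in\mathrm{supp}(\boldsymbol{\mu})}\mu_i\ge A\}$, with $\mathrm{supp}(\boldsymbol{\mu})=\{i:\mu_i\neq0\}$. $\overline d=\frac1n\sum_id_i$; $\lambda_2(\mathbf{Q})$ is the second largest eigenvalue of $\mathbf{Q}$. Asymptotics are as $n\to\infty$: $a_n\lesssim b_n$ means $\limsup a_n/b_n<\infty$, and $a_n\gg b_n$ means $b_n/a_n\to0$.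
   Formalization: The formal statement additionally assumes that A = A_n is bounded (A_n = O(1)); without it the claim fails, e.g. for complete graphs with s = 1 and A = n^4, where k_n = n^{5/4} exceeds the maximal value n^{1/4} of n^{1/4} times the mean. *)

theory Defs
  imports
    "HOL-Probability.Probability"
    "HOL-Library.Landau_Symbols"
    "Jordan_Normal_Form.Char_Poly"
begin

(* vectors and matrices below are those of Jordan_Normal_Form, so that the dimension is a value *)
unbundle no inner_syntax and no vec_syntax

text \<open>The index set \<open>[n]\<close> is \<open>{..<n}\<close>, following the indexing of vectors and matrices.\<close>

definition simple_graph :: "nat \<Rightarrow> nat set set \<Rightarrow> bool" where
  "simple_graph n E \<longleftrightarrow> E \<subseteq> {e. e \<subseteq> {..<n} \<and> card e = 2}"

definition degree_of :: "nat set set \<Rightarrow> nat \<Rightarrow> nat" where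
  "degree_of E i = card {e \<in> E. i \<in> e}"

definition avg_degree :: "nat \<Rightarrow> nat set set \<Rightarrow> real" where
  "avg_degree n E = (\<Sum>i<n. real (degree_of E i)) / real n"

definition adj_matrix :: "nat \<Rightarrow> nat set set \<Rightarrow> real mat" where
  "adj_matrix n E = mat n n (\<lambda>(i, j). if {i, j} \<in> E then 1 else 0)"

definition scaled_adj :: "nat \<Rightarrow> nat set set \<Rightarrow> real mat" where
  "scaled_adj n E = (1 / avg_degree n E) \<cdot>\<^sub>m adj_matrix n E"

text \<open>Eigenvalues are counted with multiplicity. The value is meaningful for symmetric matrices
  (whose characteristic polynomial has only real roots) of dimension at least two.\<close>

definition second_largest_eigenvalue :: "real mat \<Rightarrow> real" where
  "second_largest_eigenvalue Q = rev (sorted_list_of_multiset (proots (char_poly Q))) ! 1"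

definition spin_configs :: "nat \<Rightarrow> real vec set" where
  "spin_configs n = {x \<in> carrier_vec n. \<forall>i<n. x $ i \<in> {-1, 1}}"

definition ising_weight :: "real \<Rightarrow> real mat \<Rightarrow> real vec \<Rightarrow> real vec \<Rightarrow> real" where
  "ising_weight \<beta> Q \<mu> x = exp (\<beta> / 2 * (x \<bullet> (Q *\<^sub>v x)) + \<mu> \<bullet> x)"

definition ising_Z :: "real \<Rightarrow> real mat \<Rightarrow> real vec \<Rightarrow> real" where
  "ising_Z \<beta> Q \<mu> = (\<Sum>x \<in> spin_configs (dim_vec \<mu>). ising_weight \<beta> Q \<mu> x)"

definition ising :: "real \<Rightarrow> real mat \<Rightarrow> real vec \<Rightarrow> real vec pmf" where
  "ising \<beta> Q \<mu> = embed_pmf (\<lambda>x. if x \<in> spin_configs (dim_vec \<mu>)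
     then ising_weight \<beta> Q \<mu> x / ising_Z \<beta> Q \<mu> else 0)"

definition vec_mean :: "real vec \<Rightarrow> real" where
  "vec_mean x = (\<Sum>i<dim_vec x. x $ i) / real (dim_vec x)"

definition vec_supp :: "real vec \<Rightarrow> nat set" where
  "vec_supp \<mu> = {i. i < dim_vec \<mu> \<and> \<mu> $ i \<noteq> 0}"

definition signal_class :: "nat \<Rightarrow> nat set set \<Rightarrow> real \<Rightarrow> real vec set" where
  "signal_class n \<C> A = {\<mu> \<in> carrier_vec n.
     (\<forall>i<n. 0 \<le> \<mu> $ i) \<and> vec_supp \<mu> \<in> \<C> \<and> (\<forall>i \<in> vec_supp \<mu>. A \<le> \<mu> $ i)}"

lemma finite_spin_configs: "finite (spin_configs n)"
proof -
  have "spin_configs n \<subseteq> vec n ` (PiE {..<n} (\<lambda>_. {-1, 1}))"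
  proof
    fix x assume x: "x \<in> spin_configs n"
    then have "x = vec n (restrict (($) x) {..<n})"
      by (intro eq_vecI) (auto simp: spin_configs_def)
    moreover have "restrict (($) x) {..<n} \<in> PiE {..<n} (\<lambda>_. {-1, 1})"
      using x by (auto simp: spin_configs_def)
    ultimately show "x \<in> vec n ` (PiE {..<n} (\<lambda>_. {-1, 1}))" by blast
  qed
  then show ?thesis by (rule finite_subset) (auto intro: finite_PiE)
qed

lemma ising_Z_pos: "ising_Z \<beta> Q \<mu> > 0"
proof -
  have "vec (dim_vec \<mu>) (\<lambda>_. 1) \<in> spin_configs (dim_vec \<mu>)"
    by (auto simp: spin_configs_def)
  then show ?thesis unfolding ising_Z_def
    by (intro sum_pos finite_spin_configs) (auto simp: ising_weight_def)
qed

lemma pmf_ising: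
  "pmf (ising \<beta> Q \<mu>) x =
     (if x \<in> spin_configs (dim_vec \<mu>) then ising_weight \<beta> Q \<mu> x / ising_Z \<beta> Q \<mu> else 0)"
  unfolding ising_def
proof (rule pmf_embed_pmf)
  let ?S = "spin_configs (dim_vec \<mu>)"
  let ?f = "\<lambda>x. if x \<in> ?S then ising_weight \<beta> Q \<mu> x / ising_Z \<beta> Q \<mu> else 0"
  show nn: "0 \<le> ?f x" for x
    using ising_Z_pos[of \<beta> Q \<mu>] by (simp add: ising_weight_def)
  have "(\<integral>\<^sup>+x. ennreal (?f x) \<partial>count_space UNIV) = (\<Sum>x\<in>?S. ennreal (?f x))"
    by (rule nn_integral_count_space') (auto simp: finite_spin_configs)
  also have "\<dots> = ennreal (\<Sum>x\<in>?S. ?f x)"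
    by (rule sum_ennreal) (rule nn)
  also have "(\<Sum>x\<in>?S. ?f x) = 1"
    using ising_Z_pos[of \<beta> Q \<mu>]
    by (simp add: sum_divide_distrib[symmetric] ising_Z_def)
  finally show "(\<integral>\<^sup>+x. ennreal (?f x) \<partial>count_space UNIV) = 1" by simp
qed

end

theory Submission
  imports Defs
begin

text \<open>
  Lowering the field by \<open>r / n\<close> at every site and applying Jensen's inequality reduces the lower tail
  of the magnetization to a lower bound for its mean under the lowered field; by the FKG inequality
  it suffices to treat a field equal to a small multiple of \<open>A\<close> on the support.

  Let \<open>t\<^sub>i\<close> be the mean of the \<open>i\<close>-th spin given the others, so that
  \<open>t\<^sub>i = tanh ((Q x)\<^sub>i + \<mu>\<^sub>i)\<close>. Since \<open>\<Sum>\<^sub>i h\<^sub>i (x\<^sub>i - t\<^sub>i)\<close> has mean zero up to the dependence of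
  \<open>h\<^sub>i\<close> on \<open>x\<^sub>i\<close>, every test field \<open>h\<close> yields a moment inequality. Testing with the leading eigenvector \<open>v\<close> of
  \<open>Q\<close> times a Lipschitz function of \<open>T = \<langle>v, t\<rangle> / n\<close> balances the signal
  \<open>\<langle>v, \<mu>\<rangle>\<close> against \<open>n T\<^sup>3\<close>, up to the error \<open>\<Sum>\<^sub>i \<bar>t\<^sub>i - T\<bar>\<^sup>3\<close>. Testing with \<open>Q (t \<bar>t\<bar>)\<close> and
  applying the spectral gap to \<open>sgn t \<bar>t\<bar>\<^bsup>3/2\<^esup>\<close> bounds that error by a small multiple
  of the signal. Hence \<open>T\<close>, and with it the magnetization, has mean of order \<open>(s A / n)\<^bsup>1/3\<^esup>\<close>.
\<close>

subsection \<open>The two largest eigenvalues of a symmetric matrix\<close>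

text \<open>At \<beta> = 1 the linear parts of local field and response cancel, so all estimates
  live at cubic order, while the signal may exceed n^(1/4) only slightly. This dictates exponent
  three for the deviations: the conditional means fluctuate across sites by about d^(-1/2), with d
  the average degree, and a quadratic bound would only give n / d, which the density assumption
  allows to be far larger than n^(1/4), whereas the cubes sum to about n d^(-3/2), below n^(1/4).
  Degree irregularity perturbs the eigenvector to first order but, since \<open>Q\<close> is
  normalized by the average degree, the eigenvalue only to second order; Young's inequality then
  turns this error into a cube as well. The natural scale \<open>\<tau>\<close> solves
  \<open>n * \<tau> ^ 3 = M\<close>, where \<open>M\<close> is the size of the signal. No
  concentration estimate is needed: lowering the field by a total of \<open>M / 8\<close> while
  keeping a mean of order \<open>\<tau>\<close> yields a tail exponent of order
  \<open>M * \<tau>\<close>, which diverges. The comparison field is shrunk because the cubes of the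
  field enter as an error too. Numerical constants are not optimized.\<close>

lemma symmetric_deflation:
  fixes A :: "real mat"
  assumes A: "A \<in> carrier_mat (Suc k) (Suc k)" and sym: "transpose_mat A = A"
    and cp: "char_poly A = [:- e, 1:] * p"
  shows "\<exists>v B R. v \<in> carrier_vec (Suc k) \<and> v \<bullet> v = 1 \<and> A *\<^sub>v v = e \<cdot>\<^sub>v v \<and>
    B \<in> carrier_mat k k \<and> transpose_mat B = B \<and> char_poly B = p \<and>
    (\<forall>x \<in> carrier_vec (Suc k). R x \<in> carrier_vec k \<and>
       x \<bullet> (A *\<^sub>v x) = e * (v \<bullet> x)\<^sup>2 + R x \<bullet> (B *\<^sub>v R x) \<and>
       x \<bullet> x = (v \<bullet> x)\<^sup>2 + R x \<bullet> R x)"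
proof -
  let ?n = "Suc k"
  have "poly (char_poly A) e = 0" by (simp add: cp)
  then have "eigenvalue A e" using eigenvalue_root_char_poly[OF A] by simp
  then obtain v0 where v0: "v0 \<in> carrier_vec ?n" "v0 \<noteq> 0\<^sub>v ?n" "A *\<^sub>v v0 = e \<cdot>\<^sub>v v0"
    using A unfolding eigenvalue_def eigenvector_def by auto
  have v0pos: "v0 \<bullet> v0 > 0"
    using conjugate_square_greater_0_vec[OF v0(1)] v0(2) by simp
  define v where "v = (1 / sqrt (v0 \<bullet> v0)) \<cdot>\<^sub>v v0"
  have v: "v \<in> carrier_vec ?n" using v0 by (simp add: v_def)
  have vv: "v \<bullet> v = 1"
    unfolding v_def using v0(1) v0pos
    by (simp add: smult_scalar_prod_distrib[OF v0(1)] scalar_prod_smult_distrib[OF v0(1)] field_simps)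
  have Av: "A *\<^sub>v v = e \<cdot>\<^sub>v v"
    unfolding v_def using v0 A by (simp add: mult_mat_vec[OF A v0(1)] smult_smult_assoc mult.commute)
  \<comment> \<open>Householder reflection along \<open>v\<close> minus the first unit vector: it
    exchanges these two vectors, so conjugating by it moves the eigenvector to coordinate 0.\<close>
  define w where "w i = v $ i - (if i = 0 then 1 else 0)" for i
  define ww where "ww = (\<Sum>i<?n. w i * w i)"
  \<comment> \<open>If \<open>v\<close> already is the first unit vector, then \<open>ww = 0\<close>
    and division by zero gives \<open>c = 0\<close>, so that \<open>W\<close> is the identity; the
    equation \<open>cc\<close> holds in this case too.\<close>
  define c where "c = 2 / ww"
  define W where "W = mat ?n ?n (\<lambda>(i,j). (if i = j then 1 else 0) - c * w i * w j)"
  have W: "W \<in> carrier_mat ?n ?n" by (simp add: W_def)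
  have Wsym: "transpose_mat W = W"
    by (rule eq_matI) (auto simp: W_def)
  have cc: "c * c * ww = 2 * c" by (simp add: c_def)
  have WW: "W * W = 1\<^sub>m ?n"
  proof (rule eq_matI)
    fix i j assume ij: "i < dim_row (1\<^sub>m ?n :: real mat)" "j < dim_col (1\<^sub>m ?n :: real mat)"
    then have ij: "i < ?n" "j < ?n" by auto
    have "(W * W) $$ (i,j) = (\<Sum>l<?n. ((if i = l then 1 else 0) - c * w i * w l) * ((if l = j then 1 else 0) - c * w l * w j))"
      using ij W by (simp add: scalar_prod_def W_def lessThan_atLeast0)
    also have "\<dots> = (\<Sum>l<?n. (if i = l then (if l = j then 1 else 0) else 0) - (if i = l then c * w l * w j else 0)
        - (if l = j then c * w i * w l else 0) + c * c * w i * w j * (w l * w l))"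
      by (rule sum.cong) (auto simp: algebra_simps)
    also have "\<dots> = (if i = j then 1 else 0) - c * w i * w j - c * w i * w j + c * c * w i * w j * ww"
      using ij unfolding ww_def
      by (simp only: sum.distrib sum_subtractf sum_distrib_left[symmetric] sum.delta sum.delta' finite_lessThan lessThan_iff if_True)
    also have "\<dots> = (if i = j then 1 else 0) - 2 * c * w i * w j + (c * c * ww) * w i * w j"
      by (simp add: algebra_simps)
    also have "\<dots> = (1\<^sub>m ?n) $$ (i,j)" using ij unfolding cc by simp
    finally show "(W * W) $$ (i,j) = (1\<^sub>m ?n) $$ (i,j)" .
  qed (use W in auto)
  have vvs: "(\<Sum>i<?n. v $ i * v $ i) = 1"
    using vv v by (simp add: scalar_prod_def lessThan_atLeast0)
  have ww_eq: "ww = - 2 * w 0"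
  proof -
    have "ww = (\<Sum>i<?n. v $ i * v $ i - 2 * (if i = 0 then v $ 0 else 0) + (if i = 0 then 1 else 0))"
      unfolding ww_def w_def by (rule sum.cong) (auto simp: algebra_simps)
    also have "\<dots> = 2 - 2 * v $ 0"
      by (simp only: sum.distrib sum_subtractf sum_distrib_left[symmetric] vvs) (simp add: sum.delta)
    finally show ?thesis by (simp add: w_def)
  qed
  have cw: "c * w 0 * w i = - w i" if "i < ?n" for i
  proof (cases "ww = 0")
    case True
    then have "w i * w i = 0"
      using that unfolding ww_def by (subst (asm) sum_nonneg_eq_0_iff) auto
    then show ?thesis by simp
  next
    case False
    then show ?thesis using ww_eq by (simp add: c_def field_simps)
  qed
  have colW: "col W 0 = v"
  proof (rule eq_vecI)
    fix i assume "i < dim_vec v"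
    then have i: "i < ?n" using v by auto
    have "c * w i * w 0 = - w i" using cw[OF i] by (simp add: mult_ac)
    then show "col W 0 $ i = v $ i" using i by (simp add: W_def w_def)
  qed (use W v in auto)
  have rowW: "row W 0 = v" using colW Wsym W by (metis row_transpose zero_less_Suc carrier_matD(2))
  have Wv: "W *\<^sub>v v = unit_vec ?n 0"
  proof -
    have "W *\<^sub>v v = col (W * W) 0" using colW by (subst col_mult2[OF W W]) auto
    then show ?thesis unfolding WW by simp
  qed
  define C where "C = W * A * W"
  have C: "C \<in> carrier_mat ?n ?n" using W A by (simp add: C_def)
  have Csym: "transpose_mat C = C"
  proof -
    have "transpose_mat C = transpose_mat W * (transpose_mat A * transpose_mat W)"
      unfolding C_def using W A by (metis mult_carrier_mat transpose_mult)
    then show ?thesis unfolding Wsym sym C_def using W A by (simp add: assoc_mult_mat)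
  qed
  \<comment> \<open>The first column of \<open>C\<close> is a multiple of a unit vector; symmetry
    clears the first row as well and leaves a block diagonal matrix.\<close>
  have colC: "col C 0 = e \<cdot>\<^sub>v unit_vec ?n 0"
  proof -
    have "col C 0 = (W * A) *\<^sub>v v" unfolding C_def using W A colW by (subst col_mult2[of _ ?n ?n _ ?n]) auto
    also have "\<dots> = W *\<^sub>v (A *\<^sub>v v)" using W A v by simp
    also have "\<dots> = e \<cdot>\<^sub>v (W *\<^sub>v v)" unfolding Av using mult_mat_vec[OF W v] by simp
    finally show ?thesis unfolding Wv .
  qed
  define B where "B = mat k k (\<lambda>(i,j). C $$ (Suc i, Suc j))"
  have B: "B \<in> carrier_mat k k" by (simp add: B_def)
  have Cij: "C $$ (i,j) = C $$ (j,i)" if "i < ?n" "j < ?n" for i j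
    using that Csym C by (metis index_transpose_mat(1) carrier_matD)
  have Bsym: "transpose_mat B = B"
    by (rule eq_matI) (auto simp: B_def Cij)
  have Ci0: "C $$ (i,0) = (if i = 0 then e else 0)" if "i < ?n" for i
    using arg_cong[OF colC, of "\<lambda>u. u $ i"] that C by auto
  have block: "C = four_block_mat (mat 1 1 (\<lambda>_. e)) (0\<^sub>m 1 k) (0\<^sub>m k 1) B"
  proof (rule eq_matI)
    let ?F = "four_block_mat (mat 1 1 (\<lambda>_. e)) (0\<^sub>m 1 k) (0\<^sub>m k 1) B"
    fix i j assume ij: "i < dim_row ?F" "j < dim_col ?F"
    then have ij: "i < ?n" "j < ?n" using B by auto
    show "C $$ (i,j) = ?F $$ (i,j)"
      using ij B Ci0[of i] Ci0[of j] Cij[of i j] by (cases i; cases j) (auto simp: B_def)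
  qed (use C B in auto)
  have sim: "similar_mat C A"
    unfolding similar_mat_def
    by (rule exI[of _ W], rule exI[of _ W], rule similar_mat_witI[of _ _ ?n]) (use W A C WW in \<open>auto simp: C_def\<close>)
  have "char_poly C = char_poly (mat 1 1 (\<lambda>_. e)) * char_poly B"
    unfolding block by (rule char_poly_four_block_zeros_col) (use B in auto)
  also have "char_poly (mat 1 1 (\<lambda>_. e)) = [:-e, 1:]"
    by (simp add: char_poly_defs det_def sign_def)
  finally have "[:-e,1:] * p = [:-e,1:] * char_poly B" using char_poly_similar[OF sim] cp by simp
  then have cpB: "char_poly B = p" by (metis mult_cancel_left pCons_eq_0_iff zero_neq_one)
  \<comment> \<open>The coordinates of the reflected vector after the first one represent the part
    of \<open>x\<close> orthogonal to \<open>v\<close>.\<close>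
  define R where "R x = vec k (\<lambda>i. (W *\<^sub>v x) $ Suc i)" for x
  have R: "R x \<in> carrier_vec k" for x by (simp add: R_def)
  have y0: "(W *\<^sub>v x) $ 0 = v \<bullet> x" for x using W rowW by simp
  have WWx: "W *\<^sub>v (W *\<^sub>v x) = x" if "x \<in> carrier_vec ?n" for x
    using that W WW by (metis assoc_mult_mat_vec one_mult_mat_vec)
  have Wadj: "(W *\<^sub>v x) \<bullet> y = x \<bullet> (W *\<^sub>v y)" if "x \<in> carrier_vec ?n" "y \<in> carrier_vec ?n" for x y
    using transpose_vec_mult_scalar[OF W that(2) that(1)] Wsym that W
    by (metis comm_scalar_prod mult_mat_vec_carrier)
  have split: "y \<bullet> z = y $ 0 * z $ 0 + (\<Sum>i<k. y $ Suc i * z $ Suc i)" if "z \<in> carrier_vec ?n" for y z :: "real vec"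
    using that by (simp add: scalar_prod_def lessThan_atLeast0 sum.lessThan_Suc_shift sum.atLeast0_lessThan_Suc_shift del: sum.op_ivl_Suc)
  have norm: "x \<bullet> x = (v \<bullet> x)\<^sup>2 + R x \<bullet> R x" if x: "x \<in> carrier_vec ?n" for x
  proof -
    have "x \<bullet> x = (W *\<^sub>v x) \<bullet> (W *\<^sub>v x)" using Wadj[OF x, of "W *\<^sub>v x"] WWx[OF x] W x by simp
    also have "\<dots> = (v \<bullet> x)\<^sup>2 + R x \<bullet> R x"
      using split[of "W *\<^sub>v x" "W *\<^sub>v x"] y0[of x] W x
      by (simp add: power2_eq_square R_def scalar_prod_def[of "vec k _"] lessThan_atLeast0 del: index_mult_mat_vec)
    finally show ?thesis .
  qed
  have form: "x \<bullet> (A *\<^sub>v x) = e * (v \<bullet> x)\<^sup>2 + R x \<bullet> (B *\<^sub>v R x)" if x: "x \<in> carrier_vec ?n" for x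
  proof -
    let ?y = "W *\<^sub>v x"
    have y: "?y \<in> carrier_vec ?n" using W x by simp
    have "x \<bullet> (A *\<^sub>v x) = (W *\<^sub>v ?y) \<bullet> (A *\<^sub>v (W *\<^sub>v ?y))" using WWx[OF x] by simp
    also have "\<dots> = ?y \<bullet> (W *\<^sub>v (A *\<^sub>v (W *\<^sub>v ?y)))" by (rule Wadj) (use y A W in auto)
    also have "W *\<^sub>v (A *\<^sub>v (W *\<^sub>v ?y)) = C *\<^sub>v ?y" using W A y by (simp add: C_def assoc_mult_mat_vec[of _ ?n ?n _ ?n])
    also have "?y \<bullet> (C *\<^sub>v ?y) = ?y $ 0 * (C *\<^sub>v ?y) $ 0 + (\<Sum>i<k. ?y $ Suc i * (C *\<^sub>v ?y) $ Suc i)"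
      by (rule split) (use C y in auto)
    also have "(C *\<^sub>v ?y) $ 0 = e * (v \<bullet> x)"
    proof -
      have "(C *\<^sub>v ?y) $ 0 = row C 0 \<bullet> ?y" using C by simp
      also have "\<dots> = C $$ (0,0) * ?y $ 0 + (\<Sum>i<k. C $$ (0, Suc i) * ?y $ Suc i)"
        by (subst split) (use C y in auto)
      also have "(\<Sum>i<k. C $$ (0, Suc i) * ?y $ Suc i) = 0"
        by (rule sum.neutral) (simp add: Cij[of 0] Ci0)
      finally show ?thesis using Ci0[of 0] y0 by simp
    qed
    also have "(\<Sum>i<k. ?y $ Suc i * (C *\<^sub>v ?y) $ Suc i) = R x \<bullet> (B *\<^sub>v R x)"
    proof -
      have "(C *\<^sub>v ?y) $ Suc i = (B *\<^sub>v R x) $ i" if i: "i < k" for i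
      proof -
        have "(C *\<^sub>v ?y) $ Suc i = row C (Suc i) \<bullet> ?y" using C i by simp
        also have "\<dots> = C $$ (Suc i, 0) * ?y $ 0 + (\<Sum>j<k. C $$ (Suc i, Suc j) * ?y $ Suc j)"
          by (subst split) (use C y i in auto)
        also have "\<dots> = (\<Sum>j<k. C $$ (Suc i, Suc j) * ?y $ Suc j)" using Ci0[of "Suc i"] i by simp
        also have "\<dots> = row B i \<bullet> R x"
          unfolding scalar_prod_def using i
          by (simp add: lessThan_atLeast0 B_def R_def del: index_mult_mat_vec)
        also have "\<dots> = (B *\<^sub>v R x) $ i" using i B by simp
        finally show ?thesis .
      qed
      then show ?thesis using B by (simp add: scalar_prod_def lessThan_atLeast0 R_def del: index_mult_mat_vec)
    qed
    finally show ?thesis using y0 by (simp add: power2_eq_square algebra_simps)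
  qed
  show ?thesis using v vv Av B Bsym cpB R form norm by blast
qed

text \<open>Repeated deflation removes one eigenvalue at a time, in whatever order the list has
  them, and splits off a square each time, so no orthonormal eigenbasis has to be assembled.\<close>

lemma rayleigh_le:
  fixes A :: "real mat"
  assumes "A \<in> carrier_mat n n" "transpose_mat A = A" "char_poly A = (\<Prod>e\<leftarrow>es. [:- e, 1:])"
    "\<And>e. e \<in> set es \<Longrightarrow> e \<le> c" "x \<in> carrier_vec n"
  shows "x \<bullet> (A *\<^sub>v x) \<le> c * (x \<bullet> x)"
  using assms
proof (induction es arbitrary: n A x)
  case Nil
  then have "n = 0" using degree_monic_char_poly[of A n] by simp
  then show ?case using Nil by (simp add: scalar_prod_def)
next
  case (Cons e es)
  have "degree (char_poly A) = length (e # es)"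
    unfolding Cons.prems(3) by (rule degree_linear_factors)
  then obtain k where n: "n = Suc k" using degree_monic_char_poly[OF Cons.prems(1)] by auto
  have cp: "char_poly A = [:- e, 1:] * (\<Prod>e\<leftarrow>es. [:- e, 1:])"
    unfolding Cons.prems(3) list.map prod_list.Cons ..
  have x: "x \<in> carrier_vec (Suc k)" using Cons.prems(5) n by simp
  obtain v B R where B: "B \<in> carrier_mat k k" "transpose_mat B = B"
    "char_poly B = (\<Prod>e\<leftarrow>es. [:- e, 1:])"
    and R: "\<And>x. x \<in> carrier_vec (Suc k) \<Longrightarrow> R x \<in> carrier_vec k"
    "\<And>x. x \<in> carrier_vec (Suc k) \<Longrightarrow> x \<bullet> (A *\<^sub>v x) = e * (v \<bullet> x)\<^sup>2 + R x \<bullet> (B *\<^sub>v R x)"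
    "\<And>x. x \<in> carrier_vec (Suc k) \<Longrightarrow> x \<bullet> x = (v \<bullet> x)\<^sup>2 + R x \<bullet> R x"
    using symmetric_deflation[OF Cons.prems(1)[unfolded n] Cons.prems(2) cp] by blast
  note * = B R(1)[OF x] R(2)[OF x] R(3)[OF x]
  have "R x \<bullet> (B *\<^sub>v R x) \<le> c * (R x \<bullet> R x)"
    by (rule Cons.IH[OF *(1,2,3) _ *(4)]) (use Cons.prems(4) in auto)
  moreover have "e * (v \<bullet> x)\<^sup>2 \<le> c * (v \<bullet> x)\<^sup>2" using Cons.prems(4)[of e] by (simp add: mult_right_mono)
  ultimately show ?case unfolding *(5,6) by (simp add: algebra_simps)
qed

text \<open>Over the complex numbers the polynomial splits. For an eigenvector \<open>v\<close> the
  value \<open>a * N\<close> is a Hermitian form, hence real, and \<open>N\<close> is a positive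
  real, so every root \<open>a\<close> is real; injectivity of the embedding carries the
  factorization back.\<close>

lemma symmetric_char_poly_splits:
  fixes A :: "real mat"
  assumes A: "A \<in> carrier_mat n n" and sym: "transpose_mat A = A"
  obtains es where "char_poly A = (\<Prod>e\<leftarrow>es. [:- e, 1:])" "length es = n"
proof -
  let ?A = "map_mat complex_of_real A"
  have cA: "?A \<in> carrier_mat n n" using A by simp
  obtain as where as: "char_poly ?A = (\<Prod>a\<leftarrow>as. [:- a, 1:])" "length as = n"
    using char_poly_factorized[OF cA] by auto
  have Aij: "A $$ (i,j) = A $$ (j,i)" if "i < n" "j < n" for i j
    using that sym A by (metis index_transpose_mat(1) carrier_matD)
  have real: "a \<in> \<real>" if "a \<in> set as" for a
  proof -
    have "poly (char_poly ?A) a = 0" unfolding as(1) using that by (simp add: linear_poly_root)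
    then obtain v where v: "v \<in> carrier_vec n" "v \<noteq> 0\<^sub>v n" "?A *\<^sub>v v = a \<cdot>\<^sub>v v"
      using eigenvalue_root_char_poly[OF cA] cA unfolding eigenvalue_def eigenvector_def by auto
    define N where "N = (\<Sum>i<n. cnj (v $ i) * v $ i)"
    have "a * N = (\<Sum>i<n. cnj (v $ i) * (a * v $ i))" unfolding N_def by (simp add: sum_distrib_left mult_ac)
    also have "\<dots> = (\<Sum>i<n. cnj (v $ i) * (\<Sum>j<n. of_real (A $$ (i,j)) * v $ j))"
    proof (rule sum.cong[OF refl])
      fix i assume "i \<in> {..<n}"
      then have i: "i < n" by simp
      have "a * v $ i = (?A *\<^sub>v v) $ i" using v i by simp
      also have "\<dots> = (\<Sum>j<n. of_real (A $$ (i,j)) * v $ j)"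
        using i v(1) A by (simp add: scalar_prod_def lessThan_atLeast0)
      finally show "cnj (v $ i) * (a * v $ i) = cnj (v $ i) * (\<Sum>j<n. of_real (A $$ (i,j)) * v $ j)" by simp
    qed
    finally have aN: "a * N = (\<Sum>i<n. \<Sum>j<n. of_real (A $$ (i,j)) * (cnj (v $ i) * v $ j))"
      by (simp add: sum_distrib_left mult_ac)
    have "cnj (a * N) = (\<Sum>i<n. \<Sum>j<n. of_real (A $$ (i,j)) * (v $ i * cnj (v $ j)))"
      unfolding aN by simp
    also have "\<dots> = (\<Sum>j<n. \<Sum>i<n. of_real (A $$ (i,j)) * (v $ i * cnj (v $ j)))" by (rule sum.swap)
    also have "\<dots> = a * N" unfolding aN by (intro sum.cong refl) (auto simp: Aij mult_ac)
    finally have 1: "cnj a * cnj N = a * N" by simp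
    have N: "N = of_real (\<Sum>i<n. (cmod (v $ i))\<^sup>2)"
      unfolding N_def by (simp add: complex_norm_square[symmetric] mult.commute)
    obtain i where i: "i < n" "v $ i \<noteq> 0" using v(1,2) by (metis eq_vecI carrier_vecD index_zero_vec)
    have "(\<Sum>i<n. (cmod (v $ i))\<^sup>2) > 0"
      by (rule sum_pos2[of _ i]) (use i in auto)
    then have "N \<noteq> 0" "cnj N = N" unfolding N by (auto simp del: of_real_sum of_real_power)
    then have "cnj a = a" using 1 by simp
    then show ?thesis by (simp add: Reals_cnj_iff)
  qed
  define es where "es = map Re as"
  have as_es: "as = map complex_of_real es"
    unfolding es_def map_map by (rule map_idI[symmetric]) (use real in \<open>simp add: of_real_Re\<close>)
  interpret hp: map_poly_inj_comm_ring_hom complex_of_real ..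
  have "map_poly complex_of_real (char_poly A) = char_poly ?A"
    by (rule of_real_hom.char_poly_hom[OF A, symmetric])
  also have "\<dots> = map_poly complex_of_real (\<Prod>e\<leftarrow>es. [:- e, 1:])"
    unfolding as(1) as_es by (simp add: hp.hom_prod_list comp_def)
  finally have "char_poly A = (\<Prod>e\<leftarrow>es. [:- e, 1:])"
    by (rule hp.injectivity)
  then show ?thesis using that[of es] as(2) by (simp add: es_def)
qed

lemma proots_prod_linear: "proots (\<Prod>e\<leftarrow>es. [:- e, 1:] :: 'a :: field poly) = mset es"
proof (induction es)
  case (Cons e es)
  have "(\<Prod>e\<leftarrow>es. [:- e, 1:]) \<noteq> 0" by (auto simp: prod_list_zero_iff)
  moreover have "[:- e, 1:] \<noteq> 0" by simp
  ultimately have "proots (\<Prod>e\<leftarrow>e # es. [:- e, 1:]) = proots [:- e, 1:] + proots (\<Prod>e\<leftarrow>es. [:- e, 1:])"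
    by (simp only: list.map prod_list.Cons, intro proots_mult)
  then show ?case using Cons.IH by (simp add: proots_linear_factor)
qed simp

text \<open>Deflating by the largest root leaves a matrix whose roots are the remaining ones, the
  largest of which is the entry at index 1 of the descending list. On vectors orthogonal to
  \<open>v\<close> only the form of this smaller matrix remains.\<close>

lemma second_largest_eigenvalue_le:
  fixes A :: "real mat"
  assumes A: "A \<in> carrier_mat n n" and sym: "transpose_mat A = A" and n: "n \<ge> 2"
  obtains v l where "v \<in> carrier_vec n" "v \<bullet> v = 1" "A *\<^sub>v v = l \<cdot>\<^sub>v v"
    "\<And>x. x \<in> carrier_vec n \<Longrightarrow> v \<bullet> x = 0 \<Longrightarrow> x \<bullet> (A *\<^sub>v x) \<le> second_largest_eigenvalue A * (x \<bullet> x)"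
proof -
  obtain es0 where es0: "char_poly A = (\<Prod>e\<leftarrow>es0. [:- e, 1:])" "length es0 = n"
    using symmetric_char_poly_splits[OF A sym] .
  define es where "es = rev (sort es0)"
  have ms: "mset es = mset es0" by (simp add: es_def)
  have cp: "char_poly A = (\<Prod>e\<leftarrow>es. [:- e, 1:])"
    unfolding es0(1) using ms by (metis mset_map prod_mset_prod_list)
  have len: "length es = n" using es0 by (simp add: es_def)
  have l2: "second_largest_eigenvalue A = es ! 1"
    unfolding second_largest_eigenvalue_def es0(1) proots_prod_linear es_def
    by (simp add: sorted_list_of_multiset_mset)
  obtain e1 e2 es' where es: "es = e1 # e2 # es'"
    using len n by (metis (no_types) Suc_le_length_iff numeral_2_eq_2)
  have srt: "sorted (rev es)" by (simp add: es_def)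
  obtain k where k: "n = Suc k" using n by (cases n) auto
  have cp': "char_poly A = [:- e1, 1:] * (\<Prod>e\<leftarrow>e2 # es'. [:- e, 1:])"
    unfolding cp es list.map prod_list.Cons ..
  obtain v B R where *:
    "v \<in> carrier_vec (Suc k)" "v \<bullet> v = 1" "A *\<^sub>v v = e1 \<cdot>\<^sub>v v"
    "B \<in> carrier_mat k k" "transpose_mat B = B" "char_poly B = (\<Prod>e\<leftarrow>e2 # es'. [:- e, 1:])"
    "\<And>x. x \<in> carrier_vec (Suc k) \<Longrightarrow> R x \<in> carrier_vec k"
    "\<And>x. x \<in> carrier_vec (Suc k) \<Longrightarrow> x \<bullet> (A *\<^sub>v x) = e1 * (v \<bullet> x)\<^sup>2 + R x \<bullet> (B *\<^sub>v R x)"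
    "\<And>x. x \<in> carrier_vec (Suc k) \<Longrightarrow> x \<bullet> x = (v \<bullet> x)\<^sup>2 + R x \<bullet> R x"
    using symmetric_deflation[OF A[unfolded k] sym cp'] by blast
  have "x \<bullet> (A *\<^sub>v x) \<le> second_largest_eigenvalue A * (x \<bullet> x)"
    if x: "x \<in> carrier_vec n" "v \<bullet> x = 0" for x
  proof -
    have x': "x \<in> carrier_vec (Suc k)" using x k by simp
    have "R x \<bullet> (B *\<^sub>v R x) \<le> es ! 1 * (R x \<bullet> R x)"
      by (rule rayleigh_le[OF *(4,5,6) _ *(7)[OF x']])
        (use srt in \<open>auto simp: es sorted_append\<close>)
    then show ?thesis using *(8,9)[OF x'] x(2) l2 by simp
  qed
  then show ?thesis using that[of v e1] *(1-3) k by simp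
qed

subsection \<open>Monotonicity in the field and lower tails\<close>

text \<open>The Ahlswede-Daykin inequality over a one-element set. Only the mixed terms need an
  argument: each is at most \<open>p = c1 * d0\<close>, and their product is at most
  \<open>p * (c0 * d1)\<close>, so expanding the nonnegative product of their distances from
  \<open>p\<close> bounds their sum.\<close>

lemma four_functions_two_point:
  fixes a0 a1 b0 b1 c0 c1 d0 d1 :: real
  assumes nn: "0 \<le> a0" "0 \<le> a1" "0 \<le> b0" "0 \<le> b1" "0 \<le> c0" "0 \<le> c1" "0 \<le> d0" "0 \<le> d1"
    and h: "a0 * b0 \<le> c0 * d0" "a0 * b1 \<le> c1 * d0" "a1 * b0 \<le> c1 * d0" "a1 * b1 \<le> c1 * d1"
  shows "(a0 + a1) * (b0 + b1) \<le> (c0 + c1) * (d0 + d1)"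
proof -
  have prods: "(a0 * b1) * (a1 * b0) \<le> (c0 * d0) * (c1 * d1)"
  proof -
    have "(a0 * b0) * (a1 * b1) \<le> (c0 * d0) * (c1 * d1)"
      by (rule mult_mono) (use nn h in auto)
    then show ?thesis by (simp add: mult_ac)
  qed
  have "a0 * b1 + a1 * b0 \<le> c1 * d0 + c0 * d1"
  proof (cases "c1 * d0 = 0")
    case True
    have "a0 * b1 \<ge> 0" "a1 * b0 \<ge> 0" using nn by auto
    then have "a0 * b1 = 0" "a1 * b0 = 0" using h(2,3) True by linarith+
    then show ?thesis using nn by (metis add.right_neutral add_nonneg_nonneg mult_nonneg_nonneg)
  next
    case False
    define p where "p = c1 * d0"
    have p: "p > 0" using False nn by (simp add: p_def less_le)
    have "0 \<le> (p - a0 * b1) * (p - a1 * b0)" by (rule mult_nonneg_nonneg) (use h p_def in auto)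
    then have "p * (a0 * b1 + a1 * b0) \<le> p * p + (a0 * b1) * (a1 * b0)" by (simp add: algebra_simps)
    also have "\<dots> \<le> p * p + p * (c0 * d1)" using prods by (simp add: p_def mult_ac)
    finally have "p * (a0 * b1 + a1 * b0) \<le> p * (p + c0 * d1)" by (simp add: algebra_simps)
    then have "a0 * b1 + a1 * b0 \<le> p + c0 * d1" using p by (rule mult_left_le_imp_le)
    then show ?thesis by (simp add: p_def)
  qed
  then show ?thesis using h(1,4) by (simp add: algebra_simps)
qed

text \<open>The Ahlswede-Daykin theorem. Summing all four functions over the membership of one
  element \<open>x\<close> preserves the hypothesis, which is exactly the two-point case.\<close>

theorem four_functions:
  fixes \<alpha> \<beta> \<gamma> \<delta> :: "'a set \<Rightarrow> real"
  assumes "finite S"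
    and "\<And>A. 0 \<le> \<alpha> A" "\<And>A. 0 \<le> \<beta> A" "\<And>A. 0 \<le> \<gamma> A" "\<And>A. 0 \<le> \<delta> A"
    and "\<And>A B. A \<subseteq> S \<Longrightarrow> B \<subseteq> S \<Longrightarrow> \<alpha> A * \<beta> B \<le> \<gamma> (A \<union> B) * \<delta> (A \<inter> B)"
  shows "(\<Sum>A\<in>Pow S. \<alpha> A) * (\<Sum>A\<in>Pow S. \<beta> A) \<le> (\<Sum>A\<in>Pow S. \<gamma> A) * (\<Sum>A\<in>Pow S. \<delta> A)"
  using assms
proof (induction S arbitrary: \<alpha> \<beta> \<gamma> \<delta> rule: finite_induct)
  case empty
  then show ?case by (metis Pow_empty Un_empty_right Int_absorb empty_subsetI finite.emptyI sum.empty sum.insert insert_absorb insert_not_empty add.right_neutral)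
next
  case (insert x S)
  have split: "(\<Sum>A\<in>Pow (insert x S). f A) = (\<Sum>A\<in>Pow S. f A + f (insert x A))" for f :: "'a set \<Rightarrow> real"
  proof -
    have "inj_on (insert x) (Pow S)" using insert.hyps(2) by (auto simp: inj_on_def)
    moreover have "Pow S \<inter> insert x ` Pow S = {}" using insert.hyps(2) by auto
    ultimately show ?thesis
      using insert.hyps(1) by (simp add: Pow_insert sum.union_disjoint sum.reindex sum.distrib)
  qed
  show ?case unfolding split
  proof (rule insert.IH)
    fix A B assume AB: "A \<subseteq> S" "B \<subseteq> S"
    then have x: "x \<notin> A" "x \<notin> B" using insert.hyps(2) by auto
    note H = insert.prems(5)
    show "(\<alpha> A + \<alpha> (insert x A)) * (\<beta> B + \<beta> (insert x B))
        \<le> (\<gamma> (A \<union> B) + \<gamma> (insert x (A \<union> B))) * (\<delta> (A \<inter> B) + \<delta> (insert x (A \<inter> B)))"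
    proof (rule four_functions_two_point)
      show "\<alpha> A * \<beta> B \<le> \<gamma> (A \<union> B) * \<delta> (A \<inter> B)" using H[of A B] AB by blast
      show "\<alpha> A * \<beta> (insert x B) \<le> \<gamma> (insert x (A \<union> B)) * \<delta> (A \<inter> B)"
        using H[of A "insert x B"] AB x by (auto simp: subset_insertI2)
      show "\<alpha> (insert x A) * \<beta> B \<le> \<gamma> (insert x (A \<union> B)) * \<delta> (A \<inter> B)"
        using H[of "insert x A" B] AB x by (auto simp: subset_insertI2)
      show "\<alpha> (insert x A) * \<beta> (insert x B) \<le> \<gamma> (insert x (A \<union> B)) * \<delta> (insert x (A \<inter> B))"
        using H[of "insert x A" "insert x B"] subset_insertI2[OF AB(1), of x] subset_insertI2[OF AB(2), of x] by simp
    qed (use insert.prems in auto)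
  qed (use insert.prems in auto)
qed

section \<open>Gibbs means over sets of plus spins, and their dependence on the field\<close>

definition spin :: "nat set \<Rightarrow> nat \<Rightarrow> real" where
  "spin A i = (if i \<in> A then 1 else -1)"

definition energy :: "nat \<Rightarrow> (nat \<Rightarrow> nat \<Rightarrow> real) \<Rightarrow> (nat \<Rightarrow> real) \<Rightarrow> nat set \<Rightarrow> real" where
  "energy n Q \<mu> A = (\<Sum>i<n. \<Sum>j<n. Q i j * spin A i * spin A j) / 2 + (\<Sum>i<n. \<mu> i * spin A i)"

text \<open>Configurations are encoded as the set of sites with spin 1, so that union and
  intersection are the lattice operations required by \<open>four_functions\<close>.\<close>

definition gibbs_sum :: "nat \<Rightarrow> (nat \<Rightarrow> nat \<Rightarrow> real) \<Rightarrow> (nat \<Rightarrow> real) \<Rightarrow> (nat set \<Rightarrow> real) \<Rightarrow> real" where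
  "gibbs_sum n Q \<mu> f = (\<Sum>A\<in>Pow {..<n}. exp (energy n Q \<mu> A) * f A)"

definition gibbs_mean :: "nat \<Rightarrow> (nat \<Rightarrow> nat \<Rightarrow> real) \<Rightarrow> (nat \<Rightarrow> real) \<Rightarrow> (nat set \<Rightarrow> real) \<Rightarrow> real" where
  "gibbs_mean n Q \<mu> f = gibbs_sum n Q \<mu> f / gibbs_sum n Q \<mu> (\<lambda>_. 1)"

lemma abs_spin [simp]: "\<bar>spin A i\<bar> = 1"
  by (simp add: spin_def)

lemma spin_mono: "A \<subseteq> B \<Longrightarrow> spin A i \<le> spin B i"
  by (auto simp: spin_def)

lemma gibbs_sum_one_pos: "gibbs_sum n Q \<mu> (\<lambda>_. 1) > 0"
  unfolding gibbs_sum_def by (rule sum_pos) auto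

text \<open>Ferromagnetic terms are supermodular pair by pair; the field terms are modular and
  cancel.\<close>

lemma energy_supermodular:
  assumes "\<And>i j. i < n \<Longrightarrow> j < n \<Longrightarrow> 0 \<le> Q i j"
  shows "energy n Q \<mu> A + energy n Q \<mu> B \<le> energy n Q \<mu> (A \<union> B) + energy n Q \<mu> (A \<inter> B)"
proof -
  have "(\<Sum>i<n. \<Sum>j<n. Q i j * spin A i * spin A j) + (\<Sum>i<n. \<Sum>j<n. Q i j * spin B i * spin B j)
     \<le> (\<Sum>i<n. \<Sum>j<n. Q i j * spin (A \<union> B) i * spin (A \<union> B) j) + (\<Sum>i<n. \<Sum>j<n. Q i j * spin (A \<inter> B) i * spin (A \<inter> B) j)"
    unfolding sum.distrib[symmetric]
  proof (intro sum_mono)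
    fix i j assume "i \<in> {..<n}" "j \<in> {..<n}"
    then have "0 \<le> Q i j" using assms by auto
    then show "Q i j * spin A i * spin A j + Q i j * spin B i * spin B j
      \<le> Q i j * spin (A \<union> B) i * spin (A \<union> B) j + Q i j * spin (A \<inter> B) i * spin (A \<inter> B) j"
      by (auto simp: spin_def)
  qed
  moreover have "(\<Sum>i<n. \<mu> i * spin A i) + (\<Sum>i<n. \<mu> i * spin B i)
      = (\<Sum>i<n. \<mu> i * spin (A \<union> B) i) + (\<Sum>i<n. \<mu> i * spin (A \<inter> B) i)"
    unfolding sum.distrib[symmetric] by (rule sum.cong) (auto simp: spin_def)
  ultimately show ?thesis unfolding energy_def by linarith
qed

lemma energy_field_diff: "energy n Q \<mu>' A = energy n Q \<mu> A + (\<Sum>i<n. (\<mu>' i - \<mu> i) * spin A i)"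
  by (simp add: energy_def sum_subtractf algebra_simps)

text \<open>One application of \<open>four_functions\<close>, with \<open>f\<close> attached to the
  lower field on the left and to the higher field on the right, compares the two means directly. The
  union can carry the higher field because \<open>\<mu>' - \<mu>\<close> is nonnegative and spins
  increase with the set.\<close>

theorem gibbs_mean_mono_field:
  assumes Q: "\<And>i j. i < n \<Longrightarrow> j < n \<Longrightarrow> 0 \<le> Q i j"
    and \<mu>: "\<And>i. i < n \<Longrightarrow> \<mu> i \<le> \<mu>' i"
    and f: "\<And>A. 0 \<le> f A" "\<And>A B. A \<subseteq> B \<Longrightarrow> f A \<le> f B"
  shows "gibbs_mean n Q \<mu> f \<le> gibbs_mean n Q \<mu>' f"
proof -
  have "gibbs_sum n Q \<mu> f * gibbs_sum n Q \<mu>' (\<lambda>_. 1) \<le> gibbs_sum n Q \<mu>' f * gibbs_sum n Q \<mu> (\<lambda>_. 1)"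
    unfolding gibbs_sum_def
  proof (rule four_functions)
    fix A B :: "nat set" assume "A \<subseteq> {..<n}" "B \<subseteq> {..<n}"
    have "(\<Sum>i<n. (\<mu>' i - \<mu> i) * spin B i) \<le> (\<Sum>i<n. (\<mu>' i - \<mu> i) * spin (A \<union> B) i)"
      by (intro sum_mono mult_left_mono spin_mono) (use \<mu> in auto)
    then have "energy n Q \<mu> A + energy n Q \<mu>' B \<le> energy n Q \<mu>' (A \<union> B) + energy n Q \<mu> (A \<inter> B)"
      using energy_supermodular[of n Q \<mu> A B] Q
        energy_field_diff[of n Q \<mu>' B \<mu>] energy_field_diff[of n Q \<mu>' "A \<union> B" \<mu>] by fastforce
    then have "exp (energy n Q \<mu> A) * exp (energy n Q \<mu>' B)
        \<le> exp (energy n Q \<mu>' (A \<union> B)) * exp (energy n Q \<mu> (A \<inter> B))"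
      by (simp add: exp_add[symmetric])
    then have "(exp (energy n Q \<mu> A) * exp (energy n Q \<mu>' B)) * f A
        \<le> (exp (energy n Q \<mu>' (A \<union> B)) * exp (energy n Q \<mu> (A \<inter> B))) * f (A \<union> B)"
      by (rule mult_mono) (use f in auto)
    then show "exp (energy n Q \<mu> A) * f A * (exp (energy n Q \<mu>' B) * 1)
        \<le> exp (energy n Q \<mu>' (A \<union> B)) * f (A \<union> B) * (exp (energy n Q \<mu> (A \<inter> B)) * 1)"
      by (simp add: mult_ac)
  qed (use f in auto)
  then show ?thesis
    unfolding gibbs_mean_def using gibbs_sum_one_pos[of n Q \<mu>] gibbs_sum_one_pos[of n Q \<mu>']
    by (simp add: divide_simps mult_ac)
qed

lemma gibbs_sum_add: "gibbs_sum n Q \<mu> (\<lambda>A. f A + g A) = gibbs_sum n Q \<mu> f + gibbs_sum n Q \<mu> g"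
  by (simp add: gibbs_sum_def algebra_simps sum.distrib)

lemma gibbs_mean_add: "gibbs_mean n Q \<mu> (\<lambda>A. f A + g A) = gibbs_mean n Q \<mu> f + gibbs_mean n Q \<mu> g"
  by (simp add: gibbs_mean_def gibbs_sum_add add_divide_distrib)

lemma gibbs_mean_cmult: "gibbs_mean n Q \<mu> (\<lambda>A. c * f A) = c * gibbs_mean n Q \<mu> f"
  by (simp add: gibbs_mean_def gibbs_sum_def sum_distrib_left mult_ac)

lemma gibbs_mean_const: "gibbs_mean n Q \<mu> (\<lambda>A. c) = c"
  using gibbs_sum_one_pos[of n Q \<mu>]
  by (simp add: gibbs_mean_def gibbs_sum_def sum_distrib_right[symmetric])

lemma gibbs_mean_diff: "gibbs_mean n Q \<mu> (\<lambda>A. f A - g A) = gibbs_mean n Q \<mu> f - gibbs_mean n Q \<mu> g"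
  using gibbs_mean_add[of n Q \<mu> f "\<lambda>A. - 1 * g A"] gibbs_mean_cmult[of n Q \<mu> "-1" g] by simp

lemma gibbs_mean_sum:
  "gibbs_mean n Q \<mu> (\<lambda>A. \<Sum>i\<in>I. f i A) = (\<Sum>i\<in>I. gibbs_mean n Q \<mu> (f i))"
proof (induction I rule: infinite_finite_induct)
  case (insert i I) then show ?case by (simp add: gibbs_mean_add)
qed (simp_all add: gibbs_mean_const)

lemma gibbs_mean_mono:
  assumes "\<And>A. A \<subseteq> {..<n} \<Longrightarrow> f A \<le> g A"
  shows "gibbs_mean n Q \<mu> f \<le> gibbs_mean n Q \<mu> g"
  unfolding gibbs_mean_def gibbs_sum_def
  by (intro divide_right_mono sum_mono mult_left_mono sum_nonneg) (use assms in auto)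

lemma gibbs_mean_nonneg:
  assumes "\<And>A. A \<subseteq> {..<n} \<Longrightarrow> 0 \<le> f A"
  shows "0 \<le> gibbs_mean n Q \<mu> f"
  using gibbs_mean_mono[of n "\<lambda>_. 0" f Q \<mu>] assms gibbs_mean_const[of n Q \<mu> 0] by simp

lemma gibbs_mean_cong:
  assumes "\<And>A. A \<subseteq> {..<n} \<Longrightarrow> f A = g A"
  shows "gibbs_mean n Q \<mu> f = gibbs_mean n Q \<mu> g"
proof -
  have "gibbs_sum n Q \<mu> f = gibbs_sum n Q \<mu> g"
    unfolding gibbs_sum_def by (rule sum.cong) (use assms in auto)
  then show ?thesis by (simp add: gibbs_mean_def)
qed

lemma gibbs_mean_abs: "\<bar>gibbs_mean n Q \<mu> f\<bar> \<le> gibbs_mean n Q \<mu> (\<lambda>A. \<bar>f A\<bar>)"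
proof (rule abs_leI)
  show "gibbs_mean n Q \<mu> f \<le> gibbs_mean n Q \<mu> (\<lambda>A. \<bar>f A\<bar>)"
    by (rule gibbs_mean_mono) simp
  have "gibbs_mean n Q \<mu> (\<lambda>A. -1 * f A) \<le> gibbs_mean n Q \<mu> (\<lambda>A. \<bar>f A\<bar>)"
    by (rule gibbs_mean_mono) simp
  then show "- gibbs_mean n Q \<mu> f \<le> gibbs_mean n Q \<mu> (\<lambda>A. \<bar>f A\<bar>)"
    unfolding gibbs_mean_cmult by simp
qed

text \<open>The two unnormalized weights differ by the factor exp (r X). On the event this factor is
  at most exp (r t), while Jensen bounds the ratio of the normalizers below by exp (r m); the
  quotient is the bound, so only a mean has to be known.\<close>

lemma gibbs_lower_tail:
  fixes Q :: "nat \<Rightarrow> nat \<Rightarrow> real" and n :: nat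
  assumes r: "r \<ge> 0"
  defines "X \<equiv> \<lambda>A. (\<Sum>i<n. spin A i) / real n"
  shows "gibbs_mean n Q \<mu> (\<lambda>A. if X A < t then 1 else 0)
    \<le> exp (r * (t - gibbs_mean n Q (\<lambda>i. \<mu> i - r / n) X))"
proof -
  let ?\<mu> = "\<lambda>i. \<mu> i - r / n"
  define m where "m = gibbs_mean n Q ?\<mu> X"
  have tilt: "exp (energy n Q \<mu> A) = exp (energy n Q ?\<mu> A) * exp (r * X A)" for A
    by (simp add: energy_field_diff[of n Q \<mu> A ?\<mu>] exp_add X_def sum_distrib_left[symmetric] sum_divide_distrib[symmetric])
  have Z: "gibbs_sum n Q \<mu> (\<lambda>_. 1) \<ge> exp (r * m) * gibbs_sum n Q ?\<mu> (\<lambda>_. 1)"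
  proof -
    \<comment> \<open>Tangent line of the exponential at \<open>m\<close>; its linear part has mean
      zero under the lowered field.\<close>
    have "exp (r * m) * (1 + r * (X A - m)) \<le> exp (r * X A)" for A
    proof -
      have "exp (r * m) * (1 + r * (X A - m)) \<le> exp (r * m) * exp (r * (X A - m))"
        by (intro mult_left_mono exp_ge_add_one_self) auto
      then show ?thesis by (simp add: exp_add[symmetric] algebra_simps)
    qed
    then have "gibbs_mean n Q ?\<mu> (\<lambda>A. exp (r * m) * (1 + r * (X A - m))) \<le> gibbs_mean n Q ?\<mu> (\<lambda>A. exp (r * X A))"
      by (intro gibbs_mean_mono)
    also have "gibbs_mean n Q ?\<mu> (\<lambda>A. exp (r * m) * (1 + r * (X A - m))) = exp (r * m)"
      by (simp add: gibbs_mean_cmult gibbs_mean_add gibbs_mean_diff gibbs_mean_const m_def)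
    finally show ?thesis
      using gibbs_sum_one_pos[of n Q ?\<mu>]
      by (simp add: gibbs_mean_def gibbs_sum_def tilt divide_simps)
  qed
  have "gibbs_sum n Q \<mu> (\<lambda>A. if X A < t then 1 else 0) \<le> exp (r * t) * gibbs_sum n Q ?\<mu> (\<lambda>_. 1)"
    unfolding gibbs_sum_def sum_distrib_left
  proof (rule sum_mono)
    fix A
    have "exp (r * X A) \<le> exp (r * t)" if "X A < t" using that r by (simp add: mult_left_mono)
    then show "exp (energy n Q \<mu> A) * (if X A < t then 1 else 0) \<le> exp (r * t) * (exp (energy n Q ?\<mu> A) * 1)"
      by (simp add: tilt mult.commute)
  qed
  then have "gibbs_mean n Q \<mu> (\<lambda>A. if X A < t then 1 else 0)
      \<le> exp (r * t) * gibbs_sum n Q ?\<mu> (\<lambda>_. 1) / gibbs_sum n Q \<mu> (\<lambda>_. 1)"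
    unfolding gibbs_mean_def by (intro divide_right_mono) (use gibbs_sum_one_pos[of n Q \<mu>] in auto)
  also have "\<dots> \<le> exp (r * t) * gibbs_sum n Q ?\<mu> (\<lambda>_. 1) / (exp (r * m) * gibbs_sum n Q ?\<mu> (\<lambda>_. 1))"
    by (intro divide_left_mono Z mult_nonneg_nonneg mult_pos_pos gibbs_sum_one_pos) (use gibbs_sum_one_pos[of n Q ?\<mu>] in auto)
  also have "\<dots> = exp (r * (t - m))"
    using gibbs_sum_one_pos[of n Q ?\<mu>] by (simp add: exp_diff algebra_simps)
  finally show ?thesis by (simp add: m_def)
qed

subsection \<open>Elementary inequalities\<close>

lemma tanh_dist_le: "\<bar>tanh x - tanh y\<bar> \<le> \<bar>x - y\<bar>" for x y :: real
proof -
  have main: "tanh a - tanh b \<le> a - b" if "b \<le> a" for a b :: real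
  proof -
    have "b - tanh b \<le> a - tanh a"
    proof (rule DERIV_nonneg_imp_nondecreasing[OF that])
      fix x :: real
      show "\<exists>y. ((\<lambda>x. x - tanh x) has_real_derivative y) (at x) \<and> 0 \<le> y"
        by (rule exI[of _ "(tanh x)\<^sup>2"]) (auto intro!: derivative_eq_intros)
    qed
    then show ?thesis by simp
  qed
  show ?thesis
    using main[of x y] main[of y x] tanh_real_le_iff[of x y] tanh_real_le_iff[of y x] by linarith
qed

text \<open>Both bounds follow from monotonicity on [0, 3], the range of the local fields. For the
  upper one the derivative contains the factor 729 (1 - tanh^2) - 1, and 1 - tanh^2 = 1 / cosh^2 is
  at least 1 / 27^2 because cosh x \<le> exp 3 \<le> 27; hence 243 = 27^2 / 3.\<close>

lemma sub_tanh_bounds_nonneg: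
  fixes y :: real
  assumes "0 \<le> y" "y \<le> 3"
  shows "tanh y ^ 3 / 3 \<le> y - tanh y" "y - tanh y \<le> 243 * tanh y ^ 3"
proof -
  have "0 - tanh 0 - tanh 0 ^ 3 / 3 \<le> y - tanh y - tanh y ^ 3 / 3"
  proof (rule DERIV_nonneg_imp_nondecreasing[OF assms(1)])
    fix x :: real
    have "((\<lambda>x. x - tanh x - tanh x ^ 3 / 3) has_real_derivative (tanh x)\<^sup>2 * (tanh x)\<^sup>2) (at x)"
      by (auto intro!: derivative_eq_intros simp: power2_eq_square power3_eq_cube field_simps)
    then show "\<exists>y. ((\<lambda>x. x - tanh x - tanh x ^ 3 / 3) has_real_derivative y) (at x) \<and> 0 \<le> y"
      by (intro exI[of _ "(tanh x)\<^sup>2 * (tanh x)\<^sup>2"]) auto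
  qed
  then show "tanh y ^ 3 / 3 \<le> y - tanh y" by simp
  have "243 * tanh 0 ^ 3 - 0 + tanh 0 \<le> 243 * tanh y ^ 3 - y + tanh y"
  proof (rule DERIV_nonneg_imp_nondecreasing[OF assms(1)])
    fix x :: real assume x: "0 \<le> x" "x \<le> y"
    have "cosh x \<le> exp x" using x by (simp add: cosh_def field_simps)
    also have "\<dots> \<le> exp 3" using x assms by simp
    also have "exp (3::real) = exp 1 ^ 3" by (simp add: exp_of_nat_mult[symmetric])
    also have "\<dots> \<le> 3 ^ 3" by (intro power_mono exp_le) auto
    finally have "(cosh x)\<^sup>2 \<le> (27::real)\<^sup>2" by (intro power_mono) auto
    then have "1 / (27::real)\<^sup>2 \<le> 1 / (cosh x)\<^sup>2" by (intro divide_left_mono) (auto simp: cosh_real_nonzero)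
    also have "1 / (cosh x)\<^sup>2 = 1 - (tanh x)\<^sup>2"
    proof -
      have "1 - (tanh x)\<^sup>2 = ((cosh x)\<^sup>2 - (sinh x)\<^sup>2) / (cosh x)\<^sup>2"
        by (simp add: tanh_def power_divide diff_divide_distrib)
      then show ?thesis using hyperbolic_pythagoras[of x] by simp
    qed
    finally have s: "0 \<le> 729 * (1 - (tanh x)\<^sup>2) - 1" by simp
    have "((\<lambda>x. 243 * tanh x ^ 3 - x + tanh x) has_real_derivative (tanh x)\<^sup>2 * (729 * (1 - (tanh x)\<^sup>2) - 1)) (at x)"
      by (auto intro!: derivative_eq_intros simp: power2_eq_square power3_eq_cube algebra_simps)
    then show "\<exists>y. ((\<lambda>x. 243 * tanh x ^ 3 - x + tanh x) has_real_derivative y) (at x) \<and> 0 \<le> y"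
      using s by (intro exI[of _ "(tanh x)\<^sup>2 * (729 * (1 - (tanh x)\<^sup>2) - 1)"]) auto
  qed
  then show "y - tanh y \<le> 243 * tanh y ^ 3" by simp
qed

lemma abs_sub_tanh_le:
  fixes y :: real
  assumes "\<bar>y\<bar> \<le> 3"
  shows "\<bar>y - tanh y\<bar> \<le> 243 * \<bar>tanh y\<bar> ^ 3"
proof (cases "y \<ge> 0")
  case True
  then show ?thesis using sub_tanh_bounds_nonneg[of y] assms by simp
next
  case False
  then show ?thesis using sub_tanh_bounds_nonneg[of "- y"] assms by (simp add: power3_eq_cube)
qed

lemma tanh_mult_sub_tanh_nonneg:
  fixes y :: real
  assumes "\<bar>y\<bar> \<le> 3"
  shows "0 \<le> tanh y * (y - tanh y)"
proof (cases "y \<ge> 0")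
  case True
  then show ?thesis using sub_tanh_bounds_nonneg[of y] assms
    by (intro mult_nonneg_nonneg) (auto intro: order_trans[rotated])
next
  case False
  then show ?thesis using sub_tanh_bounds_nonneg[of "- y"] assms
    by (intro mult_nonpos_nonpos) (auto simp: power3_eq_cube intro: order_trans)
qed

lemma cube_add_le: "\<bar>a + b\<bar> ^ 3 \<le> 4 * (\<bar>a\<bar> ^ 3 + \<bar>b\<bar> ^ 3)" for a b :: real
proof -
  have "\<bar>a + b\<bar> ^ 3 \<le> (\<bar>a\<bar> + \<bar>b\<bar>) ^ 3" by (intro power_mono) auto
  moreover have "4 * (\<bar>a\<bar> ^ 3 + \<bar>b\<bar> ^ 3) - (\<bar>a\<bar> + \<bar>b\<bar>) ^ 3 = 3 * (\<bar>a\<bar> + \<bar>b\<bar>) * (\<bar>a\<bar> - \<bar>b\<bar>)\<^sup>2"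
    by (simp add: power2_eq_square power3_eq_cube algebra_simps)
  moreover have "0 \<le> 3 * (\<bar>a\<bar> + \<bar>b\<bar>) * (\<bar>a\<bar> - \<bar>b\<bar>)\<^sup>2" by simp
  ultimately show ?thesis by linarith
qed

text \<open>If \<open>tanh y\<close> is at least \<open>T / 2\<close>, the cubic lower bound gives
  \<open>T ^ 3 / 24\<close>. Otherwise \<open>tanh y\<close> is at distance more than
  \<open>T / 2\<close> from \<open>T\<close>, and the error term pays for \<open>T ^ 3 / 24\<close>
  and, if \<open>y\<close> is negative, also for 243 cubes of \<open>tanh y\<close>; hence 244 = 243
  + 1.\<close>

lemma sub_tanh_ge_of_center:
  fixes y T :: real
  assumes y: "\<bar>y\<bar> \<le> 3" and T: "0 \<le> T"
  shows "T ^ 3 / 24 - 244 * \<bar>tanh y - T\<bar> ^ 3 \<le> y - tanh y"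
proof (cases "T / 2 \<le> tanh y")
  case True
  then have "0 \<le> tanh y" using T by linarith
  then have y0: "0 \<le> y" by simp
  have "(T / 2) ^ 3 \<le> tanh y ^ 3" using True T by (intro power_mono) auto
  then have "T ^ 3 / 8 \<le> tanh y ^ 3" by (simp add: power_divide)
  moreover have "0 \<le> 244 * \<bar>tanh y - T\<bar> ^ 3" by simp
  moreover have "tanh y ^ 3 / 3 \<le> y - tanh y" using sub_tanh_bounds_nonneg(1)[of y] y0 y by simp
  ultimately show ?thesis by linarith
next
  case False
  then have "(T / 2) ^ 3 \<le> \<bar>tanh y - T\<bar> ^ 3" using T by (intro power_mono) auto
  then have "T ^ 3 / 8 \<le> \<bar>tanh y - T\<bar> ^ 3" by (simp add: power_divide)
  moreover have "0 \<le> T ^ 3" using T by simp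
  ultimately have 1: "T ^ 3 / 24 \<le> \<bar>tanh y - T\<bar> ^ 3" by linarith
  show ?thesis
  proof (cases "y \<ge> 0")
    case True
    then have "0 \<le> y - tanh y" using tanh_dist_le[of y 0] by simp
    moreover have "0 \<le> \<bar>tanh y - T\<bar> ^ 3" by simp
    ultimately show ?thesis using 1 by linarith
  next
    case neg: False
    then have "\<bar>tanh y\<bar> ^ 3 \<le> \<bar>tanh y - T\<bar> ^ 3" using T by (intro power_mono) auto
    then show ?thesis using abs_sub_tanh_le[OF y] 1 by linarith
  qed
qed

lemma sub_tanh_le_of_center:
  fixes y T :: real
  assumes y: "\<bar>y\<bar> \<le> 3" and T: "T \<le> 0"
  shows "y - tanh y \<le> - (\<bar>T\<bar> ^ 3) / 24 + 244 * \<bar>tanh y - T\<bar> ^ 3"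
proof -
  have "\<bar>T - tanh y\<bar> = \<bar>tanh y - T\<bar>" by linarith
  then show ?thesis using sub_tanh_ge_of_center[of "- y" "- T"] assms by simp
qed

text \<open>Absorbs a linear term into a small multiple of the cube, at the cost of a cubic
  remainder in the coefficient; the threshold \<open>l = h * x\<close> decides which term
  dominates.\<close>

lemma young_cube:
  fixes x l h :: real
  assumes "0 \<le> x" "0 \<le> l" "0 < h"
  shows "l\<^sup>2 * x \<le> h\<^sup>2 * x ^ 3 + l ^ 3 / h"
proof (cases "l \<le> h * x")
  case True
  then have "l\<^sup>2 \<le> (h * x)\<^sup>2" using assms by (intro power_mono) auto
  then have "l\<^sup>2 * x \<le> (h * x)\<^sup>2 * x" using assms by (intro mult_right_mono) auto
  moreover have "0 \<le> l ^ 3 / h" using assms by simp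
  ultimately show ?thesis by (simp add: power_mult_distrib power3_eq_cube power2_eq_square mult_ac)
next
  case False
  then have "x \<le> l / h" using assms by (simp add: field_simps)
  then have "l\<^sup>2 * x \<le> l\<^sup>2 * (l / h)" using assms by (intro mult_left_mono) auto
  moreover have "0 \<le> h\<^sup>2 * x ^ 3" using assms by simp
  ultimately show ?thesis by (simp add: power3_eq_cube power2_eq_square mult_ac)
qed

lemma young_square_cube:
  fixes x a h :: real
  assumes "0 \<le> x" "0 \<le> a" "0 < h"
  shows "a * x\<^sup>2 \<le> h * x ^ 3 + a ^ 3 / h\<^sup>2"
proof (cases "a \<le> h * x")
  case True
  then have "a * x\<^sup>2 \<le> h * x * x\<^sup>2" using assms by (intro mult_right_mono) auto
  moreover have "0 \<le> a ^ 3 / h\<^sup>2" using assms by simp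
  ultimately show ?thesis by (simp add: power3_eq_cube power2_eq_square mult_ac)
next
  case False
  then have "x \<le> a / h" using assms by (simp add: field_simps)
  then have "x\<^sup>2 \<le> (a / h)\<^sup>2" using assms by (intro power_mono) auto
  then have "a * x\<^sup>2 \<le> a * (a / h)\<^sup>2" using assms by (intro mult_left_mono) auto
  moreover have "0 \<le> h * x ^ 3" using assms by simp
  ultimately show ?thesis by (simp add: power3_eq_cube power2_eq_square power_divide mult_ac)
qed

text \<open>The signed 3/2 power, whose square is the cube of the modulus. It is the substitution of
  Stroock-Varopoulos type that bounds the mixed difference form of \<open>t * \<bar>t\<bar>\<close>
  and \<open>t\<close> below by a genuine square, to which a spectral gap applies.\<close>

definition signed_pow32 :: "real \<Rightarrow> real" where
  "signed_pow32 t = t * sqrt \<bar>t\<bar>"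

lemma signed_pow32_sq: "(signed_pow32 t)\<^sup>2 = \<bar>t\<bar> ^ 3"
  by (simp add: signed_pow32_def power_mult_distrib power3_eq_cube power2_eq_square)

lemma signed_pow32_minus: "signed_pow32 (- t) = - signed_pow32 t"
  by (simp add: signed_pow32_def)

text \<open>Lets the average of the transformed values be written as the transform of some centre,
  so that deviations can be compared in the original scale.\<close>

lemma signed_pow32_surj: "\<exists>t. signed_pow32 t = z"
proof
  let ?r = "root 3 \<bar>z\<bar>"
  have "?r ^ 3 = \<bar>z\<bar>" by (simp add: real_root_pow_pos2)
  then have "?r * ?r * ?r = \<bar>z\<bar>" by (simp add: power3_eq_cube)
  moreover have "sqrt \<bar>sgn z * ?r\<^sup>2\<bar> = ?r" if "z \<noteq> 0"
    using that by (simp add: abs_mult abs_sgn_eq)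
  ultimately show "signed_pow32 (sgn z * ?r\<^sup>2) = z"
    by (cases "z = 0") (simp_all add: signed_pow32_def power2_eq_square mult.assoc sgn_mult_abs)
qed

text \<open>Both inequalities below become polynomial after substituting \<open>t = a\<^sup>2\<close>, \<open>s = b\<^sup>2\<close>.\<close>

lemma signed_square_mono:
  fixes t s :: real
  shows "2 / 3 * (signed_pow32 t - signed_pow32 s)\<^sup>2 \<le> (t * \<bar>t\<bar> - s * \<bar>s\<bar>) * (t - s)"
proof -
  have same: "2 / 3 * (signed_pow32 t - signed_pow32 s)\<^sup>2 \<le> (t * \<bar>t\<bar> - s * \<bar>s\<bar>) * (t - s)"
    if "0 \<le> t" "0 \<le> s" for t s
  proof -
    define a b where "a = sqrt t" and "b = sqrt s"
    have ab: "a \<ge> 0" "b \<ge> 0" "t = a * a" "s = b * b" using that by (auto simp: a_def b_def)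
    have "3 * ((a * a * (a * a) - b * b * (b * b)) * (a * a - b * b)) - 2 * (a * a * a - b * b * b)\<^sup>2
      = (a - b)\<^sup>2 * ((a * a - b * b)\<^sup>2 + 2 * a * b * (a + b)\<^sup>2 - 2 * a * b * a * b)"
      by (simp add: power2_eq_square algebra_simps)
    moreover have ab2: "2 * a * b * a * b \<le> 2 * a * b * (a + b)\<^sup>2"
    proof -
      have "2 * a * b * (a * b) \<le> 2 * a * b * (a + b)\<^sup>2"
        using ab by (intro mult_left_mono) (auto simp: power2_eq_square algebra_simps)
      then show ?thesis by (simp add: mult_ac)
    qed
    have "0 \<le> (a - b)\<^sup>2 * ((a * a - b * b)\<^sup>2 + 2 * a * b * (a + b)\<^sup>2 - 2 * a * b * a * b)"
      using ab2 zero_le_power2[of "a * a - b * b"] by (intro mult_nonneg_nonneg zero_le_power2) linarith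
    ultimately have "2 / 3 * (a * a * a - b * b * b)\<^sup>2 \<le> (a * a * (a * a) - b * b * (b * b)) * (a * a - b * b)"
      by linarith
    then show ?thesis using ab by (simp add: signed_pow32_def real_sqrt_mult mult_ac)
  qed
  have opp: "2 / 3 * (signed_pow32 t - signed_pow32 s)\<^sup>2 \<le> (t * \<bar>t\<bar> - s * \<bar>s\<bar>) * (t - s)"
    if "0 \<le> t" "s \<le> 0" for t s
  proof -
    define a b where "a = sqrt t" and "b = sqrt (- s)"
    have ab: "a \<ge> 0" "b \<ge> 0" "t = a * a" "s = - (b * b)" using that by (auto simp: a_def b_def)
    have "(a * a * (a * a) + b * b * (b * b)) * (a * a + b * b) - (a * a * a + b * b * b)\<^sup>2
      = (a * b * (a - b))\<^sup>2"
      by (simp add: power2_eq_square algebra_simps)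
    then have "(a * a * a + b * b * b)\<^sup>2 \<le> (a * a * (a * a) + b * b * (b * b)) * (a * a + b * b)"
      using zero_le_power2[of "a * b * (a - b)"] by linarith
    then have "2 / 3 * (a * a * a + b * b * b)\<^sup>2 \<le> (a * a * (a * a) + b * b * (b * b)) * (a * a + b * b)"
      using zero_le_power2[of "a * a * a + b * b * b"] by linarith
    then show ?thesis using ab by (simp add: signed_pow32_def real_sqrt_mult mult_ac)
  qed
  consider "0 \<le> t" "0 \<le> s" | "0 \<le> t" "s \<le> 0" | "t \<le> 0" "0 \<le> s" | "t \<le> 0" "s \<le> 0" by linarith
  then show ?thesis
  proof cases
    case 3
    then show ?thesis using opp[of s t] by (simp add: power2_commute algebra_simps)
  next
    case 4
    then show ?thesis using same[of "-t" "-s"]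
      by (simp add: signed_pow32_minus power2_commute algebra_simps)
  qed (use same opp in auto)
qed

lemma cube_dist_le_signed_pow32:
  fixes t s :: real
  shows "\<bar>t - s\<bar> ^ 3 \<le> 2 * (signed_pow32 t - signed_pow32 s)\<^sup>2"
proof -
  have same: "\<bar>t - s\<bar> ^ 3 \<le> 2 * (signed_pow32 t - signed_pow32 s)\<^sup>2" if "0 \<le> s" "s \<le> t" for t s
  proof -
    define a b where "a = sqrt t" and "b = sqrt s"
    have ab: "0 \<le> b" "b \<le> a" "t = a * a" "s = b * b" using that by (auto simp: a_def b_def)
    have "2 * (a * a * a - b * b * b)\<^sup>2 - (a * a - b * b) ^ 3
      = (a - b)\<^sup>2 * ((a * a + a * b + b * b)\<^sup>2 + (b * (3 * a * a * b + 4 * a * b * b + 2 * b * b * b)))"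
      by (simp add: power2_eq_square power3_eq_cube algebra_simps)
    moreover have "0 \<le> (a - b)\<^sup>2 * ((a * a + a * b + b * b)\<^sup>2 + (b * (3 * a * a * b + 4 * a * b * b + 2 * b * b * b)))"
      using ab by (intro mult_nonneg_nonneg add_nonneg_nonneg) auto
    ultimately have "(a * a - b * b) ^ 3 \<le> 2 * (a * a * a - b * b * b)\<^sup>2" by linarith
    moreover have "b * b \<le> a * a" using ab by (intro mult_mono) auto
    ultimately show ?thesis using ab by (simp add: signed_pow32_def real_sqrt_mult mult_ac)
  qed
  have opp: "\<bar>t - s\<bar> ^ 3 \<le> 2 * (signed_pow32 t - signed_pow32 s)\<^sup>2" if "0 \<le> t" "s \<le> 0" for t s
  proof -
    define a b where "a = sqrt t" and "b = sqrt (- s)"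
    have ab: "0 \<le> a" "0 \<le> b" "t = a * a" "s = - (b * b)" using that by (auto simp: a_def b_def)
    have "2 * (a * a * a + b * b * b)\<^sup>2 - (a * a + b * b) ^ 3
      = (a - b)\<^sup>2 * ((a * a - b * b)\<^sup>2 + 2 * a * b * (a * a + b * b) + 2 * (a * a) * (b * b))"
      by (simp add: power2_eq_square power3_eq_cube algebra_simps)
    moreover have "0 \<le> (a - b)\<^sup>2 * ((a * a - b * b)\<^sup>2 + 2 * a * b * (a * a + b * b) + 2 * (a * a) * (b * b))"
      using ab by (intro mult_nonneg_nonneg add_nonneg_nonneg) auto
    ultimately have "(a * a + b * b) ^ 3 \<le> 2 * (a * a * a + b * b * b)\<^sup>2" by linarith
    moreover have "0 \<le> a * a + b * b" by simp
    ultimately show ?thesis using ab by (simp add: signed_pow32_def real_sqrt_mult mult_ac)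
  qed
  consider "0 \<le> s" "s \<le> t" | "0 \<le> t" "t \<le> s" | "0 \<le> t" "s \<le> 0" | "t \<le> 0" "0 \<le> s"
    | "t \<le> s" "s \<le> 0" | "s \<le> t" "t \<le> 0" by linarith
  then show ?thesis
  proof cases
    case 2
    then show ?thesis using same[of t s] by (simp add: power2_commute abs_minus_commute)
  next
    case 4
    then show ?thesis using opp[of s t] by (simp add: power2_commute abs_minus_commute)
  next
    case 5
    then show ?thesis using same[of "-s" "-t"]
      by (simp add: signed_pow32_minus power2_commute abs_minus_commute)
  next
    case 6
    then show ?thesis using same[of "-t" "-s"]
      by (simp add: signed_pow32_minus power2_commute abs_minus_commute)
  qed (use same opp in auto)
qed

subsection \<open>Stein's identity for Gibbs measures\<close>

definition flip :: "nat \<Rightarrow> nat set \<Rightarrow> nat set" where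
  "flip i A = (if i \<in> A then A - {i} else insert i A)"

lemma flip_flip [simp]: "flip i (flip i A) = A"
  by (auto simp: flip_def)

lemma flip_subset: "i < n \<Longrightarrow> A \<subseteq> {..<n} \<Longrightarrow> flip i A \<subseteq> {..<n}"
  by (auto simp: flip_def)

lemma spin_flip: "spin (flip i A) j = (if j = i then - spin A j else spin A j)"
proof -
  have "j \<in> flip i A \<longleftrightarrow> (if j = i then j \<notin> A else j \<in> A)" by (simp add: flip_def)
  then show ?thesis by (simp add: spin_def)
qed

lemma sum_flip:
  assumes "i < n"
  shows "(\<Sum>A\<in>Pow {..<n}. f (flip i A)) = (\<Sum>A\<in>Pow {..<n}. f A)"
  by (rule sum.reindex_bij_witness[of _ "flip i" "flip i"]) (use assms flip_subset in auto)

locale ising_system =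
  fixes n :: nat and Q :: "nat \<Rightarrow> nat \<Rightarrow> real" and \<mu> :: "nat \<Rightarrow> real"
  assumes Q_sym: "\<And>i j. i < n \<Longrightarrow> j < n \<Longrightarrow> Q i j = Q j i"
    and Q_diag: "\<And>i. i < n \<Longrightarrow> Q i i = 0"
    and Q_nonneg: "\<And>i j. i < n \<Longrightarrow> j < n \<Longrightarrow> 0 \<le> Q i j"
begin

abbreviation E :: "(nat set \<Rightarrow> real) \<Rightarrow> real" where
  "E \<equiv> gibbs_mean n Q \<mu>"

definition local_field :: "nat \<Rightarrow> nat set \<Rightarrow> real" where
  "local_field i A = (\<Sum>j<n. Q i j * spin A j) + \<mu> i"

definition cmean :: "nat \<Rightarrow> nat set \<Rightarrow> real" where
  "cmean i A = tanh (local_field i A)"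

lemma local_field_flip:
  assumes "i < n" "j < n"
  shows "local_field j (flip i A) = local_field j A - 2 * Q j i * spin A i"
proof -
  have "(\<Sum>k<n. Q j k * spin (flip i A) k) = (\<Sum>k<n. Q j k * spin A k - (if k = i then 2 * Q j i * spin A i else 0))"
    by (rule sum.cong) (auto simp: spin_flip)
  then show ?thesis using assms by (simp add: local_field_def sum_subtractf)
qed

lemma cmean_flip_self: "i < n \<Longrightarrow> cmean i (flip i A) = cmean i A"
  by (simp add: cmean_def local_field_flip Q_diag)

lemma cmean_flip_dist:
  assumes "i < n" "j < n"
  shows "\<bar>cmean j A - cmean j (flip i A)\<bar> \<le> 2 * Q j i"
proof -
  have "\<bar>cmean j A - cmean j (flip i A)\<bar> \<le> \<bar>2 * Q j i * spin A i\<bar>"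
    unfolding cmean_def using tanh_dist_le[of "local_field j A" "local_field j (flip i A)"]
    by (simp add: local_field_flip assms)
  then show ?thesis using Q_nonneg[of j i] assms by (simp add: abs_mult)
qed

lemma energy_flip:
  assumes i: "i < n"
  shows "energy n Q \<mu> A = energy n Q \<mu> (flip i A) + 2 * spin A i * local_field i A"
proof -
  let ?x = "spin A" and ?y = "spin (flip i A)"
  have "(\<Sum>k<n. \<Sum>j<n. Q k j * ?x k * ?x j) - (\<Sum>k<n. \<Sum>j<n. Q k j * ?y k * ?y j)
    = (\<Sum>k<n. \<Sum>j<n. (if k = i then 2 * Q i j * ?x i * ?x j else 0) + (if j = i then 2 * Q k i * ?x k * ?x i else 0))"
    unfolding sum_subtractf[symmetric]
    by (intro sum.cong refl) (auto simp: spin_flip Q_diag)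
  also have "\<dots> = (\<Sum>k<n. if k = i then \<Sum>j<n. 2 * Q i j * ?x i * ?x j else 0) + (\<Sum>k<n. 2 * Q k i * ?x k * ?x i)"
    unfolding sum.distrib by (intro arg_cong2[where f = "(+)"] sum.cong refl) (use i in auto)
  also have "\<dots> = (\<Sum>j<n. 2 * Q i j * ?x i * ?x j) + (\<Sum>k<n. 2 * Q k i * ?x k * ?x i)" using i by simp
  also have "(\<Sum>k<n. 2 * Q k i * ?x k * ?x i) = (\<Sum>j<n. 2 * Q i j * ?x i * ?x j)"
    by (rule sum.cong) (use Q_sym i in auto)
  finally have q: "(\<Sum>k<n. \<Sum>j<n. Q k j * ?x k * ?x j) - (\<Sum>k<n. \<Sum>j<n. Q k j * ?y k * ?y j)
    = 4 * ?x i * (\<Sum>j<n. Q i j * ?x j)"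
    by (simp add: sum_distrib_left mult_ac)
  have "(\<Sum>k<n. \<mu> k * ?x k) - (\<Sum>k<n. \<mu> k * ?y k) = (\<Sum>k<n. if k = i then 2 * \<mu> i * ?x i else 0)"
    unfolding sum_subtractf[symmetric] by (rule sum.cong) (auto simp: spin_flip)
  then have m: "(\<Sum>k<n. \<mu> k * ?x k) - (\<Sum>k<n. \<mu> k * ?y k) = 2 * \<mu> i * ?x i" using i by simp
  show ?thesis using q m unfolding energy_def local_field_def by (simp add: algebra_simps)
qed

text \<open>Detailed balance: by \<open>energy_flip\<close> the two weights differ by exp (2 x y),
  with x the spin and y its local field, and for x = 1 or x = -1 this factor turns x - tanh y into x
  + tanh y. The conditional mean is unchanged by the flip because the diagonal of \<open>Q\<close>
  vanishes.\<close>

lemma weight_flip_antisym: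
  assumes i: "i < n"
  shows "exp (energy n Q \<mu> (flip i A)) * (spin (flip i A) i - cmean i (flip i A))
    = - (exp (energy n Q \<mu> A) * (spin A i - cmean i A))"
proof -
  have key: "exp (2 * x * y) * (x - tanh y) = x + tanh y" if x: "x = 1 \<or> x = -1" for x y :: real
  proof -
    define a where "a = exp (2 * y)"
    have a: "a > 0" by (simp add: a_def)
    have e: "exp (- 2 * y) = 1 / a"
      unfolding a_def by (simp add: exp_minus inverse_eq_divide)
    have t: "tanh y = (a - 1) / (a + 1)"
    proof -
      have "1 - 1 / a = (a - 1) / a" "1 + 1 / a = (a + 1) / a" using a by (simp_all add: field_simps)
      then show ?thesis unfolding tanh_real_altdef e using a by simp
    qed
    from x show ?thesis
    proof
      assume x: "x = 1"
      have e': "exp (2 * x * y) = a" by (simp add: x a_def)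
      have "x - tanh y = 2 / (a + 1)" "x + tanh y = 2 * a / (a + 1)"
        using a unfolding t x by (simp_all add: field_simps)
      then show ?thesis by (simp only: e') simp
    next
      assume x: "x = -1"
      have e': "exp (2 * x * y) = 1 / a" using e by (simp add: x)
      have "x - tanh y = - 2 * a / (a + 1)" "x + tanh y = - 2 / (a + 1)"
        using a unfolding t x by (simp_all add: field_simps)
      then show ?thesis using a by (simp only: e') simp
    qed
  qed
  have "spin A i = 1 \<or> spin A i = -1" by (simp add: spin_def)
  note k = key[OF this, of "local_field i A", folded cmean_def]
  have "exp (energy n Q \<mu> A) * (spin A i - cmean i A)
      = exp (energy n Q \<mu> (flip i A)) * (exp (2 * spin A i * local_field i A) * (spin A i - cmean i A))"
    unfolding energy_flip[OF i, of A] exp_add by (simp only: mult.assoc)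
  also have "\<dots> = exp (energy n Q \<mu> (flip i A)) * (spin A i + cmean i A)" unfolding k ..
  finally have w: "exp (energy n Q \<mu> A) * (spin A i - cmean i A)
      = exp (energy n Q \<mu> (flip i A)) * (spin A i + cmean i A)" .
  have "spin (flip i A) i - cmean i (flip i A) = - (spin A i + cmean i A)"
    by (simp add: spin_flip cmean_flip_self i)
  then show ?thesis unfolding w by (simp only: mult_minus_right)
qed

lemma gibbs_mean_spin_sub_cmean:
  assumes i: "i < n"
  shows "E (\<lambda>A. (spin A i - cmean i A) * h A) = E (\<lambda>A. (spin A i - cmean i A) * (h A - h (flip i A))) / 2"
proof -
  let ?w = "\<lambda>A. exp (energy n Q \<mu> A) * (spin A i - cmean i A)"
  have "(\<Sum>A\<in>Pow {..<n}. ?w A * h (flip i A)) = (\<Sum>A\<in>Pow {..<n}. ?w (flip i A) * h (flip i (flip i A)))"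
    by (rule sum_flip[OF i, symmetric])
  also have "\<dots> = - (\<Sum>A\<in>Pow {..<n}. ?w A * h A)"
    by (simp add: weight_flip_antisym[OF i] sum_negf)
  finally have "E (\<lambda>A. (spin A i - cmean i A) * h (flip i A)) = - E (\<lambda>A. (spin A i - cmean i A) * h A)"
    by (simp add: gibbs_mean_def gibbs_sum_def mult.assoc)
  then show ?thesis by (simp add: right_diff_distrib gibbs_mean_diff)
qed

text \<open>Given the other spins, \<open>spin A i\<close> has mean \<open>cmean i A\<close>, so only the dependence of
  \<open>h i\<close> on the \<open>i\<close>-th spin contributes.\<close>

lemma stein_bound:
  "\<bar>E (\<lambda>A. \<Sum>i<n. (spin A i - cmean i A) * h i A)\<bar> \<le> E (\<lambda>A. \<Sum>i<n. \<bar>h i A - h i (flip i A)\<bar>)"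
proof -
  have "\<bar>E (\<lambda>A. (spin A i - cmean i A) * h i A)\<bar> \<le> E (\<lambda>A. \<bar>h i A - h i (flip i A)\<bar>)" if i: "i < n" for i
  proof -
    have "\<bar>E (\<lambda>A. (spin A i - cmean i A) * (h i A - h i (flip i A)))\<bar>
       \<le> E (\<lambda>A. \<bar>(spin A i - cmean i A) * (h i A - h i (flip i A))\<bar>)" by (rule gibbs_mean_abs)
    \<comment> \<open>The factor 2 bounds the spin minus its conditional mean; it cancels the 1/2
      produced by symmetrizing over the flip.\<close>
    also have "\<dots> \<le> E (\<lambda>A. 2 * \<bar>h i A - h i (flip i A)\<bar>)"
    proof (rule gibbs_mean_mono)
      fix A
      have "\<bar>cmean i A\<bar> \<le> 1" 
        unfolding cmean_def using tanh_real_bounds[of "local_field i A"] by (auto simp: abs_le_iff)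
      then have "\<bar>spin A i - cmean i A\<bar> \<le> 2" using abs_spin[of A i] by linarith
      then show "\<bar>(spin A i - cmean i A) * (h i A - h i (flip i A))\<bar> \<le> 2 * \<bar>h i A - h i (flip i A)\<bar>"
        unfolding abs_mult by (intro mult_right_mono) auto
    qed
    finally show ?thesis unfolding gibbs_mean_cmult gibbs_mean_spin_sub_cmean[OF i, of "h i"] by simp
  qed
  then show ?thesis
    unfolding gibbs_mean_sum by (intro order_trans[OF sum_abs sum_mono]) simp
qed

end

subsection \<open>Near-regular interactions\<close>

text \<open>The parameters \<open>p\<close> and \<open>l\<close> enter as squares because the error terms below are
  \<open>n * p ^ 3\<close> and \<open>n * l ^ 3\<close>.\<close>

locale near_regular_ising = ising_system +
  fixes v :: "nat \<Rightarrow> real" and lam \<omega> p l \<gamma> :: real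
  assumes n_pos: "0 < n"
    and Q_le: "\<And>i j. i < n \<Longrightarrow> j < n \<Longrightarrow> Q i j \<le> p\<^sup>2" and p: "0 < p" "p \<le> 1"
    and rows: "\<And>i. i < n \<Longrightarrow> \<bar>(\<Sum>j<n. Q i j) - 1\<bar> \<le> \<omega>" and \<omega>: "0 \<le> \<omega>" "\<omega> \<le> 1/2"
    and v_bounds: "\<And>i. i < n \<Longrightarrow> 1/2 \<le> v i" "\<And>i. i < n \<Longrightarrow> v i \<le> 2"
    and v_mean: "\<bar>(\<Sum>i<n. v i) / n - 1\<bar> \<le> \<omega>"
    and eigen: "\<And>i. i < n \<Longrightarrow> (\<Sum>j<n. Q i j * v j) = lam * v i"
    and lam: "\<bar>lam - 1\<bar> \<le> l\<^sup>2" and l: "0 \<le> l" "l\<^sup>2 \<le> 1/2"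
    and \<gamma>: "0 < \<gamma>" "\<gamma> \<le> 1"
    and gap: "\<And>z. \<gamma> * (\<Sum>i<n. (z i - (\<Sum>j<n. z j) / n)\<^sup>2) - \<omega> * (\<Sum>i<n. (z i)\<^sup>2)
       \<le> (\<Sum>i<n. (z i)\<^sup>2) - (\<Sum>i<n. \<Sum>j<n. Q i j * z i * z j)"
    and field_le: "\<And>i. i < n \<Longrightarrow> \<bar>\<mu> i\<bar> \<le> 1"
begin

definition T :: "nat set \<Rightarrow> real" where
  "T A = (\<Sum>i<n. v i * cmean i A) / n"

text \<open>The remainder y - tanh y of the local field y, cubic near zero: it is the restoring
  drift left after the linear parts of field and conditional mean have cancelled.\<close>

definition excess :: "nat \<Rightarrow> nat set \<Rightarrow> real" where
  "excess i A = local_field i A - cmean i A"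

definition dev3 :: "nat set \<Rightarrow> real" where
  "dev3 A = (\<Sum>i<n. \<bar>cmean i A - T A\<bar> ^ 3)"

lemma row_le: "i < n \<Longrightarrow> (\<Sum>j<n. Q i j) \<le> 3/2"
  using rows[of i] \<omega> by linarith

lemma col_le: "i < n \<Longrightarrow> (\<Sum>j<n. Q j i) \<le> 3/2"
proof -
  assume i: "i < n"
  have "(\<Sum>j<n. Q j i) = (\<Sum>j<n. Q i j)" by (rule sum.cong) (use i Q_sym in auto)
  then show ?thesis using row_le[OF i] by simp
qed

lemma local_field_le:
  assumes "i < n" shows "\<bar>local_field i A\<bar> \<le> 3"
proof -
  have "\<bar>\<Sum>j<n. Q i j * spin A j\<bar> \<le> (\<Sum>j<n. Q i j)"
    by (rule order_trans[OF sum_abs]) (use Q_nonneg assms in \<open>auto simp: abs_mult intro!: sum_mono\<close>)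
  then show ?thesis unfolding local_field_def using row_le[OF assms] field_le[OF assms] by linarith
qed

lemma lam_le: "0 \<le> lam" "lam \<le> 3/2"
  using lam l by linarith+

section \<open>Moment inequalities from the leading eigenvector\<close>

lemma T_flip:
  assumes i: "i < n" shows "\<bar>T A - T (flip i A)\<bar> \<le> 6 / n"
proof -
  have "\<bar>(\<Sum>j<n. v j * cmean j A) - (\<Sum>j<n. v j * cmean j (flip i A))\<bar>
      \<le> (\<Sum>j<n. \<bar>v j * (cmean j A - cmean j (flip i A))\<bar>)"
    unfolding sum_subtractf[symmetric] right_diff_distrib[symmetric] by (rule sum_abs)
  also have "\<dots> \<le> (\<Sum>j<n. 2 * (Q i j * v j))"
  proof (rule sum_mono)
    fix j assume "j \<in> {..<n}"
    then have j: "j < n" by simp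
    have "\<bar>v j\<bar> * \<bar>cmean j A - cmean j (flip i A)\<bar> \<le> v j * (2 * Q j i)"
      by (intro mult_mono cmean_flip_dist i j) (use v_bounds(1)[OF j] in auto)
    then show "\<bar>v j * (cmean j A - cmean j (flip i A))\<bar> \<le> 2 * (Q i j * v j)"
      using Q_sym[OF i j] by (simp add: abs_mult mult_ac)
  qed
  \<comment> \<open>The change at each site \<open>j\<close> is bounded by an entry of
    \<open>Q\<close>, so the eigenvector equation evaluates the weighted sum exactly.\<close>
  also have "\<dots> = 2 * lam * v i" by (simp add: sum_distrib_left[symmetric] eigen[OF i])
  also have "\<dots> \<le> 2 * (3/2) * 2"
    using lam_le v_bounds[OF i] by (intro mult_mono) auto
  finally show ?thesis
    unfolding T_def diff_divide_distrib[symmetric] abs_divide using n_pos by (simp add: divide_right_mono)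
qed

text \<open>The weight \<open>lam * v i\<close> is the \<open>i\<close>-th entry of
  \<open>Q v\<close>, so by symmetry \<open>Q\<close> moves onto the spins and produces the local
  fields; this makes the signal and the excess visible. The plain weight \<open>v i\<close> would
  only compare spins with conditional means.\<close>

lemma eigen_test_identity:
  "(\<Sum>i<n. (spin A i - cmean i A) * (lam * v i))
    = (\<Sum>i<n. v i * excess i A) - (\<Sum>i<n. v i * \<mu> i) - (lam - 1) * n * T A"
proof -
  have "(\<Sum>i<n. spin A i * (lam * v i)) = (\<Sum>i<n. \<Sum>j<n. Q i j * v j * spin A i)"
    by (rule sum.cong) (simp_all add: eigen[symmetric] sum_distrib_left sum_distrib_right mult_ac)
  also have "\<dots> = (\<Sum>j<n. \<Sum>i<n. Q i j * v j * spin A i)" by (rule sum.swap)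
  also have "\<dots> = (\<Sum>j<n. v j * (local_field j A - \<mu> j))"
    unfolding local_field_def
    by (intro sum.cong refl) (auto simp: sum_distrib_left mult_ac Q_sym intro!: sum.cong)
  finally have 1: "(\<Sum>i<n. spin A i * (lam * v i)) = (\<Sum>j<n. v j * (local_field j A - \<mu> j))" .
  have 2: "(\<Sum>i<n. v i * cmean i A) = n * T A" using n_pos by (simp add: T_def)
  have "(\<Sum>i<n. (spin A i - cmean i A) * (lam * v i))
      = (\<Sum>i<n. spin A i * (lam * v i)) - lam * (\<Sum>i<n. v i * cmean i A)"
    unfolding sum_distrib_left sum_subtractf[symmetric] by (rule sum.cong) (auto simp: algebra_simps)
  also have "\<dots> = (\<Sum>i<n. v i * local_field i A) - (\<Sum>i<n. v i * \<mu> i) - lam * (n * T A)"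
    unfolding 1 2 by (simp add: right_diff_distrib sum_subtractf)
  also have "(\<Sum>i<n. v i * local_field i A) = (\<Sum>i<n. v i * excess i A) + n * T A"
    unfolding 2[symmetric] excess_def by (simp add: right_diff_distrib sum_subtractf)
  finally show ?thesis by (simp add: algebra_simps)
qed

text \<open>One flip changes \<open>T\<close> by order 1 / n, so the \<open>n\<close> Stein errors
  add up to order 1 / \<tau> independently of \<open>n\<close>. The constant 18 is the product of
  3/2, 2 and 6, the bounds for \<open>lam\<close>, \<open>v\<close> and
  \<open>T_flip\<close>.\<close>

lemma lipschitz_test_bound:
  fixes \<tau> :: real
  assumes \<tau>: "0 < \<tau>" and G: "\<And>x y. \<bar>G x - G y\<bar> \<le> \<bar>x - y\<bar> / \<tau>"
  shows "\<bar>E (\<lambda>A. G (T A) * ((\<Sum>i<n. v i * excess i A) - (\<Sum>i<n. v i * \<mu> i) - (lam - 1) * n * T A))\<bar>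
    \<le> 18 / \<tau>"
proof -
  have "\<bar>E (\<lambda>A. \<Sum>i<n. (spin A i - cmean i A) * (lam * v i * G (T A)))\<bar>
     \<le> E (\<lambda>A. \<Sum>i<n. \<bar>lam * v i * G (T A) - lam * v i * G (T (flip i A))\<bar>)"
    by (rule stein_bound)
  also have "\<dots> \<le> E (\<lambda>A. \<Sum>i<n. 18 / (n * \<tau>))"
  proof (intro gibbs_mean_mono sum_mono)
    fix A i assume "i \<in> {..<n}"
    then have i: "i < n" by simp
    have "\<bar>G (T A) - G (T (flip i A))\<bar> \<le> 6 / n / \<tau>"
      by (rule order_trans[OF G]) (use divide_right_mono[OF T_flip[OF i, of A], of \<tau>] \<tau> in simp)
    then have "lam * v i * \<bar>G (T A) - G (T (flip i A))\<bar> \<le> (3/2) * 2 * (6 / n / \<tau>)"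
      using lam_le v_bounds[OF i] by (intro mult_mono) auto
    moreover have "\<bar>lam * v i * G (T A) - lam * v i * G (T (flip i A))\<bar> = lam * v i * \<bar>G (T A) - G (T (flip i A))\<bar>"
      unfolding right_diff_distrib[symmetric] abs_mult using lam_le v_bounds(1)[OF i] by simp
    ultimately show "\<bar>lam * v i * G (T A) - lam * v i * G (T (flip i A))\<bar> \<le> 18 / (n * \<tau>)" by simp
  qed
  also have "\<dots> = 18 / \<tau>" using n_pos by (simp add: gibbs_mean_const)
  also have "(\<lambda>A. \<Sum>i<n. (spin A i - cmean i A) * (lam * v i * G (T A)))
     = (\<lambda>A. G (T A) * ((\<Sum>i<n. v i * excess i A) - (\<Sum>i<n. v i * \<mu> i) - (lam - 1) * n * T A))"
    unfolding eigen_test_identity[symmetric] by (simp add: sum_distrib_left mult_ac)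
  finally show ?thesis .
qed

text \<open>Weights that do not depend on the configuration have no Stein error.\<close>

lemma mean_weighted_spin: "E (\<lambda>A. \<Sum>i<n. v i * spin A i) = n * E T"
proof -
  have "\<bar>E (\<lambda>A. \<Sum>i<n. (spin A i - cmean i A) * v i)\<bar> \<le> E (\<lambda>A. \<Sum>i<n. \<bar>v i - v i\<bar>)"
    by (rule stein_bound)
  then have "E (\<lambda>A. \<Sum>i<n. (spin A i - cmean i A) * v i) = 0" by (simp add: gibbs_mean_const)
  moreover have "(\<lambda>A. \<Sum>i<n. (spin A i - cmean i A) * v i) = (\<lambda>A. (\<Sum>i<n. v i * spin A i) - n * T A)"
    using n_pos by (simp add: T_def sum_subtractf[symmetric] algebra_simps)
  ultimately show ?thesis by (simp add: gibbs_mean_diff gibbs_mean_cmult)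
qed

lemma excess_ge: "i < n \<Longrightarrow> 0 \<le> T A \<Longrightarrow> T A ^ 3 / 24 - 244 * \<bar>cmean i A - T A\<bar> ^ 3 \<le> excess i A"
  unfolding excess_def cmean_def by (rule sub_tanh_ge_of_center[OF local_field_le])

lemma excess_le: "i < n \<Longrightarrow> T A \<le> 0 \<Longrightarrow> excess i A \<le> - (\<bar>T A\<bar> ^ 3) / 24 + 244 * \<bar>cmean i A - T A\<bar> ^ 3"
  unfolding excess_def cmean_def by (rule sub_tanh_le_of_center[OF local_field_le])

lemma abs_excess_le:
  assumes "i < n"
  shows "\<bar>excess i A\<bar> \<le> 972 * (\<bar>T A\<bar> ^ 3 + \<bar>cmean i A - T A\<bar> ^ 3)"
proof -
  have "\<bar>excess i A\<bar> \<le> 243 * \<bar>cmean i A\<bar> ^ 3"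
    unfolding excess_def cmean_def by (rule abs_sub_tanh_le[OF local_field_le[OF assms]])
  also have "\<bar>cmean i A\<bar> ^ 3 \<le> 4 * (\<bar>T A\<bar> ^ 3 + \<bar>cmean i A - T A\<bar> ^ 3)"
    using cube_add_le[of "T A" "cmean i A - T A"] by simp
  finally show ?thesis by simp
qed

text \<open>The weights lie between 1/2 and 2: the cubic drift loses a factor 2 and the deviation
  error gains one, which turns 24 and 244 into 48 and 488.\<close>

lemma sum_excess_le_neg:
  assumes "T A \<le> 0"
  shows "(\<Sum>i<n. v i * excess i A) \<le> - (n * \<bar>T A\<bar> ^ 3 / 48) + 488 * dev3 A"
proof -
  have "v i * excess i A \<le> - (\<bar>T A\<bar> ^ 3) / 48 + 488 * \<bar>cmean i A - T A\<bar> ^ 3" if i: "i < n" for i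
  proof -
    have "v i * excess i A \<le> v i * (- (\<bar>T A\<bar> ^ 3) / 24 + 244 * \<bar>cmean i A - T A\<bar> ^ 3)"
      using excess_le[OF i assms] v_bounds(1)[OF i] by (intro mult_left_mono) auto
    also have "\<dots> = - (v i * (\<bar>T A\<bar> ^ 3 / 24)) + v i * (244 * \<bar>cmean i A - T A\<bar> ^ 3)"
      by (simp add: algebra_simps)
    also have "\<dots> \<le> - (1/2 * (\<bar>T A\<bar> ^ 3 / 24)) + 2 * (244 * \<bar>cmean i A - T A\<bar> ^ 3)"
      using v_bounds[OF i] by (intro add_mono le_imp_neg_le mult_right_mono) auto
    finally show ?thesis by simp
  qed
  then have "(\<Sum>i<n. v i * excess i A) \<le> (\<Sum>i<n. - (\<bar>T A\<bar> ^ 3) / 48 + 488 * \<bar>cmean i A - T A\<bar> ^ 3)"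
    by (intro sum_mono) auto
  then show ?thesis unfolding dev3_def sum_distrib_left sum.distrib by simp
qed

lemma sum_excess_ge_pos:
  assumes "0 \<le> T A"
  shows "n * T A ^ 3 / 48 - 488 * dev3 A \<le> (\<Sum>i<n. v i * excess i A)"
proof -
  have "T A ^ 3 / 48 - 488 * \<bar>cmean i A - T A\<bar> ^ 3 \<le> v i * excess i A" if i: "i < n" for i
  proof -
    have "1/2 * (T A ^ 3 / 24) - 2 * (244 * \<bar>cmean i A - T A\<bar> ^ 3)
        \<le> v i * (T A ^ 3 / 24) - v i * (244 * \<bar>cmean i A - T A\<bar> ^ 3)"
      using v_bounds[OF i] assms by (intro diff_mono mult_right_mono) auto
    also have "\<dots> = v i * (T A ^ 3 / 24 - 244 * \<bar>cmean i A - T A\<bar> ^ 3)"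
      by (simp add: algebra_simps)
    also have "\<dots> \<le> v i * excess i A"
      using excess_ge[OF i assms] v_bounds(1)[OF i] by (intro mult_left_mono) auto
    finally show ?thesis by simp
  qed
  then have "(\<Sum>i<n. T A ^ 3 / 48 - 488 * \<bar>cmean i A - T A\<bar> ^ 3) \<le> (\<Sum>i<n. v i * excess i A)"
    by (intro sum_mono) auto
  then show ?thesis unfolding dev3_def by (simp add: sum_subtractf sum_distrib_left)
qed

lemma abs_sum_excess_le: "\<bar>\<Sum>i<n. v i * excess i A\<bar> \<le> 1944 * (n * \<bar>T A\<bar> ^ 3 + dev3 A)"
proof -
  have "\<bar>v i * excess i A\<bar> \<le> 1944 * (\<bar>T A\<bar> ^ 3 + \<bar>cmean i A - T A\<bar> ^ 3)" if i: "i < n" for i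
  proof -
    have "\<bar>v i\<bar> * \<bar>excess i A\<bar> \<le> 2 * (972 * (\<bar>T A\<bar> ^ 3 + \<bar>cmean i A - T A\<bar> ^ 3))"
      using v_bounds[OF i] by (intro mult_mono abs_excess_le i) auto
    then show ?thesis by (simp add: abs_mult)
  qed
  then have "\<bar>\<Sum>i<n. v i * excess i A\<bar> \<le> (\<Sum>i<n. 1944 * (\<bar>T A\<bar> ^ 3 + \<bar>cmean i A - T A\<bar> ^ 3))"
    by (intro order_trans[OF sum_abs sum_mono]) auto
  then show ?thesis unfolding dev3_def by (simp add: sum.distrib sum_distrib_left algebra_simps)
qed

lemma dev3_nonneg: "0 \<le> dev3 A"
  unfolding dev3_def by (intro sum_nonneg) simp

lemma abs_lam_term_le: "\<bar>(lam - 1) * n * T A\<bar> \<le> n * l\<^sup>2 * \<bar>T A\<bar>"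
proof -
  have "\<bar>lam - 1\<bar> * (n * \<bar>T A\<bar>) \<le> l\<^sup>2 * (n * \<bar>T A\<bar>)" by (intro mult_right_mono lam) auto
  then show ?thesis by (simp add: abs_mult mult_ac)
qed

text \<open>The test function is \<open>T / \<tau>\<close> clamped to [-1, 1]. It has the sign of
  \<open>T\<close>, as the cubic drift does, and modulus 1 once \<bar>T\<bar> \<ge> \<tau>, so
  smaller values cost at most \<open>n * \<tau> ^ 3 / 48\<close>. The eigenvalue term is absorbed by
  \<open>young_cube\<close> with parameter 1/10; what remains of the cube is 1/48 - 1/100 >
  1/100.\<close>

lemma T_moment_le:
  fixes \<tau> :: real
  assumes \<tau>: "0 < \<tau>"
  shows "n * E (\<lambda>A. \<bar>T A\<bar> ^ 3)
    \<le> 100 * (n * \<tau> ^ 3 / 48 + 488 * E dev3 + 18 / \<tau> + \<bar>\<Sum>i<n. v i * \<mu> i\<bar> + 10 * (n * l ^ 3))"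
proof -
  define \<beta> where "\<beta> = (\<Sum>i<n. v i * \<mu> i)"
  define G where "G x = max (-1) (min 1 (x / \<tau>))" for x
  have Glip: "\<bar>G x - G y\<bar> \<le> \<bar>x - y\<bar> / \<tau>" for x y
  proof -
    have "\<bar>G x - G y\<bar> \<le> \<bar>x / \<tau> - y / \<tau>\<bar>" unfolding G_def by linarith
    then show ?thesis using \<tau> by (simp add: diff_divide_distrib[symmetric])
  qed
  have G1: "\<bar>G x\<bar> \<le> 1" for x unfolding G_def by linarith
  have pt: "n * \<bar>T A\<bar> ^ 3 / 100 \<le> G (T A) * ((\<Sum>i<n. v i * excess i A) - \<beta> - (lam - 1) * n * T A)
      + (n * \<tau> ^ 3 / 48 + 488 * dev3 A + \<bar>\<beta>\<bar> + 10 * (n * l ^ 3))" for A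
  proof -
    define S where "S = (\<Sum>i<n. v i * excess i A)"
    have 1: "n * \<bar>T A\<bar> ^ 3 / 48 - n * \<tau> ^ 3 / 48 - 488 * dev3 A \<le> G (T A) * S"
    proof -
      have a: "\<bar>T A\<bar> ^ 3 - \<tau> ^ 3 \<le> \<bar>G (T A)\<bar> * \<bar>T A\<bar> ^ 3"
      proof (cases "\<tau> \<le> \<bar>T A\<bar>")
        case True
        then have "\<bar>G (T A)\<bar> = 1" using \<tau> unfolding G_def by (auto simp: field_simps abs_if min_def max_def split: if_splits)
        then show ?thesis using \<tau> by simp
      next
        case False
        then have "\<bar>T A\<bar> ^ 3 \<le> \<tau> ^ 3" by (intro power_mono) auto
        moreover have "0 \<le> \<bar>G (T A)\<bar> * \<bar>T A\<bar> ^ 3" by simp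
        ultimately show ?thesis by linarith
      qed
      have b: "\<bar>G (T A)\<bar> * (n * \<bar>T A\<bar> ^ 3 / 48 - 488 * dev3 A) \<le> G (T A) * S"
      proof (cases "0 \<le> T A")
        case True
        have g: "0 \<le> G (T A)" using divide_nonneg_pos[OF True \<tau>] unfolding G_def by linarith
        show ?thesis using mult_left_mono[OF sum_excess_ge_pos[OF True] g] True g by (simp add: S_def)
      next
        case False
        then have g: "G (T A) \<le> 0" using \<tau> by (simp add: G_def divide_nonpos_pos min_le_iff_disj)
        have "S \<le> - (n * \<bar>T A\<bar> ^ 3 / 48 - 488 * dev3 A)" using sum_excess_le_neg[of A] False by (simp add: S_def)
        then have "G (T A) * (- (n * \<bar>T A\<bar> ^ 3 / 48 - 488 * dev3 A)) \<le> G (T A) * S"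
          using g by (rule mult_left_mono_neg)
        then show ?thesis unfolding abs_of_nonpos[OF g] by (simp only: mult_minus_left mult_minus_right)
      qed
      have "\<bar>G (T A)\<bar> * dev3 A \<le> 1 * dev3 A" by (intro mult_right_mono G1 dev3_nonneg)
      moreover have "n * (\<bar>T A\<bar> ^ 3 - \<tau> ^ 3) \<le> n * (\<bar>G (T A)\<bar> * \<bar>T A\<bar> ^ 3)" by (intro mult_left_mono a) auto
      moreover have "\<bar>G (T A)\<bar> * (n * \<bar>T A\<bar> ^ 3 / 48 - 488 * dev3 A)
        = n * (\<bar>G (T A)\<bar> * \<bar>T A\<bar> ^ 3) / 48 - 488 * (\<bar>G (T A)\<bar> * dev3 A)"
        by (simp add: algebra_simps)
      moreover have "n * (\<bar>T A\<bar> ^ 3 - \<tau> ^ 3) = n * \<bar>T A\<bar> ^ 3 - n * \<tau> ^ 3" by (simp add: algebra_simps)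
      ultimately show ?thesis using b by linarith
    qed
    have 2: "\<bar>G (T A) * \<beta>\<bar> \<le> \<bar>\<beta>\<bar>" unfolding abs_mult by (rule mult_left_le_one_le) (use G1 in auto)
    have 3: "\<bar>G (T A) * ((lam - 1) * n * T A)\<bar> \<le> n * l\<^sup>2 * \<bar>T A\<bar>"
    proof -
      have "\<bar>G (T A)\<bar> * \<bar>(lam - 1) * n * T A\<bar> \<le> 1 * \<bar>(lam - 1) * n * T A\<bar>" by (intro mult_right_mono G1) auto
      then show ?thesis using abs_lam_term_le[of A] unfolding abs_mult[of "G (T A)"] by linarith
    qed
    have "l\<^sup>2 * \<bar>T A\<bar> \<le> (1/10)\<^sup>2 * \<bar>T A\<bar> ^ 3 + l ^ 3 / (1/10)" by (rule young_cube) (use l in auto)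
    then have "n * (l\<^sup>2 * \<bar>T A\<bar>) \<le> n * ((1/10)\<^sup>2 * \<bar>T A\<bar> ^ 3 + l ^ 3 / (1/10))" by (intro mult_left_mono) auto
    then have 4: "n * l\<^sup>2 * \<bar>T A\<bar> \<le> n * \<bar>T A\<bar> ^ 3 / 100 + 10 * (n * l ^ 3)"
      by (simp add: algebra_simps power2_eq_square)
    have 5: "0 \<le> n * \<bar>T A\<bar> ^ 3" by simp
    have "G (T A) * (S - \<beta> - (lam - 1) * n * T A) = G (T A) * S - G (T A) * \<beta> - G (T A) * ((lam - 1) * n * T A)"
      by (simp add: algebra_simps)
    then show ?thesis using 1 2 3 4 5 unfolding S_def by linarith
  qed
  have "E (\<lambda>A. n * \<bar>T A\<bar> ^ 3 / 100) \<le> E (\<lambda>A. G (T A) * ((\<Sum>i<n. v i * excess i A) - \<beta> - (lam - 1) * n * T A)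
      + (n * \<tau> ^ 3 / 48 + 488 * dev3 A + \<bar>\<beta>\<bar> + 10 * (n * l ^ 3)))"
    by (rule gibbs_mean_mono) (rule pt)
  also have "\<dots> = E (\<lambda>A. G (T A) * ((\<Sum>i<n. v i * excess i A) - \<beta> - (lam - 1) * n * T A))
      + (n * \<tau> ^ 3 / 48 + 488 * E dev3 + \<bar>\<beta>\<bar> + 10 * (n * l ^ 3))"
    by (simp add: gibbs_mean_add gibbs_mean_const gibbs_mean_cmult)
  finally have "E (\<lambda>A. n * \<bar>T A\<bar> ^ 3 / 100) \<le> 18 / \<tau> + (n * \<tau> ^ 3 / 48 + 488 * E dev3 + \<bar>\<beta>\<bar> + 10 * (n * l ^ 3))"
    using lipschitz_test_bound[OF \<tau>, of G, OF Glip] unfolding \<beta>_def by linarith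
  moreover have "E (\<lambda>A. n * \<bar>T A\<bar> ^ 3 / 100) = n * E (\<lambda>A. \<bar>T A\<bar> ^ 3) / 100"
    using gibbs_mean_cmult[of n Q \<mu> "n / 100" "\<lambda>A. \<bar>T A\<bar> ^ 3"] by simp
  ultimately have "n * E (\<lambda>A. \<bar>T A\<bar> ^ 3) / 100
      \<le> 18 / \<tau> + (n * \<tau> ^ 3 / 48 + 488 * E dev3 + \<bar>\<beta>\<bar> + 10 * (n * l ^ 3))" by simp
  then show ?thesis unfolding \<beta>_def by (simp add: field_simps)
qed

text \<open>The test function is a cutoff, 1 for \<open>T\<close> up to \<open>\<tau>\<close> and 0
  from \<open>2 * \<tau>\<close> on. Up to deviation errors, the positive drift on its support is at
  most of order \<open>n * \<tau> ^ 3\<close>, so a larger signal forces \<open>E g\<close> to be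
  small; for negative \<open>T\<close> the drift has the favourable sign and bounds the cube of the
  negative part. Here 15552 = 8 * 1944.\<close>

lemma drift_bound:
  fixes \<tau> :: real
  assumes \<tau>: "0 < \<tau>"
  defines "g \<equiv> \<lambda>A. max 0 (min 1 (2 - T A / \<tau>))"
  shows "(\<Sum>i<n. v i * \<mu> i) * E g + n * E (\<lambda>A. (max 0 (- T A)) ^ 3) / 48
    \<le> 18 / \<tau> + 15552 * (n * \<tau> ^ 3) * E g + 1944 * E dev3 + n * l\<^sup>2 * E (\<lambda>A. \<bar>T A\<bar>)"
proof -
  define \<beta> where "\<beta> = (\<Sum>i<n. v i * \<mu> i)"
  define G where "G x = max 0 (min 1 (2 - x / \<tau>))" for x
  have gG: "g A = G (T A)" for A by (simp add: g_def G_def)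
  have Glip: "\<bar>G x - G y\<bar> \<le> \<bar>x - y\<bar> / \<tau>" for x y
  proof -
    have "\<bar>G x - G y\<bar> \<le> \<bar>x / \<tau> - y / \<tau>\<bar>" unfolding G_def by linarith
    then show ?thesis using \<tau> by (simp add: diff_divide_distrib[symmetric])
  qed
  have G01: "0 \<le> G x" "G x \<le> 1" for x unfolding G_def by linarith+
  have pt: "\<beta> * g A + n * (max 0 (- T A)) ^ 3 / 48
      \<le> - (G (T A) * ((\<Sum>i<n. v i * excess i A) - \<beta> - (lam - 1) * n * T A))
        + (15552 * (n * \<tau> ^ 3) * g A + 1944 * dev3 A + n * l\<^sup>2 * \<bar>T A\<bar>)" for A
  proof -
    define S where "S = (\<Sum>i<n. v i * excess i A)"
    have 1: "G (T A) * S \<le> 15552 * (n * \<tau> ^ 3) * g A - n * (max 0 (- T A)) ^ 3 / 48 + 1944 * dev3 A"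
    proof (cases "T A \<le> 0")
      case True
      then have "g A = 1" using \<tau> by (simp add: g_def divide_nonpos_pos)
      moreover have "max 0 (- T A) = \<bar>T A\<bar>" using True by simp
      moreover have "0 \<le> 15552 * (n * \<tau> ^ 3)" using \<tau> by simp
      ultimately show ?thesis using sum_excess_le_neg[OF True] dev3_nonneg[of A] by (simp add: S_def gG)
    next
      case False
      have m: "max 0 (- T A) = 0" using False by simp
      show ?thesis
      proof (cases "T A \<le> 2 * \<tau>")
        case True
        have "S \<le> 1944 * (n * \<bar>T A\<bar> ^ 3 + dev3 A)" using abs_sum_excess_le[of A] by (simp add: S_def)
        also have "\<dots> \<le> 1944 * (n * (2 * \<tau>) ^ 3 + dev3 A)"
          using True False by (intro mult_left_mono add_mono power_mono) auto
        finally have "G (T A) * S \<le> G (T A) * (1944 * (n * (2 * \<tau>) ^ 3 + dev3 A))"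
          using G01 by (intro mult_left_mono) auto
        also have "\<dots> = 15552 * (n * \<tau> ^ 3) * g A + 1944 * (G (T A) * dev3 A)"
          by (simp add: gG power_mult_distrib algebra_simps)
        also have "G (T A) * dev3 A \<le> dev3 A" using G01 dev3_nonneg by (intro mult_left_le_one_le) auto
        finally show ?thesis unfolding m by simp
      next
        case False
        then have "G (T A) = 0" using \<tau> by (simp add: G_def field_simps)
        then show ?thesis unfolding m gG using dev3_nonneg[of A] by simp
      qed
    qed
    have 3: "\<bar>G (T A) * ((lam - 1) * n * T A)\<bar> \<le> n * l\<^sup>2 * \<bar>T A\<bar>"
    proof -
      have "\<bar>G (T A)\<bar> * \<bar>(lam - 1) * n * T A\<bar> \<le> 1 * \<bar>(lam - 1) * n * T A\<bar>"
        using G01[of "T A"] by (intro mult_right_mono) auto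
      then show ?thesis using abs_lam_term_le[of A] unfolding abs_mult[of "G (T A)"] by linarith
    qed
    have "G (T A) * (S - \<beta> - (lam - 1) * n * T A) = G (T A) * S - \<beta> * g A - G (T A) * ((lam - 1) * n * T A)"
      by (simp add: gG algebra_simps)
    then show ?thesis using 1 3 unfolding S_def by linarith
  qed
  let ?D = "\<lambda>A. G (T A) * ((\<Sum>i<n. v i * excess i A) - \<beta> - (lam - 1) * n * T A)"
  have "\<beta> * E g + n / 48 * E (\<lambda>A. (max 0 (- T A)) ^ 3) = E (\<lambda>A. \<beta> * g A + n / 48 * (max 0 (- T A)) ^ 3)"
    by (simp only: gibbs_mean_add gibbs_mean_cmult)
  also have "\<dots> \<le> E (\<lambda>A. - 1 * ?D A + (15552 * (n * \<tau> ^ 3) * g A + 1944 * dev3 A + n * l\<^sup>2 * \<bar>T A\<bar>))"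
    by (rule gibbs_mean_mono) (use pt in simp)
  also have "\<dots> = - 1 * E ?D + (15552 * (n * \<tau> ^ 3) * E g + 1944 * E dev3 + n * l\<^sup>2 * E (\<lambda>A. \<bar>T A\<bar>))"
    by (simp only: gibbs_mean_add gibbs_mean_cmult)
  finally show ?thesis
    using lipschitz_test_bound[OF \<tau>, of G, OF Glip] unfolding \<beta>_def by simp
qed

end

section \<open>Cubic deviations of the conditional means\<close>

lemma power3_mean_le:
  fixes x :: "nat \<Rightarrow> real"
  assumes n: "0 < n" and x: "\<And>i. i < n \<Longrightarrow> 0 \<le> x i"
  shows "n * ((\<Sum>i<n. x i) / n) ^ 3 \<le> (\<Sum>i<n. x i ^ 3)"
proof -
  define m where "m = (\<Sum>i<n. x i) / n"
  have m: "0 \<le> m" unfolding m_def using x by (intro divide_nonneg_nonneg sum_nonneg) auto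
  have "m ^ 3 + 3 * m\<^sup>2 * (x i - m) \<le> x i ^ 3" if "i < n" for i
  proof -
    have "x i ^ 3 - (m ^ 3 + 3 * m\<^sup>2 * (x i - m)) = (x i - m)\<^sup>2 * (x i + 2 * m)"
      by (simp add: power2_eq_square power3_eq_cube algebra_simps)
    moreover have "0 \<le> (x i - m)\<^sup>2 * (x i + 2 * m)" using x[OF that] m by simp
    ultimately show ?thesis by linarith
  qed
  then have "(\<Sum>i<n. m ^ 3 + 3 * m\<^sup>2 * (x i - m)) \<le> (\<Sum>i<n. x i ^ 3)" by (intro sum_mono) auto
  moreover have "(\<Sum>i<n. m ^ 3 + 3 * m\<^sup>2 * (x i - m)) = n * m ^ 3 + 3 * m\<^sup>2 * ((\<Sum>i<n. x i) - n * m)"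
    by (simp add: sum.distrib sum_distrib_left[symmetric] sum_subtractf)
  moreover have "(\<Sum>i<n. x i) - n * m = 0" using n by (simp add: m_def)
  ultimately have "n * m ^ 3 \<le> (\<Sum>i<n. x i ^ 3)" by simp
  then show ?thesis unfolding m_def .
qed

context near_regular_ising
begin

definition abs3 :: "nat set \<Rightarrow> real" where
  "abs3 A = (\<Sum>i<n. \<bar>cmean i A\<bar> ^ 3)"

definition pvar :: "nat set \<Rightarrow> real" where
  "pvar A = (\<Sum>i<n. (signed_pow32 (cmean i A) - (\<Sum>j<n. signed_pow32 (cmean j A)) / n)\<^sup>2)"

lemma abs3_nonneg: "0 \<le> abs3 A"
  unfolding abs3_def by (intro sum_nonneg) simp

lemma abs3_le: "abs3 A \<le> 4 * (n * \<bar>T A\<bar> ^ 3 + dev3 A)"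
proof -
  have "abs3 A \<le> (\<Sum>i<n. 4 * (\<bar>T A\<bar> ^ 3 + \<bar>cmean i A - T A\<bar> ^ 3))"
    unfolding abs3_def
  proof (rule sum_mono)
    fix i
    show "\<bar>cmean i A\<bar> ^ 3 \<le> 4 * (\<bar>T A\<bar> ^ 3 + \<bar>cmean i A - T A\<bar> ^ 3)"
      using cube_add_le[of "T A" "cmean i A - T A"] by simp
  qed
  then show ?thesis unfolding dev3_def by (simp add: sum.distrib sum_distrib_left algebra_simps)
qed

text \<open>Deviations from \<open>c\<close>, the preimage under \<open>signed_pow32\<close> of the
  mean of the transforms, are controlled by \<open>pvar\<close>. The shift \<open>T A - c\<close>
  splits into a weighted average of \<open>t i - c\<close> and an error from \<open>v\<close> not
  having mean exactly 1; Cauchy-Schwarz bounds \<open>n * \<bar>c\<bar> ^ 3\<close> by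
  \<open>abs3\<close>. The constant is 264 = 2 * (4 + 4 * 32).\<close>

lemma dev3_le: "dev3 A \<le> 264 * pvar A + 16 * \<omega> * abs3 A"
proof -
  define t where "t i = cmean i A" for i
  define zb where "zb = (\<Sum>j<n. signed_pow32 (t j)) / n"
  obtain c where c: "signed_pow32 c = zb" using signed_pow32_surj by blast
  define D where "D = (\<Sum>i<n. \<bar>t i - c\<bar> ^ 3)"
  have D0: "0 \<le> D" unfolding D_def by (intro sum_nonneg) simp
  have D: "D \<le> 2 * pvar A"
    unfolding D_def pvar_def sum_distrib_left
    by (intro sum_mono) (use cube_dist_le_signed_pow32[of _ c] c in \<open>simp add: t_def zb_def\<close>)
  have c3: "n * \<bar>c\<bar> ^ 3 \<le> abs3 A"
  proof -
    have "\<bar>zb\<bar> \<le> (\<Sum>j<n. \<bar>signed_pow32 (t j)\<bar>) / n"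
      unfolding zb_def abs_divide by (simp add: divide_right_mono)
    then have "zb\<^sup>2 \<le> ((\<Sum>j<n. \<bar>signed_pow32 (t j)\<bar>) / n)\<^sup>2"
      by (rule abs_le_square_iff[THEN iffD1, OF order_trans]) simp
    also have "\<dots> = (\<Sum>j<n. \<bar>signed_pow32 (t j)\<bar> * 1)\<^sup>2 / n\<^sup>2" by (simp add: power_divide)
    also have "\<dots> \<le> ((\<Sum>j<n. \<bar>signed_pow32 (t j)\<bar>\<^sup>2) * (\<Sum>j<n. 1\<^sup>2)) / n\<^sup>2"
      by (intro divide_right_mono Cauchy_Schwarz_ineq_sum) auto
    also have "\<dots> = abs3 A / n"
    proof -
      have "(\<Sum>j<n. \<bar>signed_pow32 (t j)\<bar>\<^sup>2) = abs3 A"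
        by (simp add: abs3_def signed_pow32_sq t_def)
      then show ?thesis using n_pos by (simp add: power2_eq_square[of "real n"])
    qed
    finally show ?thesis using n_pos signed_pow32_sq[of c] c by (simp add: field_simps)
  qed
  have Tc: "n * \<bar>T A - c\<bar> ^ 3 \<le> 32 * D + 4 * \<omega> * abs3 A"
  proof -
    define a where "a = (\<Sum>i<n. v i * (t i - c)) / n"
    define b where "b = c * ((\<Sum>i<n. v i) / n - 1)"
    have Tab: "T A - c = a + b"
      using n_pos by (simp add: T_def a_def b_def t_def right_diff_distrib sum_subtractf sum_distrib_left diff_divide_distrib mult.commute)
    have "\<bar>a\<bar> \<le> (\<Sum>i<n. 2 * \<bar>t i - c\<bar>) / n"
      unfolding a_def abs_divide abs_of_nat
    proof (intro divide_right_mono order_trans[OF sum_abs sum_mono])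
      fix i assume "i \<in> {..<n}"
      then have "\<bar>v i\<bar> * \<bar>t i - c\<bar> \<le> 2 * \<bar>t i - c\<bar>"
        using v_bounds[of i] by (intro mult_right_mono) auto
      then show "\<bar>v i * (t i - c)\<bar> \<le> 2 * \<bar>t i - c\<bar>" by (simp add: abs_mult)
    qed simp
    then have "n * \<bar>a\<bar> ^ 3 \<le> n * ((\<Sum>i<n. 2 * \<bar>t i - c\<bar>) / n) ^ 3"
      by (intro mult_left_mono power_mono) auto
    also have "\<dots> \<le> (\<Sum>i<n. (2 * \<bar>t i - c\<bar>) ^ 3)" by (rule power3_mean_le[OF n_pos]) simp
    also have "\<dots> = 8 * D" by (simp add: D_def power_mult_distrib sum_distrib_left)
    finally have a3: "n * \<bar>a\<bar> ^ 3 \<le> 8 * D" .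
    have "\<bar>b\<bar> ^ 3 = \<bar>c\<bar> ^ 3 * \<bar>(\<Sum>i<n. v i) / n - 1\<bar> ^ 3" by (simp add: b_def abs_mult power_mult_distrib)
    also have "\<dots> \<le> \<bar>c\<bar> ^ 3 * \<omega>"
    proof (intro mult_left_mono)
      have "\<bar>(\<Sum>i<n. v i) / n - 1\<bar> ^ 3 \<le> \<omega> ^ 3" by (intro power_mono v_mean) simp
      also have "\<dots> \<le> \<omega> ^ 1" using \<omega> by (intro power_decreasing) auto
      finally show "\<bar>(\<Sum>i<n. v i) / n - 1\<bar> ^ 3 \<le> \<omega>" by simp
    qed simp
    finally have "n * \<bar>b\<bar> ^ 3 \<le> n * (\<bar>c\<bar> ^ 3 * \<omega>)" by (intro mult_left_mono) auto
    also have "\<dots> = (n * \<bar>c\<bar> ^ 3) * \<omega>" by simp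
    also have "\<dots> \<le> abs3 A * \<omega>" by (intro mult_right_mono c3 \<omega>)
    finally have b3: "n * \<bar>b\<bar> ^ 3 \<le> \<omega> * abs3 A" by (simp add: mult.commute)
    have "n * \<bar>T A - c\<bar> ^ 3 \<le> n * (4 * (\<bar>a\<bar> ^ 3 + \<bar>b\<bar> ^ 3))"
      unfolding Tab by (intro mult_left_mono cube_add_le) simp
    then show ?thesis using a3 b3 by (simp add: algebra_simps)
  qed
  have "dev3 A \<le> (\<Sum>i<n. 4 * (\<bar>t i - c\<bar> ^ 3 + \<bar>T A - c\<bar> ^ 3))"
    unfolding dev3_def
  proof (rule sum_mono)
    fix i
    show "\<bar>cmean i A - T A\<bar> ^ 3 \<le> 4 * (\<bar>t i - c\<bar> ^ 3 + \<bar>T A - c\<bar> ^ 3)"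
      using cube_add_le[of "t i - c" "c - T A"] by (simp add: t_def abs_minus_commute)
  qed
  also have "\<dots> = 4 * D + 4 * (n * \<bar>T A - c\<bar> ^ 3)"
    by (simp add: D_def sum.distrib sum_distrib_left algebra_simps)
  finally show ?thesis using Tc D by linarith
qed

text \<open>Summation by parts for a symmetric form; the row sums stay explicit because
  \<open>Q\<close> is only nearly stochastic.\<close>

lemma dirichlet_identity:
  "(\<Sum>i<n. \<Sum>j<n. Q i j * (a i - a j) * (b i - b j)) / 2
    = (\<Sum>i<n. (\<Sum>j<n. Q i j) * (a i * b i)) - (\<Sum>i<n. \<Sum>j<n. Q i j * a i * b j)"
proof -
  have swap: "(\<Sum>i<n. \<Sum>j<n. Q i j * f j i) = (\<Sum>i<n. \<Sum>j<n. Q i j * f i j)" for f :: "nat \<Rightarrow> nat \<Rightarrow> real"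
    by (subst sum.swap) (intro sum.cong refl, auto simp: Q_sym)
  have "(\<Sum>i<n. \<Sum>j<n. Q i j * (a i - a j) * (b i - b j))
    = (\<Sum>i<n. \<Sum>j<n. Q i j * (a i * b i)) + (\<Sum>i<n. \<Sum>j<n. Q i j * (a j * b j))
      - (\<Sum>i<n. \<Sum>j<n. Q i j * (a i * b j)) - (\<Sum>i<n. \<Sum>j<n. Q i j * (a j * b i))"
    unfolding sum.distrib[symmetric] sum_subtractf[symmetric]
    by (intro sum.cong refl) (simp add: algebra_simps)
  moreover have "(\<Sum>i<n. (\<Sum>j<n. Q i j) * (a i * b i)) = (\<Sum>i<n. \<Sum>j<n. Q i j * (a i * b i))"
    by (simp add: sum_distrib_right)
  moreover have "(\<Sum>i<n. \<Sum>j<n. Q i j * a i * b j) = (\<Sum>i<n. \<Sum>j<n. Q i j * (a i * b j))"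
    by (simp add: mult.assoc)
  ultimately show ?thesis
    using swap[of "\<lambda>i j. a i * b i"] swap[of "\<lambda>i j. a i * b j"] by linarith
qed

text \<open>The pointwise bound \<open>signed_square_mono\<close> compares two Dirichlet forms: that
  of the transforms with themselves, and that of \<open>t * \<bar>t\<bar>\<close> with
  \<open>t\<close>. Their diagonals agree, both consisting of \<bar>t\<bar> ^ 3, so the spectral gap
  for the former bounds the latter; uneven row sums and the defect in \<open>gap\<close> cost
  multiples of \<open>\<omega>\<close>.\<close>

lemma pvar_le:
  "2/3 * \<gamma> * pvar A \<le> abs3 A - (\<Sum>i<n. \<Sum>j<n. Q i j * (cmean i A * \<bar>cmean i A\<bar>) * cmean j A) + 3 * \<omega> * abs3 A"
proof -
  define t where "t i = cmean i A" for i
  define z where "z i = signed_pow32 (t i)" for i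
  define \<sigma> where "\<sigma> i = t i * \<bar>t i\<bar>" for i
  have st: "\<sigma> i * t i = \<bar>t i\<bar> ^ 3" for i
    by (simp add: \<sigma>_def power3_eq_cube)
  have zz: "z i * z i = \<bar>t i\<bar> ^ 3" for i using signed_pow32_sq[of "t i"] by (simp add: z_def power2_eq_square)
  have rowsum: "\<bar>(\<Sum>i<n. (\<Sum>j<n. Q i j) * \<bar>t i\<bar> ^ 3) - abs3 A\<bar> \<le> \<omega> * abs3 A"
  proof -
    have "\<bar>\<Sum>i<n. ((\<Sum>j<n. Q i j) - 1) * \<bar>t i\<bar> ^ 3\<bar> \<le> (\<Sum>i<n. \<omega> * \<bar>t i\<bar> ^ 3)"
      by (rule order_trans[OF sum_abs sum_mono]) (auto simp: abs_mult power_abs intro!: mult_right_mono rows)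
    then show ?thesis unfolding abs3_def
      by (simp add: left_diff_distrib sum_subtractf sum_distrib_left t_def)
  qed
  have "2/3 * ((\<Sum>i<n. \<Sum>j<n. Q i j * (z i - z j) * (z i - z j)) / 2)
     \<le> (\<Sum>i<n. \<Sum>j<n. Q i j * (\<sigma> i - \<sigma> j) * (t i - t j)) / 2"
  proof -
    have "2/3 * (\<Sum>i<n. \<Sum>j<n. Q i j * (z i - z j) * (z i - z j)) \<le> (\<Sum>i<n. \<Sum>j<n. Q i j * (\<sigma> i - \<sigma> j) * (t i - t j))"
      unfolding sum_distrib_left
    proof (intro sum_mono)
      fix i j assume "i \<in> {..<n}" "j \<in> {..<n}"
      then have "Q i j * (2/3 * (z i - z j)\<^sup>2) \<le> Q i j * ((\<sigma> i - \<sigma> j) * (t i - t j))"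
        unfolding z_def \<sigma>_def by (intro mult_left_mono signed_square_mono Q_nonneg) auto
      then show "2/3 * (Q i j * (z i - z j) * (z i - z j)) \<le> Q i j * (\<sigma> i - \<sigma> j) * (t i - t j)"
        by (simp add: power2_eq_square mult_ac)
    qed
    then show ?thesis by simp
  qed
  then have 1: "2/3 * ((\<Sum>i<n. (\<Sum>j<n. Q i j) * \<bar>t i\<bar> ^ 3) - (\<Sum>i<n. \<Sum>j<n. Q i j * z i * z j))
    \<le> (\<Sum>i<n. (\<Sum>j<n. Q i j) * \<bar>t i\<bar> ^ 3) - (\<Sum>i<n. \<Sum>j<n. Q i j * \<sigma> i * t j)"
    unfolding dirichlet_identity st zz .
  have 2: "\<gamma> * pvar A - \<omega> * abs3 A \<le> abs3 A - (\<Sum>i<n. \<Sum>j<n. Q i j * z i * z j)"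
    using gap[of z] by (simp add: pvar_def abs3_def z_def t_def signed_pow32_sq)
  have "0 \<le> \<omega> * abs3 A" using \<omega> abs3_nonneg by simp
  then show ?thesis using 1 2 rowsum unfolding \<sigma>_def t_def by (simp add: abs_le_iff)
qed

lemma excess_sign: "i < n \<Longrightarrow> 0 \<le> cmean i A * \<bar>cmean i A\<bar> * excess i A"
proof -
  assume i: "i < n"
  have "0 \<le> cmean i A * excess i A"
    unfolding cmean_def excess_def by (rule tanh_mult_sub_tanh_nonneg[OF local_field_le[OF i]])
  then have "0 \<le> \<bar>cmean i A\<bar> * (cmean i A * excess i A)" by simp
  then show ?thesis by (simp add: mult_ac)
qed

lemma cubic_test_bound:
  "E (\<lambda>A. abs3 A - (\<Sum>i<n. \<Sum>j<n. Q i j * (cmean i A * \<bar>cmean i A\<bar>) * cmean j A))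
    \<le> E (\<lambda>A. (\<Sum>i<n. \<bar>\<mu> i\<bar> * \<bar>cmean i A\<bar>\<^sup>2) + (\<Sum>i<n. 6 * (p\<^sup>2 * \<bar>cmean i A\<bar>) + 6 * p ^ 4))"
proof -
  define \<sigma> where "\<sigma> j A = cmean j A * \<bar>cmean j A\<bar>" for j A
  have "E (\<lambda>A. \<Sum>i<n. (spin A i - cmean i A) * (\<Sum>j<n. Q i j * \<sigma> j A))
     \<le> E (\<lambda>A. \<Sum>i<n. \<bar>(\<Sum>j<n. Q i j * \<sigma> j A) - (\<Sum>j<n. Q i j * \<sigma> j (flip i A))\<bar>)"
    using stein_bound[of "\<lambda>i A. \<Sum>j<n. Q i j * \<sigma> j A"] by linarith
  also have "\<dots> \<le> E (\<lambda>A. \<Sum>i<n. 6 * (p\<^sup>2 * \<bar>cmean i A\<bar>) + 6 * p ^ 4)"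
  proof (rule gibbs_mean_mono)
    fix A
    have "(\<Sum>i<n. \<bar>(\<Sum>j<n. Q i j * \<sigma> j A) - (\<Sum>j<n. Q i j * \<sigma> j (flip i A))\<bar>)
       \<le> (\<Sum>i<n. \<Sum>j<n. Q i j * (4 * (p\<^sup>2 * \<bar>cmean j A\<bar>) + 4 * p ^ 4))"
    proof (rule sum_mono)
      fix i assume "i \<in> {..<n}"
      then have i: "i < n" by simp
      have "\<bar>(\<Sum>j<n. Q i j * \<sigma> j A) - (\<Sum>j<n. Q i j * \<sigma> j (flip i A))\<bar> \<le> (\<Sum>j<n. \<bar>Q i j * (\<sigma> j A - \<sigma> j (flip i A))\<bar>)"
        unfolding sum_subtractf[symmetric] right_diff_distrib[symmetric] by (rule sum_abs)
      also have "\<dots> \<le> (\<Sum>j<n. Q i j * (4 * (p\<^sup>2 * \<bar>cmean j A\<bar>) + 4 * p ^ 4))"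
      proof (rule sum_mono)
        fix j assume "j \<in> {..<n}"
        then have j: "j < n" by simp
        define a b where "a = cmean j A" and "b = cmean j (flip i A)"
        have q: "0 \<le> Q j i" "Q j i \<le> p\<^sup>2" using Q_nonneg Q_le i j by auto
        have ab: "\<bar>a - b\<bar> \<le> 2 * p\<^sup>2" using cmean_flip_dist[OF i j, of A] q by (simp add: a_def b_def)
        have "\<bar>a * \<bar>a\<bar> - b * \<bar>b\<bar>\<bar> \<le> \<bar>a - b\<bar> * (\<bar>a\<bar> + \<bar>b\<bar>)"
        proof -
          have "a * \<bar>a\<bar> - b * \<bar>b\<bar> = (a - b) * \<bar>a\<bar> + b * (\<bar>a\<bar> - \<bar>b\<bar>)" by (simp add: algebra_simps)
          then have "\<bar>a * \<bar>a\<bar> - b * \<bar>b\<bar>\<bar> \<le> \<bar>a - b\<bar> * \<bar>a\<bar> + \<bar>b\<bar> * \<bar>\<bar>a\<bar> - \<bar>b\<bar>\<bar>"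
            using abs_triangle_ineq[of "(a - b) * \<bar>a\<bar>" "b * (\<bar>a\<bar> - \<bar>b\<bar>)"] by (simp add: abs_mult)
          also have "\<bar>b\<bar> * \<bar>\<bar>a\<bar> - \<bar>b\<bar>\<bar> \<le> \<bar>b\<bar> * \<bar>a - b\<bar>" by (intro mult_left_mono abs_triangle_ineq3) simp
          finally show ?thesis by (simp add: algebra_simps)
        qed
        also have "\<dots> \<le> (2 * p\<^sup>2) * (2 * \<bar>a\<bar> + 2 * p\<^sup>2)"
          using ab by (intro mult_mono) auto
        finally have "\<bar>\<sigma> j A - \<sigma> j (flip i A)\<bar> \<le> 4 * (p\<^sup>2 * \<bar>cmean j A\<bar>) + 4 * p ^ 4"
          unfolding \<sigma>_def a_def b_def by (simp add: algebra_simps power2_eq_square power4_eq_xxxx)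
        then show "\<bar>Q i j * (\<sigma> j A - \<sigma> j (flip i A))\<bar> \<le> Q i j * (4 * (p\<^sup>2 * \<bar>cmean j A\<bar>) + 4 * p ^ 4)"
          using Q_nonneg[OF i j] by (simp add: abs_mult mult_left_mono)
      qed
      finally show "\<bar>(\<Sum>j<n. Q i j * \<sigma> j A) - (\<Sum>j<n. Q i j * \<sigma> j (flip i A))\<bar>
        \<le> (\<Sum>j<n. Q i j * (4 * (p\<^sup>2 * \<bar>cmean j A\<bar>) + 4 * p ^ 4))" .
    qed
    also have "\<dots> = (\<Sum>j<n. (\<Sum>i<n. Q i j) * (4 * (p\<^sup>2 * \<bar>cmean j A\<bar>) + 4 * p ^ 4))"
      by (subst sum.swap) (simp add: sum_distrib_right)
    also have "\<dots> \<le> (\<Sum>j<n. 3/2 * (4 * (p\<^sup>2 * \<bar>cmean j A\<bar>) + 4 * p ^ 4))"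
      by (intro sum_mono mult_right_mono col_le) auto
    also have "\<dots> = (\<Sum>i<n. 6 * (p\<^sup>2 * \<bar>cmean i A\<bar>) + 6 * p ^ 4)"
      by (rule sum.cong) auto
    finally show "(\<Sum>i<n. \<bar>(\<Sum>j<n. Q i j * \<sigma> j A) - (\<Sum>j<n. Q i j * \<sigma> j (flip i A))\<bar>)
       \<le> (\<Sum>i<n. 6 * (p\<^sup>2 * \<bar>cmean i A\<bar>) + 6 * p ^ 4)" .
  qed
  finally have stein: "E (\<lambda>A. \<Sum>i<n. (spin A i - cmean i A) * (\<Sum>j<n. Q i j * \<sigma> j A))
     \<le> E (\<lambda>A. \<Sum>i<n. 6 * (p\<^sup>2 * \<bar>cmean i A\<bar>) + 6 * p ^ 4)" .
  have pt: "abs3 A - (\<Sum>i<n. \<Sum>j<n. Q i j * (cmean i A * \<bar>cmean i A\<bar>) * cmean j A)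
     \<le> (\<Sum>i<n. (spin A i - cmean i A) * (\<Sum>j<n. Q i j * \<sigma> j A)) + (\<Sum>i<n. \<bar>\<mu> i\<bar> * \<bar>cmean i A\<bar>\<^sup>2)" for A
  proof -
    have swap: "(\<Sum>i<n. a i * (\<Sum>j<n. Q i j * \<sigma> j A)) = (\<Sum>i<n. \<sigma> i A * (\<Sum>j<n. Q i j * a j))" for a :: "nat \<Rightarrow> real"
      unfolding sum_distrib_left
      by (subst sum.swap) (intro sum.cong refl, auto simp: Q_sym mult_ac)
    have "(\<Sum>i<n. (spin A i - cmean i A) * (\<Sum>j<n. Q i j * \<sigma> j A))
       = (\<Sum>i<n. spin A i * (\<Sum>j<n. Q i j * \<sigma> j A)) - (\<Sum>i<n. cmean i A * (\<Sum>j<n. Q i j * \<sigma> j A))"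
      by (simp add: left_diff_distrib sum_subtractf)
    also have "\<dots> = (\<Sum>i<n. \<sigma> i A * (local_field i A - \<mu> i)) - (\<Sum>i<n. \<sigma> i A * (\<Sum>j<n. Q i j * cmean j A))"
      unfolding swap by (simp add: local_field_def)
    also have "(\<Sum>i<n. \<sigma> i A * (local_field i A - \<mu> i))
        = abs3 A + (\<Sum>i<n. \<sigma> i A * excess i A) - (\<Sum>i<n. \<sigma> i A * \<mu> i)"
    proof -
      have "\<sigma> i A * (local_field i A - \<mu> i) = \<bar>cmean i A\<bar> ^ 3 + \<sigma> i A * excess i A - \<sigma> i A * \<mu> i" for i
      proof -
        have "\<sigma> i A * cmean i A = \<bar>cmean i A\<bar> ^ 3"
          by (simp add: \<sigma>_def power3_eq_cube)
        then show ?thesis unfolding excess_def by (simp add: algebra_simps)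
      qed
      then show ?thesis by (simp add: abs3_def sum.distrib sum_subtractf)
    qed
    finally have eq: "(\<Sum>i<n. (spin A i - cmean i A) * (\<Sum>j<n. Q i j * \<sigma> j A))
       = abs3 A + (\<Sum>i<n. \<sigma> i A * excess i A) - (\<Sum>i<n. \<sigma> i A * \<mu> i) - (\<Sum>i<n. \<sigma> i A * (\<Sum>j<n. Q i j * cmean j A))" .
    have "0 \<le> (\<Sum>i<n. \<sigma> i A * excess i A)" unfolding \<sigma>_def by (intro sum_nonneg) (use excess_sign in auto)
    moreover have "(\<Sum>i<n. \<sigma> i A * \<mu> i) \<le> (\<Sum>i<n. \<bar>\<mu> i\<bar> * \<bar>cmean i A\<bar>\<^sup>2)"
    proof (rule sum_mono)
      fix i
      have "\<sigma> i A * \<mu> i \<le> \<bar>\<sigma> i A * \<mu> i\<bar>" by simp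
      then show "\<sigma> i A * \<mu> i \<le> \<bar>\<mu> i\<bar> * \<bar>cmean i A\<bar>\<^sup>2" by (simp add: \<sigma>_def abs_mult power2_eq_square mult_ac)
    qed
    moreover have "(\<Sum>i<n. \<sigma> i A * (\<Sum>j<n. Q i j * cmean j A)) = (\<Sum>i<n. \<Sum>j<n. Q i j * (cmean i A * \<bar>cmean i A\<bar>) * cmean j A)"
      unfolding \<sigma>_def sum_distrib_left by (intro sum.cong refl) (simp add: mult_ac)
    ultimately show ?thesis using eq by linarith
  qed
  have "E (\<lambda>A. abs3 A - (\<Sum>i<n. \<Sum>j<n. Q i j * (cmean i A * \<bar>cmean i A\<bar>) * cmean j A))
     \<le> E (\<lambda>A. (\<Sum>i<n. (spin A i - cmean i A) * (\<Sum>j<n. Q i j * \<sigma> j A)) + (\<Sum>i<n. \<bar>\<mu> i\<bar> * \<bar>cmean i A\<bar>\<^sup>2))"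
    by (rule gibbs_mean_mono) (rule pt)
  then show ?thesis using stein by (simp only: gibbs_mean_add)
qed

text \<open>\<open>\<eta>\<close> is a free parameter: Young's inequality trades the linear and
  quadratic errors for a small multiple of \<open>abs3\<close>, which is bounded by the cube of
  \<open>T\<close> and \<open>dev3\<close> again. The estimate is thus self-referential and becomes
  useful once \<open>\<omega>\<close> and \<open>\<eta>\<close> are small against
  \<open>\<gamma>\<close>. The prefactor is 396 = 264 * 3/2.\<close>

lemma dev3_mean_le:
  assumes \<eta>: "0 < \<eta>" "\<eta> \<le> 1"
  shows "E dev3 \<le> 396 / \<gamma> * ((4 * \<omega> + 7 * \<eta>) * (4 * (n * E (\<lambda>A. \<bar>T A\<bar> ^ 3) + E dev3))
     + (\<Sum>i<n. \<bar>\<mu> i\<bar> ^ 3) / \<eta>\<^sup>2 + 12 * (n * p ^ 3) / \<eta>)"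
proof -
  define B where "B = (\<Sum>i<n. \<bar>\<mu> i\<bar> ^ 3) / \<eta>\<^sup>2 + 12 * (n * p ^ 3) / \<eta>"
  have pt: "(\<Sum>i<n. \<bar>\<mu> i\<bar> * \<bar>cmean i A\<bar>\<^sup>2) + (\<Sum>i<n. 6 * (p\<^sup>2 * \<bar>cmean i A\<bar>) + 6 * p ^ 4) \<le> 7 * \<eta> * abs3 A + B" for A
  proof -
    have "\<bar>\<mu> i\<bar> * \<bar>cmean i A\<bar>\<^sup>2 + (6 * (p\<^sup>2 * \<bar>cmean i A\<bar>) + 6 * p ^ 4)
      \<le> 7 * \<eta> * \<bar>cmean i A\<bar> ^ 3 + (\<bar>\<mu> i\<bar> ^ 3 / \<eta>\<^sup>2 + 12 * p ^ 3 / \<eta>)" for i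
    proof -
      have 1: "\<bar>\<mu> i\<bar> * \<bar>cmean i A\<bar>\<^sup>2 \<le> \<eta> * \<bar>cmean i A\<bar> ^ 3 + \<bar>\<mu> i\<bar> ^ 3 / \<eta>\<^sup>2"
        by (rule young_square_cube) (use \<eta> in auto)
      have 2: "p\<^sup>2 * \<bar>cmean i A\<bar> \<le> \<eta>\<^sup>2 * \<bar>cmean i A\<bar> ^ 3 + p ^ 3 / \<eta>"
        by (rule young_cube) (use \<eta> p in auto)
      have "\<eta>\<^sup>2 \<le> \<eta> ^ 1" using \<eta> by (intro power_decreasing) auto
      then have 3: "\<eta>\<^sup>2 * \<bar>cmean i A\<bar> ^ 3 \<le> \<eta> * \<bar>cmean i A\<bar> ^ 3" by (intro mult_right_mono) auto
      have "p ^ 4 \<le> p ^ 3" using p by (intro power_decreasing) auto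
      also have "p ^ 3 \<le> p ^ 3 / \<eta>" using \<eta> p by (simp add: field_simps mult_left_le_one_le)
      finally have 4: "p ^ 4 \<le> p ^ 3 / \<eta>" .
      show ?thesis using 1 2 3 4 by linarith
    qed
    then have "(\<Sum>i<n. \<bar>\<mu> i\<bar> * \<bar>cmean i A\<bar>\<^sup>2 + (6 * (p\<^sup>2 * \<bar>cmean i A\<bar>) + 6 * p ^ 4))
      \<le> (\<Sum>i<n. 7 * \<eta> * \<bar>cmean i A\<bar> ^ 3 + (\<bar>\<mu> i\<bar> ^ 3 / \<eta>\<^sup>2 + 12 * p ^ 3 / \<eta>))" by (intro sum_mono)
    then show ?thesis unfolding B_def abs3_def
      by (simp only: sum.distrib sum_distrib_left[symmetric] sum_divide_distrib[symmetric]) simp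
  qed
  have "2/3 * \<gamma> * E pvar \<le> E (\<lambda>A. abs3 A - (\<Sum>i<n. \<Sum>j<n. Q i j * (cmean i A * \<bar>cmean i A\<bar>) * cmean j A) + 3 * \<omega> * abs3 A)"
    unfolding gibbs_mean_cmult[symmetric] by (rule gibbs_mean_mono) (rule pvar_le)
  also have "\<dots> \<le> E (\<lambda>A. 7 * \<eta> * abs3 A + B) + 3 * \<omega> * E abs3"
    unfolding gibbs_mean_add[of n Q \<mu> _ "\<lambda>A. 3 * \<omega> * abs3 A"] gibbs_mean_cmult[of n Q \<mu> "3 * \<omega>"]
    by (intro add_right_mono order_trans[OF cubic_test_bound] gibbs_mean_mono pt)
  also have "\<dots> = (3 * \<omega> + 7 * \<eta>) * E abs3 + B"
    by (simp add: gibbs_mean_add gibbs_mean_cmult gibbs_mean_const algebra_simps)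
  finally have P: "2/3 * \<gamma> * E pvar \<le> (3 * \<omega> + 7 * \<eta>) * E abs3 + B" .
  have D: "E dev3 \<le> 264 * E pvar + 16 * \<omega> * E abs3"
  proof -
    have "E dev3 \<le> E (\<lambda>A. 264 * pvar A + 16 * \<omega> * abs3 A)" by (rule gibbs_mean_mono) (rule dev3_le)
    then show ?thesis by (simp add: gibbs_mean_add gibbs_mean_cmult)
  qed
  have S: "E abs3 \<le> 4 * (n * E (\<lambda>A. \<bar>T A\<bar> ^ 3) + E dev3)"
  proof -
    have "E abs3 \<le> E (\<lambda>A. 4 * (n * \<bar>T A\<bar> ^ 3 + dev3 A))" by (rule gibbs_mean_mono) (rule abs3_le)
    then show ?thesis by (simp add: gibbs_mean_add gibbs_mean_cmult)
  qed
  have S0: "0 \<le> E abs3" by (rule gibbs_mean_nonneg) (rule abs3_nonneg)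
  have "\<gamma> * E dev3 \<le> 264 * (\<gamma> * E pvar) + 16 * (\<gamma> * (\<omega> * E abs3))"
    using mult_left_mono[OF D, of \<gamma>] \<gamma> by (simp add: algebra_simps)
  also have "\<gamma> * (\<omega> * E abs3) \<le> \<omega> * E abs3" using \<gamma> \<omega> S0 by (intro mult_left_le_one_le) auto
  finally have "\<gamma> * E dev3 \<le> 396 * ((3 * \<omega> + 7 * \<eta>) * E abs3 + B) + 16 * (\<omega> * E abs3)"
    using P by simp
  also have "\<dots> \<le> 396 * ((4 * \<omega> + 7 * \<eta>) * E abs3 + B)"
    using mult_nonneg_nonneg[OF \<omega>(1) S0] by (simp add: algebra_simps)
  also have "\<dots> \<le> 396 * ((4 * \<omega> + 7 * \<eta>) * (4 * (n * E (\<lambda>A. \<bar>T A\<bar> ^ 3) + E dev3)) + B)"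
    by (intro mult_left_mono add_right_mono S) (use \<omega> \<eta> in auto)
  finally show ?thesis using \<gamma> unfolding B_def by (simp add: field_simps)
qed

end

section \<open>Lower bound for the mean of the weighted conditional means\<close>

text \<open>The error terms of \<open>mean_T_ge\<close> below have to be smaller than the signal by this factor.\<close>

definition tolerance :: "real \<Rightarrow> real" where
  "tolerance \<gamma> = \<gamma> ^ 3 / 10 ^ 90"

context near_regular_ising
begin

text \<open>The bounds for the third moment \<open>V\<close> and the deviations \<open>W\<close>
  each involve the other; a small \<open>\<eta>\<close> closes the loop. Then
  \<open>drift_bound\<close> shows that \<open>T\<close> exceeds the fraction \<open>s\<close> of
  \<open>\<tau>\<close> apart from a small mean of \<open>g\<close>, and that the negative part has
  a small third moment, which together bound the mean from below.\<close>

lemma mean_T_ge: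
  fixes M \<tau> :: real
  assumes M: "0 < M" and \<tau>: "0 < \<tau>" "n * \<tau> ^ 3 = M"
    and small: "1 / \<tau> \<le> tolerance \<gamma> * M" "n * l ^ 3 \<le> tolerance \<gamma> * M" "n * p ^ 3 \<le> tolerance \<gamma> * M"
      "\<omega> \<le> tolerance \<gamma>"
    and field: "M / 4 \<le> (\<Sum>i<n. v i * \<mu> i)" "(\<Sum>i<n. v i * \<mu> i) \<le> 3 * M"
      "(\<Sum>i<n. \<bar>\<mu> i\<bar> ^ 3) \<le> tolerance \<gamma> * M"
  shows "\<tau> / 100 \<le> E T"
proof -
  define \<iota> where "\<iota> = tolerance \<gamma>"
  \<comment> \<open>Fixed by the end of the proof, where 64 * 96000 * 125000 * \<kappa> has to be at
    most 1/10.\<close>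
  define \<kappa> :: real where "\<kappa> = 1 / 10 ^ 13"
  \<comment> \<open>Proportional to \<gamma> in order to cancel the prefactor 396 / \<gamma> of
    \<open>dev3_mean_le\<close>; the power of ten makes the resulting coefficient of
    \<open>W\<close> smaller than \<kappa>.\<close>
  define \<eta> where "\<eta> = \<kappa> * \<gamma> / (4 * 10 ^ 9)"
  define V where "V = n * E (\<lambda>A. \<bar>T A\<bar> ^ 3)"
  define W where "W = E dev3"
  define \<beta> where "\<beta> = (\<Sum>i<n. v i * \<mu> i)"
  note small' = small[folded \<iota>_def] field(3)[folded \<iota>_def]
  have \<eta>: "0 < \<eta>" "\<eta> \<le> 1" using \<gamma> by (auto simp: \<eta>_def \<kappa>_def)
  have W0: "0 \<le> W" unfolding W_def by (rule gibbs_mean_nonneg) (rule dev3_nonneg)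
  have V0: "0 \<le> V" unfolding V_def by (intro mult_nonneg_nonneg gibbs_mean_nonneg) auto
  have g3: "\<gamma> ^ 3 \<le> \<gamma>" "\<gamma> ^ 3 \<le> 1" using \<gamma> power_decreasing[of 1 3 \<gamma>] by (auto simp: power_le_one)
  have \<iota>0: "0 < \<iota>" using \<gamma> by (simp add: \<iota>_def tolerance_def)
  have \<iota>1: "\<iota> \<le> 1 / 10 ^ 90" using g3 by (simp add: \<iota>_def tolerance_def)
  have \<iota>\<eta>: "\<iota> \<le> \<eta>" using g3 \<gamma> by (simp add: \<iota>_def tolerance_def \<eta>_def \<kappa>_def)
  \<comment> \<open>The cube of \<gamma> in \<open>tolerance\<close> is used here: the square of
    \<eta> takes two powers and the prefactor 396 / \<gamma> the third.\<close>
  have \<iota>\<gamma>: "\<iota> \<le> \<kappa> * \<gamma> * \<eta>\<^sup>2 / 30000"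
    using \<gamma> by (simp add: \<iota>_def tolerance_def \<eta>_def \<kappa>_def power2_eq_square power3_eq_cube)
  have \<iota>M: "\<iota> * M \<le> M / 10 ^ 90" using mult_right_mono[OF \<iota>1, of M] M by simp
  then have \<iota>M': "\<iota> * M \<le> M / 1000" using M by simp
  have V: "V \<le> 48800 * W + 400 * M"
  proof -
    define q where "q = 18 / \<tau>"
    have "V \<le> 100 * (M / 48 + 488 * W + q + \<bar>\<beta>\<bar> + 10 * (n * l ^ 3))"
      using T_moment_le[OF \<tau>(1)] unfolding \<tau>(2) V_def W_def \<beta>_def q_def .
    moreover have "q \<le> 18 * (\<iota> * M)" using small'(1) by (simp add: q_def)
    moreover have "\<bar>\<beta>\<bar> \<le> 3 * M" using field M by (simp add: \<beta>_def)
    moreover have "V \<le> 48800 * W + 400 * M"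
      if "V \<le> 100 * (M / 48 + 488 * W + q + b + 10 * c)" "q \<le> 18 * k" "b \<le> 3 * M" "c \<le> k" "k \<le> M / 1000" for b c k
      using that M by simp
    ultimately show ?thesis using small'(2) \<iota>M' by blast
  qed
  have W: "W \<le> \<kappa> * M"
  proof -
    have b0: "(4 * \<omega> + 7 * \<eta>) * (4 * (V + W)) \<le> (11 * \<eta>) * (4 * (50000 * (W + M)))"
    proof (rule mult_mono)
      show "4 * \<omega> + 7 * \<eta> \<le> 11 * \<eta>" using small'(4) \<iota>\<eta> by linarith
      show "4 * (V + W) \<le> 4 * (50000 * (W + M))" using V W0 M by simp
    qed (use \<eta> V0 W0 in auto)
    have b1: "\<iota> * M / \<eta>\<^sup>2 + 12 * (\<iota> * M) / \<eta> \<le> 13 * (\<iota> * M) / \<eta>\<^sup>2"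
    proof -
      have "\<eta>\<^sup>2 \<le> \<eta> ^ 1" using \<eta> by (intro power_decreasing) auto
      then have le: "12 * (\<iota> * M) / \<eta> \<le> 12 * (\<iota> * M) / \<eta>\<^sup>2" using \<iota>0 M \<eta> by (intro divide_left_mono) auto
      have eq: "13 * (\<iota> * M) / \<eta>\<^sup>2 = \<iota> * M / \<eta>\<^sup>2 + 12 * (\<iota> * M) / \<eta>\<^sup>2"
        by (simp add: add_divide_distrib[symmetric])
      show ?thesis unfolding eq by (rule add_left_mono[OF le])
    qed
    have b2: "13 * (\<iota> * M) / \<eta>\<^sup>2 \<le> 13 * (\<kappa> * \<gamma> / 30000) * M"
    proof -
      have "\<iota> / \<eta>\<^sup>2 \<le> \<kappa> * \<gamma> / 30000" using \<iota>\<gamma> \<eta> by (simp add: field_simps)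
      then have "13 * (\<iota> / \<eta>\<^sup>2) * M \<le> 13 * (\<kappa> * \<gamma> / 30000) * M" using M by (intro mult_right_mono) auto
      then show ?thesis by simp
    qed
    have "W \<le> 396 / \<gamma> * ((4 * \<omega> + 7 * \<eta>) * (4 * (V + W)) + (\<Sum>i<n. \<bar>\<mu> i\<bar> ^ 3) / \<eta>\<^sup>2 + 12 * (n * p ^ 3) / \<eta>)"
      using dev3_mean_le[OF \<eta>] unfolding V_def W_def .
    also have "\<dots> \<le> 396 / \<gamma> * ((11 * \<eta>) * (4 * (50000 * (W + M))) + \<iota> * M / \<eta>\<^sup>2 + 12 * (\<iota> * M) / \<eta>)"
      using b0 small'(3,5) \<gamma> \<eta>
      by (intro mult_left_mono add_mono divide_right_mono) auto
    also have "\<dots> \<le> 396 / \<gamma> * ((11 * \<eta>) * (4 * (50000 * (W + M))) + 13 * (\<kappa> * \<gamma> / 30000) * M)"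
      using b1 b2 \<gamma> by (intro mult_left_mono) auto
    also have "\<dots> = 396 * 11 * 200000 / (4 * 10 ^ 9) * \<kappa> * (W + M) + 396 * 13 / 30000 * \<kappa> * M"
      using \<gamma> by (simp add: \<eta>_def field_simps)
    finally show ?thesis using W0 M by (simp add: \<kappa>_def field_simps)
  qed
  have V': "V \<le> 401 * M"
  proof -
    have "48800 * W \<le> M" using W M by (simp add: \<kappa>_def)
    then show ?thesis using V by linarith
  qed
  \<comment> \<open>The fraction 1/50 makes \<open>15552 * (n * s ^ 3)\<close> at most
    \<open>M / 8\<close>, half of the lower bound \<open>M / 4\<close> for the signal.\<close>
  define s where "s = \<tau> / 50"
  have s: "0 < s" using \<tau> by (simp add: s_def)
  define g where "g A = max 0 (min 1 (2 - T A / s))" for A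
  define N where "N A = (max 0 (- T A)) ^ 3" for A
  have g01: "0 \<le> E g" by (rule gibbs_mean_nonneg) (simp add: g_def)
  have N0: "0 \<le> E N" by (rule gibbs_mean_nonneg) (simp add: N_def)
  have drift: "\<beta> * E g + n * E N / 48 \<le> 18 / s + 15552 * (n * s ^ 3) * E g + 1944 * W + n * l\<^sup>2 * E (\<lambda>A. \<bar>T A\<bar>)"
    using drift_bound[OF s] unfolding \<beta>_def W_def g_def N_def .
  have lin: "n * l\<^sup>2 * E (\<lambda>A. \<bar>T A\<bar>) \<le> 2 * \<kappa> * M"
  proof -
    have "E (\<lambda>A. l\<^sup>2 * \<bar>T A\<bar>) \<le> E (\<lambda>A. \<kappa>\<^sup>2 * \<bar>T A\<bar> ^ 3 + l ^ 3 / \<kappa>)"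
      by (intro gibbs_mean_mono young_cube) (use l in \<open>auto simp: \<kappa>_def\<close>)
    then have "l\<^sup>2 * E (\<lambda>A. \<bar>T A\<bar>) \<le> \<kappa>\<^sup>2 * E (\<lambda>A. \<bar>T A\<bar> ^ 3) + l ^ 3 / \<kappa>"
      by (simp add: gibbs_mean_add gibbs_mean_cmult gibbs_mean_const)
    then have "n * (l\<^sup>2 * E (\<lambda>A. \<bar>T A\<bar>)) \<le> n * (\<kappa>\<^sup>2 * E (\<lambda>A. \<bar>T A\<bar> ^ 3) + l ^ 3 / \<kappa>)"
      by (intro mult_left_mono) auto
    then have "n * l\<^sup>2 * E (\<lambda>A. \<bar>T A\<bar>) \<le> \<kappa>\<^sup>2 * V + (n * l ^ 3) / \<kappa>"
      by (simp add: V_def algebra_simps)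
    moreover have "\<kappa>\<^sup>2 * V \<le> \<kappa> * M" using V' M V0 by (simp add: \<kappa>_def power2_eq_square)
    moreover have "(n * l ^ 3) / \<kappa> \<le> \<kappa> * M"
    proof -
      have "n * l ^ 3 \<le> M / 10 ^ 90" using small'(2) \<iota>M by (rule order_trans)
      then show ?thesis using M by (simp add: \<kappa>_def)
    qed
    ultimately show ?thesis by linarith
  qed
  have "M / 8 * E g + n * E N / 48 \<le> 2000 * \<kappa> * M"
  proof -
    have "18 / s = 900 * (1 / \<tau>)" by (simp add: s_def)
    also have "\<dots> \<le> 900 * (M / 10 ^ 90)"
      by (intro mult_left_mono order_trans[OF small'(1) \<iota>M]) auto
    finally have "18 / s \<le> \<kappa> * M" using M by (simp add: \<kappa>_def)
    moreover have "15552 * (n * s ^ 3) * E g \<le> M / 8 * E g"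
    proof (rule mult_right_mono[OF _ g01])
      have "n * s ^ 3 = M / 125000" using \<tau>(2) by (simp add: s_def power_divide)
      then show "15552 * (n * s ^ 3) \<le> M / 8" using M by simp
    qed
    moreover have "M / 4 * E g \<le> \<beta> * E g" unfolding \<beta>_def by (intro mult_right_mono field g01)
    moreover have "0 \<le> \<kappa> * M" using M by (simp add: \<kappa>_def)
    moreover have "M / 8 * E g = M / 4 * E g - M / 8 * E g" by simp
    ultimately show ?thesis using drift lin W by linarith
  qed
  moreover have "0 \<le> M / 8 * E g" "0 \<le> n * E N / 48" using M g01 N0 by auto
  ultimately have "M / 8 * E g \<le> 2000 * \<kappa> * M" "n * E N / 48 \<le> 2000 * \<kappa> * M" by linarith+
  then have g: "E g \<le> 16000 * \<kappa>" and nN: "n * E N \<le> 96000 * \<kappa> * M"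
    using M by (simp_all add: algebra_simps)
  have "n * E N \<le> n * (96000 * \<kappa> * \<tau> ^ 3)"
    using nN unfolding \<tau>(2)[symmetric] by (simp add: mult_ac)
  then have N: "E N \<le> 96000 * \<kappa> * \<tau> ^ 3" using n_pos by simp
  \<comment> \<open>For \<open>T A \<ge> s\<close> the left side is at most \<open>s\<close>;
    elsewhere \<open>g A = 1\<close> and only the negative part of \<open>T A\<close> matters, which
    is below \<open>s / 8\<close> or controlled by its cube.\<close>
  have pt: "s - s * g A - s / 8 - 64 / s\<^sup>2 * N A \<le> T A" for A
  proof -
    define x where "x = max 0 (- T A)"
    have x: "x \<le> s / 8 + 64 / s\<^sup>2 * x ^ 3"
    proof (cases "x \<le> s / 8")
      case True
      moreover have "0 \<le> 64 / s\<^sup>2 * x ^ 3" by (simp add: x_def)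
      ultimately show ?thesis by linarith
    next
      case False
      then have "(s / 8)\<^sup>2 * x \<le> x\<^sup>2 * x" using s by (intro mult_right_mono power_mono) auto
      then have "x \<le> 64 / s\<^sup>2 * x ^ 3" using s by (simp add: field_simps power2_eq_square power3_eq_cube)
      then show ?thesis using s by linarith
    qed
    have "s - s * g A - x \<le> T A"
    proof (cases "T A < s")
      case True
      then have "g A = 1" using s by (simp add: g_def field_simps)
      then show ?thesis by (simp add: x_def)
    next
      case False
      then have "x = 0" "0 \<le> g A" using s by (auto simp: x_def g_def)
      moreover from this have "0 \<le> s * g A" using s by simp
      ultimately show ?thesis using False by linarith
    qed
    then show ?thesis using x unfolding N_def x_def by linarith
  qed
  have "E (\<lambda>A. s - s * g A - s / 8 - 64 / s\<^sup>2 * N A) \<le> E T" by (rule gibbs_mean_mono) (rule pt)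
  then have "s - s * E g - s / 8 - 64 / s\<^sup>2 * E N \<le> E T"
    by (simp only: gibbs_mean_diff gibbs_mean_cmult gibbs_mean_const)
  moreover have "s * E g \<le> s / 100"
  proof -
    have "s * E g \<le> s * (16000 * \<kappa>)" using g s by (intro mult_left_mono) auto
    then show ?thesis using s by (simp add: \<kappa>_def)
  qed
  moreover have "64 / s\<^sup>2 * E N \<le> s / 10"
  proof -
    have "64 / s\<^sup>2 * E N \<le> 64 / s\<^sup>2 * (96000 * \<kappa> * \<tau> ^ 3)" using N by (intro mult_left_mono) auto
    also have "\<dots> = 64 * 96000 * 125000 * \<kappa> * s"
      using \<tau> by (simp add: s_def field_simps power2_eq_square power3_eq_cube)
    also have "\<dots> \<le> s / 10" using s by (simp add: \<kappa>_def)
    finally show ?thesis .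
  qed
  \<comment> \<open>What remains is s (1 - 1/100 - 1/8 - 1/10), which is more than s / 2.\<close>
  moreover have "\<tau> / 100 = s / 2" by (simp add: s_def)
  ultimately show ?thesis using s by linarith
qed

text \<open>Replacing the weights \<open>v\<close> by 1 costs at most \<open>\<tau> / 200\<close>,
  half of the lower bound for the mean of \<open>T\<close>.\<close>

lemma mean_magnetization_ge:
  fixes M \<tau> :: real
  assumes M: "0 < M" and \<tau>: "0 < \<tau>" "n * \<tau> ^ 3 = M"
    and small: "1 / \<tau> \<le> tolerance \<gamma> * M" "n * l ^ 3 \<le> tolerance \<gamma> * M" "n * p ^ 3 \<le> tolerance \<gamma> * M"
      "\<omega> \<le> tolerance \<gamma>"
    and field: "M / 4 \<le> (\<Sum>i<n. v i * \<mu> i)" "(\<Sum>i<n. v i * \<mu> i) \<le> 3 * M"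
      "(\<Sum>i<n. \<bar>\<mu> i\<bar> ^ 3) \<le> tolerance \<gamma> * M"
    and v1: "(\<Sum>i<n. \<bar>v i - 1\<bar>) \<le> n * \<tau> / 200"
  shows "\<tau> / 200 \<le> E (\<lambda>A. (\<Sum>i<n. spin A i) / n)"
proof -
  have "E (\<lambda>A. 1 / n * (\<Sum>i<n. v i * spin A i) - \<tau> / 200) \<le> E (\<lambda>A. (\<Sum>i<n. spin A i) / n)"
  proof (rule gibbs_mean_mono)
    fix A
    have "(\<Sum>i<n. v i * spin A i) - (\<Sum>i<n. spin A i) \<le> (\<Sum>i<n. \<bar>v i - 1\<bar>)"
      unfolding sum_subtractf[symmetric]
    proof (rule sum_mono)
      fix i
      have "v i * spin A i - spin A i = (v i - 1) * spin A i" by (simp add: algebra_simps)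
      also have "\<dots> \<le> \<bar>(v i - 1) * spin A i\<bar>" by simp
      finally show "v i * spin A i - spin A i \<le> \<bar>v i - 1\<bar>" by (simp add: abs_mult)
    qed
    then have "(\<Sum>i<n. v i * spin A i) \<le> (\<Sum>i<n. spin A i) + n * \<tau> / 200" using v1 by linarith
    then have "(\<Sum>i<n. v i * spin A i) / n \<le> ((\<Sum>i<n. spin A i) + n * \<tau> / 200) / n"
      by (rule divide_right_mono) simp
    then show "1 / n * (\<Sum>i<n. v i * spin A i) - \<tau> / 200 \<le> (\<Sum>i<n. spin A i) / n"
      using n_pos by (simp add: add_divide_distrib)
  qed
  also have "E (\<lambda>A. 1 / n * (\<Sum>i<n. v i * spin A i) - \<tau> / 200) = E T - \<tau> / 200"
    using n_pos by (simp only: gibbs_mean_diff gibbs_mean_cmult gibbs_mean_const mean_weighted_spin) simp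
  finally show ?thesis using mean_T_ge[OF M \<tau> small field] by linarith
qed

end

subsection \<open>From degrees and spectral gap to near-regularity\<close>

lemma sum_young:
  fixes x y :: "nat \<Rightarrow> real"
  assumes c: "0 < c"
  shows "\<bar>\<Sum>i<n. x i * y i\<bar> \<le> c / 2 * (\<Sum>i<n. (x i)\<^sup>2) + 1 / (2 * c) * (\<Sum>i<n. (y i)\<^sup>2)"
proof -
  have "\<bar>x i * y i\<bar> \<le> c / 2 * (x i)\<^sup>2 + 1 / (2 * c) * (y i)\<^sup>2" for i
  proof -
    have "0 \<le> (c * \<bar>x i\<bar> - \<bar>y i\<bar>)\<^sup>2 / (2 * c)" using c by simp
    also have "\<dots> = c / 2 * (x i)\<^sup>2 + 1 / (2 * c) * (y i)\<^sup>2 - \<bar>x i\<bar> * \<bar>y i\<bar>"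
      using c by (simp add: power2_diff power_mult_distrib field_simps power2_eq_square)
    finally show ?thesis by (simp add: abs_mult)
  qed
  then have "\<bar>\<Sum>i<n. x i * y i\<bar> \<le> (\<Sum>i<n. c / 2 * (x i)\<^sup>2 + 1 / (2 * c) * (y i)\<^sup>2)"
    by (intro order_trans[OF sum_abs sum_mono])
  then show ?thesis by (simp only: sum.distrib sum_distrib_left[symmetric])
qed

lemma sum_sq_deviation_mean_le:
  fixes z :: "nat \<Rightarrow> real"
  assumes "0 < n"
  shows "(\<Sum>i<n. (z i - (\<Sum>j<n. z j) / n)\<^sup>2) \<le> (\<Sum>i<n. (z i - c)\<^sup>2)"
proof -
  define m where "m = (\<Sum>j<n. z j) / n"
  have sm: "(\<Sum>j<n. z j) = n * m" using assms by (simp add: m_def)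
  have "(\<Sum>i<n. (z i - c)\<^sup>2) = (\<Sum>i<n. (z i - m)\<^sup>2 + (2 * (m - c) * (z i - m) + (m - c)\<^sup>2))"
    by (rule sum.cong) (auto simp: power2_eq_square algebra_simps)
  also have "\<dots> = (\<Sum>i<n. (z i - m)\<^sup>2) + (2 * (m - c) * ((\<Sum>i<n. z i) - n * m) + n * (m - c)\<^sup>2)"
    by (simp add: sum.distrib sum_distrib_left[symmetric] sum_subtractf)
  finally show ?thesis unfolding m_def[symmetric] sm by simp
qed

text \<open>The eigenvector is scaled to be comparable with the constant vector 1, with its sign
  fixed by \<open>u_mean\<close>. \<open>total\<close> is exact because the interaction is
  normalized by the average degree; it makes the row errors sum to zero.\<close>

locale leading_eigenvector =
  fixes n :: nat and Q :: "nat \<Rightarrow> nat \<Rightarrow> real" and u :: "nat \<Rightarrow> real" and lam \<gamma> \<epsilon> p :: real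
  assumes n_pos: "0 < n"
    and Q_sym: "\<And>i j. i < n \<Longrightarrow> j < n \<Longrightarrow> Q i j = Q j i"
    and Q_nonneg: "\<And>i j. i < n \<Longrightarrow> j < n \<Longrightarrow> 0 \<le> Q i j"
    and Q_le: "\<And>i j. i < n \<Longrightarrow> j < n \<Longrightarrow> Q i j \<le> p\<^sup>2"
    and rows: "\<And>i. i < n \<Longrightarrow> \<bar>(\<Sum>j<n. Q i j) - 1\<bar> \<le> \<epsilon>"
    and total: "(\<Sum>i<n. \<Sum>j<n. Q i j) = n"
    and \<gamma>: "0 < \<gamma>" "\<gamma> \<le> 1" and \<epsilon>: "0 < \<epsilon>" "8 * \<epsilon> \<le> \<gamma>"
    and u_norm: "(\<Sum>i<n. (u i)\<^sup>2) = n"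
    and u_mean: "0 \<le> (\<Sum>i<n. u i)"
    and eigen: "\<And>i. i < n \<Longrightarrow> (\<Sum>j<n. Q i j * u j) = lam * u i"
    and orth_le: "\<And>x. (\<Sum>i<n. x i * u i) = 0 \<Longrightarrow> (\<Sum>i<n. \<Sum>j<n. Q i j * x i * x j) \<le> (1 - \<gamma>) * (\<Sum>i<n. (x i)\<^sup>2)"
    and p_small: "192 * p\<^sup>2 * n * \<epsilon>\<^sup>2 \<le> \<gamma>\<^sup>2"
begin

text \<open>Row errors relative to the gap: the first-order size of the perturbation of the
  eigenvector.\<close>

definition "\<delta> = \<epsilon> / \<gamma>"
definition "e i = (\<Sum>j<n. Q i j) - 1"
definition "a = (\<Sum>i<n. u i) / n"
text \<open>The component of the constant vector orthogonal to \<open>u\<close>; \<open>a\<close> is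
  the coefficient of the projection because the squared norm of \<open>u\<close> is
  \<open>n\<close>.\<close>

definition "w i = 1 - a * u i"

lemma \<delta>: "0 < \<delta>" "\<delta> \<le> 1/8" "\<epsilon> \<le> \<delta>" "\<epsilon> = \<delta> * \<gamma>"
  using \<gamma> \<epsilon> by (auto simp: \<delta>_def field_simps mult_left_le)

lemma \<delta>_sq: "\<delta>\<^sup>2 \<le> \<delta> / 8"
  using mult_left_mono[OF \<delta>(2), of \<delta>] \<delta>(1) by (simp add: power2_eq_square)

lemma sum_e: "(\<Sum>i<n. e i) = 0"
  using total by (simp add: e_def sum_subtractf)

lemma sum_e_sq: "(\<Sum>i<n. (e i)\<^sup>2) \<le> n * \<epsilon>\<^sup>2"
proof -
  have "(\<Sum>i<n. (e i)\<^sup>2) \<le> (\<Sum>i<n. \<epsilon>\<^sup>2)"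
  proof (rule sum_mono)
    fix i assume "i \<in> {..<n}"
    then have "\<bar>e i\<bar> \<le> \<epsilon>" using rows by (simp add: e_def)
    then have "\<bar>e i\<bar>\<^sup>2 \<le> \<epsilon>\<^sup>2" by (intro power_mono) auto
    then show "(e i)\<^sup>2 \<le> \<epsilon>\<^sup>2" by simp
  qed
  then show ?thesis by simp
qed

lemma sum_u: "(\<Sum>i<n. u i) = n * a"
  using n_pos by (simp add: a_def)

lemma w_orth: "(\<Sum>i<n. w i * u i) = 0"
proof -
  have "(\<Sum>i<n. w i * u i) = (\<Sum>i<n. u i) - a * (\<Sum>i<n. (u i)\<^sup>2)"
    by (simp add: w_def left_diff_distrib sum_subtractf sum_distrib_left power2_eq_square mult.assoc)
  then show ?thesis by (simp add: u_norm sum_u)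
qed

lemma sum_w: "(\<Sum>i<n. w i) = (\<Sum>i<n. (w i)\<^sup>2)"
proof -
  have "(\<Sum>i<n. (w i)\<^sup>2) = (\<Sum>i<n. w i - a * (w i * u i))"
    by (rule sum.cong) (auto simp: w_def power2_eq_square algebra_simps)
  then show ?thesis by (simp add: sum_subtractf sum_distrib_left[symmetric] w_orth)
qed

text \<open>The gap is tested on \<open>w\<close> itself. Since \<open>w\<close> is orthogonal to
  \<open>u\<close> and has the same inner product with 1 as with itself, its form is its squared
  norm plus its product with the row errors \<open>e\<close>; hence \<open>\<gamma>\<close> times
  the squared norm is at most the modulus of that product.\<close>

lemma norm_w: "(\<Sum>i<n. (w i)\<^sup>2) \<le> n * \<delta>\<^sup>2"
proof -
  define N where "N = (\<Sum>i<n. (w i)\<^sup>2)"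
  have Qw: "(\<Sum>j<n. Q i j * w j) = 1 + e i - a * lam * u i" if "i < n" for i
  proof -
    have "(\<Sum>j<n. Q i j * w j) = (\<Sum>j<n. Q i j) - a * (\<Sum>j<n. Q i j * u j)"
      by (simp add: w_def right_diff_distrib sum_subtractf sum_distrib_left mult_ac)
    then show ?thesis using eigen[OF that] by (simp add: e_def)
  qed
  have "(\<Sum>i<n. \<Sum>j<n. Q i j * w i * w j) = (\<Sum>i<n. w i * (\<Sum>j<n. Q i j * w j))"
    by (simp add: sum_distrib_left mult_ac)
  also have "\<dots> = (\<Sum>i<n. w i + w i * e i - a * lam * (w i * u i))"
    by (rule sum.cong) (auto simp: Qw algebra_simps)
  also have "\<dots> = N + (\<Sum>i<n. w i * e i)"
    by (simp add: sum.distrib sum_subtractf sum_distrib_left[symmetric] w_orth sum_w N_def)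
  finally have "N + (\<Sum>i<n. w i * e i) \<le> (1 - \<gamma>) * N" using orth_le[OF w_orth] by (simp add: N_def)
  moreover have "\<bar>\<Sum>i<n. w i * e i\<bar> \<le> \<gamma> / 2 * N + 1 / (2 * \<gamma>) * (\<Sum>i<n. (e i)\<^sup>2)"
    unfolding N_def by (rule sum_young) (rule \<gamma>)
  ultimately have "\<gamma> / 2 * N \<le> 1 / (2 * \<gamma>) * (\<Sum>i<n. (e i)\<^sup>2)" by (simp add: algebra_simps)
  also have "\<dots> \<le> 1 / (2 * \<gamma>) * (n * \<epsilon>\<^sup>2)" using \<gamma> by (intro mult_left_mono sum_e_sq) auto
  finally show ?thesis using \<gamma> unfolding N_def[symmetric] by (simp add: \<delta>_def power_divide field_simps power2_eq_square)
qed

lemma a_sq: "n * a\<^sup>2 + (\<Sum>i<n. (w i)\<^sup>2) = n"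
proof -
  have "real n = (\<Sum>i<n. (a * u i + w i)\<^sup>2)" by (simp add: w_def)
  also have "\<dots> = (\<Sum>i<n. a\<^sup>2 * (u i)\<^sup>2 + (w i)\<^sup>2 + 2 * a * (w i * u i))"
    by (rule sum.cong) (auto simp: power2_eq_square algebra_simps)
  also have "\<dots> = n * a\<^sup>2 + (\<Sum>i<n. (w i)\<^sup>2)"
    by (simp add: sum.distrib sum_distrib_left[symmetric] w_orth u_norm)
  finally show ?thesis by simp
qed

lemma a_bounds: "1/2 \<le> a" "a \<le> 1" "1 - a \<le> \<delta>\<^sup>2"
proof -
  have a0: "0 \<le> a" unfolding a_def using u_mean by simp
  have "n * (1 - a\<^sup>2) \<le> n * \<delta>\<^sup>2" using a_sq norm_w by (simp add: algebra_simps)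
  then have 1: "1 - a\<^sup>2 \<le> \<delta>\<^sup>2" using n_pos by simp
  have "n * a\<^sup>2 \<le> n * 1" using a_sq sum_nonneg[of "{..<n}" "\<lambda>i. (w i)\<^sup>2"] by simp
  then have "a\<^sup>2 \<le> 1\<^sup>2" using n_pos by simp
  then show a1: "a \<le> 1" by (rule power2_le_imp_le) simp
  have "0 \<le> a * (1 - a)" using a0 a1 by simp
  then show 2: "1 - a \<le> \<delta>\<^sup>2" using 1 by (simp add: power2_eq_square algebra_simps)
  show "1/2 \<le> a" using 2 \<delta>_sq \<delta>(2) by linarith
qed

text \<open>The two summands of u - 1 = (1 - a) u - w are orthogonal, and 1 - a is of second order
  in \<delta>.\<close>

lemma sum_dev_sq: "(\<Sum>i<n. (u i - 1)\<^sup>2) \<le> 2 * n * \<delta>\<^sup>2"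
proof -
  have "(\<Sum>i<n. (u i - 1)\<^sup>2) = (\<Sum>i<n. (1 - a)\<^sup>2 * (u i)\<^sup>2 + (w i)\<^sup>2 - 2 * (1 - a) * (w i * u i))"
    by (rule sum.cong) (auto simp: w_def power2_eq_square algebra_simps)
  also have "\<dots> = n * (1 - a)\<^sup>2 + (\<Sum>i<n. (w i)\<^sup>2)"
    by (simp add: sum.distrib sum_subtractf sum_distrib_left[symmetric] w_orth u_norm)
  also have "\<dots> \<le> n * \<delta>\<^sup>2 + n * \<delta>\<^sup>2"
  proof (intro add_mono norm_w mult_left_mono power_mono)
    show "1 - a \<le> \<delta>" using a_bounds(3) \<delta>_sq \<delta> by linarith
  qed (use a_bounds in auto)
  finally show ?thesis by simp
qed

lemma sum_abs_dev: "(\<Sum>i<n. \<bar>u i - 1\<bar>) \<le> 2 * n * \<delta>"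
proof -
  have "\<bar>\<Sum>i<n. \<bar>u i - 1\<bar> * 1\<bar> \<le> (1 / \<delta>) / 2 * (\<Sum>i<n. \<bar>u i - 1\<bar>\<^sup>2) + 1 / (2 * (1 / \<delta>)) * (\<Sum>i<n. 1\<^sup>2)"
    by (rule sum_young) (use \<delta> in simp)
  also have "\<dots> \<le> (1 / \<delta>) / 2 * (2 * n * \<delta>\<^sup>2) + 1 / (2 * (1 / \<delta>)) * n"
    using sum_dev_sq \<delta> by (intro add_mono mult_left_mono) auto
  also have "\<dots> = 3/2 * (n * \<delta>)" using \<delta> by (simp add: power2_eq_square)
  also have "\<dots> \<le> 2 * n * \<delta>" using \<delta> by simp
  finally show ?thesis by simp
qed

text \<open>Summing the eigenvector equation expresses \<open>(lam - 1) * (n * a)\<close> as the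
  product of \<open>u\<close> with the row errors. These sum to zero, so \<open>u\<close> may be
  replaced by \<open>u - 1\<close>; both factors are then of first order, and the eigenvalue error
  is quadratic.\<close>

lemma lam_near_one: "\<bar>lam - 1\<bar> \<le> (2 * \<delta>)\<^sup>2"
proof -
  have "(\<Sum>i<n. lam * u i) = (\<Sum>i<n. \<Sum>j<n. Q i j * u j)" by (rule sum.cong) (auto simp: eigen)
  also have "\<dots> = (\<Sum>j<n. \<Sum>i<n. Q i j * u j)" by (rule sum.swap)
  also have "\<dots> = (\<Sum>j<n. (1 + e j) * u j)"
    unfolding e_def by (intro sum.cong refl) (auto simp: sum_distrib_right Q_sym intro!: sum.cong)
  also have "\<dots> = (\<Sum>j<n. u j + (u j - 1) * e j + e j)"
    by (rule sum.cong) (auto simp: algebra_simps)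
  also have "\<dots> = (\<Sum>j<n. u j) + (\<Sum>j<n. (u j - 1) * e j)" by (simp add: sum.distrib sum_e)
  finally have eq: "(lam - 1) * (n * a) = (\<Sum>j<n. (u j - 1) * e j)"
    by (simp add: sum_distrib_left[symmetric] sum_u algebra_simps)
  have "\<bar>lam - 1\<bar> * (n * a) = \<bar>(lam - 1) * (n * a)\<bar>"
    using a_bounds by (simp add: abs_mult)
  then have "\<bar>lam - 1\<bar> * (n * a) = \<bar>\<Sum>j<n. (u j - 1) * e j\<bar>" unfolding eq .
  also have "\<dots> \<le> \<gamma> / 2 * (\<Sum>i<n. (u i - 1)\<^sup>2) + 1 / (2 * \<gamma>) * (\<Sum>i<n. (e i)\<^sup>2)"
    by (rule sum_young) (rule \<gamma>)
  also have "\<dots> \<le> \<gamma> / 2 * (2 * n * \<delta>\<^sup>2) + 1 / (2 * \<gamma>) * (n * \<epsilon>\<^sup>2)"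
    using \<gamma> by (intro add_mono mult_left_mono sum_dev_sq sum_e_sq) auto
  also have "\<dots> = n * (3/2 * \<gamma> * \<delta>\<^sup>2)"
  proof -
    have "1 / (2 * \<gamma>) * (n * \<epsilon>\<^sup>2) = n * (\<gamma> / 2 * \<delta>\<^sup>2)"
      using \<gamma> by (simp add: \<delta>_def power2_eq_square)
    then show ?thesis by simp
  qed
  finally have "n * (\<bar>lam - 1\<bar> * a) \<le> n * (3/2 * \<gamma> * \<delta>\<^sup>2)" by (simp add: mult_ac)
  then have "\<bar>lam - 1\<bar> * a \<le> 3/2 * \<gamma> * \<delta>\<^sup>2" using n_pos by simp
  moreover have "\<bar>lam - 1\<bar> * (1/2) \<le> \<bar>lam - 1\<bar> * a" using a_bounds by (intro mult_left_mono) auto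
  moreover have "3/2 * \<gamma> * \<delta>\<^sup>2 \<le> 3/2 * 1 * \<delta>\<^sup>2" using \<gamma> by (intro mult_right_mono mult_left_mono) auto
  ultimately have "\<bar>lam - 1\<bar> \<le> 3 * \<delta>\<^sup>2" by simp
  then show ?thesis by (simp add: power2_eq_square)
qed

text \<open>A norm bound on \<open>u - 1\<close> does not give order-one control of single entries;
  the eigenvector equation does, since it averages \<open>u - 1\<close> over a row of
  \<open>Q\<close> whose squared norm is at most 2 p^2. The factor 192 = 4 * 48 in
  \<open>p_small\<close> makes the square of this average at most 1/48.\<close>

lemma u_near_one:
  assumes i: "i < n"
  shows "1/2 \<le> u i" "u i \<le> 2"
proof -
  define D where "D = (\<Sum>j<n. Q i j * (u j - 1))"
  have "D\<^sup>2 \<le> (\<Sum>j<n. (Q i j)\<^sup>2) * (\<Sum>j<n. (u j - 1)\<^sup>2)" unfolding D_def by (rule Cauchy_Schwarz_ineq_sum)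
  also have "\<dots> \<le> (p\<^sup>2 * 2) * (2 * n * \<delta>\<^sup>2)"
  proof (intro mult_mono sum_dev_sq sum_nonneg)
    have "(\<Sum>j<n. (Q i j)\<^sup>2) \<le> (\<Sum>j<n. p\<^sup>2 * Q i j)"
      by (rule sum_mono) (use Q_le[OF i] Q_nonneg[OF i] in \<open>simp add: power2_eq_square mult_right_mono\<close>)
    also have "\<dots> = p\<^sup>2 * (\<Sum>j<n. Q i j)" by (simp add: sum_distrib_left)
    also have "\<dots> \<le> p\<^sup>2 * 2" using rows[OF i] \<epsilon> \<gamma> by (intro mult_left_mono) auto
    finally show "(\<Sum>j<n. (Q i j)\<^sup>2) \<le> p\<^sup>2 * 2" .
  qed auto
  also have "\<dots> = (192 * p\<^sup>2 * n * \<epsilon>\<^sup>2) / (48 * \<gamma>\<^sup>2)" using \<gamma> by (simp add: \<delta>_def power_divide)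
  also have "\<dots> \<le> \<gamma>\<^sup>2 / (48 * \<gamma>\<^sup>2)" using p_small by (intro divide_right_mono) auto
  also have "\<dots> \<le> (1/6)\<^sup>2" using \<gamma> by (simp add: power2_eq_square)
  finally have "\<bar>D\<bar>\<^sup>2 \<le> (1/6)\<^sup>2" by simp
  then have D: "\<bar>D\<bar> \<le> 1/6" by (rule power2_le_imp_le) simp
  have "lam * u i = (\<Sum>j<n. Q i j) + D" unfolding eigen[OF i, symmetric] D_def
    by (simp add: right_diff_distrib sum_subtractf)
  then have lu: "\<bar>lam * u i - 1\<bar> \<le> 1/3" using D rows[OF i] \<epsilon> \<gamma> by linarith
  have "(2 * \<delta>)\<^sup>2 \<le> 1/16" using \<delta>_sq \<delta>(2) by (simp add: power_mult_distrib)
  then have l: "15/16 \<le> lam" "lam \<le> 17/16" using lam_near_one by linarith+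
  have pos: "0 < u i"
  proof (rule ccontr)
    assume "\<not> 0 < u i"
    then have "lam * u i \<le> 0" using l by (simp add: mult_nonneg_nonpos)
    then show False using lu by linarith
  qed
  have "15/16 * u i \<le> lam * u i" "lam * u i \<le> 17/16 * u i" using l pos by (auto intro: mult_right_mono)
  then show "1/2 \<le> u i" "u i \<le> 2" using lu by linarith+
qed

text \<open>Splitting \<open>z\<close> along \<open>u\<close> turns the gap on the complement of
  \<open>u\<close> into one around the plain mean. Half of \<open>\<gamma>\<close> is lost because
  \<open>z - c\<close> is the sum of \<open>x\<close> and \<open>c * (u - 1)\<close>, whose square
  is bounded by twice the squares; the mean of \<open>z\<close> is at least as good a centre as
  \<open>c\<close>.\<close>

lemma spectral_gap:
  "\<gamma> / 2 * (\<Sum>i<n. (z i - (\<Sum>j<n. z j) / n)\<^sup>2) - \<delta> * (\<Sum>i<n. (z i)\<^sup>2)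
    \<le> (\<Sum>i<n. (z i)\<^sup>2) - (\<Sum>i<n. \<Sum>j<n. Q i j * z i * z j)"
proof -
  define c where "c = (\<Sum>i<n. z i * u i) / n"
  define x where "x i = z i - c * u i" for i
  define Sz where "Sz = (\<Sum>i<n. (z i)\<^sup>2)"
  define Sx where "Sx = (\<Sum>i<n. (x i)\<^sup>2)"
  have zu: "(\<Sum>i<n. z i * u i) = n * c" using n_pos by (simp add: c_def)
  have xu: "(\<Sum>i<n. x i * u i) = 0"
  proof -
    have "(\<Sum>i<n. x i * u i) = (\<Sum>i<n. z i * u i) - c * (\<Sum>i<n. (u i)\<^sup>2)"
      by (simp add: x_def left_diff_distrib sum_subtractf sum_distrib_left power2_eq_square mult.assoc)
    then show ?thesis by (simp add: zu u_norm)
  qed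
  have S: "Sz = Sx + n * c\<^sup>2"
  proof -
    have "Sz = (\<Sum>i<n. (x i)\<^sup>2 + c\<^sup>2 * (u i)\<^sup>2 + 2 * c * (x i * u i))"
      unfolding Sz_def by (rule sum.cong) (auto simp: x_def power2_eq_square algebra_simps)
    then show ?thesis by (simp add: sum.distrib sum_distrib_left[symmetric] xu u_norm Sx_def)
  qed
  have Sz0: "0 \<le> Sz" unfolding Sz_def by (intro sum_nonneg) simp
  have Sx0: "0 \<le> Sx" unfolding Sx_def by (intro sum_nonneg) simp
  then have nc: "n * c\<^sup>2 \<le> Sz" using S by simp
  have xQu: "(\<Sum>i<n. \<Sum>j<n. Q i j * (x i * u j)) = 0"
  proof -
    have "(\<Sum>i<n. \<Sum>j<n. Q i j * (x i * u j)) = (\<Sum>i<n. x i * (\<Sum>j<n. Q i j * u j))"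
      by (simp add: sum_distrib_left mult_ac)
    also have "\<dots> = (\<Sum>i<n. lam * (x i * u i))" by (rule sum.cong) (auto simp: eigen)
    finally show ?thesis by (simp add: sum_distrib_left[symmetric] xu)
  qed
  have uQx: "(\<Sum>i<n. \<Sum>j<n. Q i j * (u i * x j)) = 0"
  proof -
    have "(\<Sum>i<n. \<Sum>j<n. Q i j * (u i * x j)) = (\<Sum>j<n. \<Sum>i<n. Q i j * (u i * x j))" by (rule sum.swap)
    also have "\<dots> = (\<Sum>i<n. \<Sum>j<n. Q i j * (x i * u j))"
      by (intro sum.cong refl) (auto simp: Q_sym)
    finally show ?thesis using xQu by simp
  qed
  have uQu: "(\<Sum>i<n. \<Sum>j<n. Q i j * (u i * u j)) = lam * n"
  proof -
    have "(\<Sum>i<n. \<Sum>j<n. Q i j * (u i * u j)) = (\<Sum>i<n. u i * (\<Sum>j<n. Q i j * u j))"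
      by (simp add: sum_distrib_left mult_ac)
    also have "\<dots> = (\<Sum>i<n. lam * (u i)\<^sup>2)" by (rule sum.cong) (auto simp: eigen power2_eq_square)
    finally show ?thesis by (simp add: sum_distrib_left[symmetric] u_norm)
  qed
  have "(\<Sum>i<n. \<Sum>j<n. Q i j * z i * z j) = (\<Sum>i<n. \<Sum>j<n. Q i j * x i * x j + c * (Q i j * (x i * u j))
      + c * (Q i j * (u i * x j)) + c\<^sup>2 * (Q i j * (u i * u j)))"
    by (intro sum.cong refl) (simp add: x_def power2_eq_square algebra_simps)
  also have "\<dots> = (\<Sum>i<n. \<Sum>j<n. Q i j * x i * x j) + c\<^sup>2 * (lam * n)"
    by (simp only: sum.distrib sum_distrib_left[symmetric] xQu uQx uQu mult_zero_right add_0_right)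
  finally have form: "(\<Sum>i<n. \<Sum>j<n. Q i j * z i * z j) \<le> (1 - \<gamma>) * Sx + c\<^sup>2 * (lam * n)"
    using orth_le[OF xu] by (simp add: Sx_def)
  have "(\<Sum>i<n. (z i - (\<Sum>j<n. z j) / n)\<^sup>2) \<le> (\<Sum>i<n. (z i - c)\<^sup>2)"
    by (rule sum_sq_deviation_mean_le[OF n_pos])
  also have "\<dots> \<le> (\<Sum>i<n. 2 * (x i)\<^sup>2 + 2 * c\<^sup>2 * (u i - 1)\<^sup>2)"
  proof (rule sum_mono)
    fix i
    have "2 * (x i)\<^sup>2 + 2 * c\<^sup>2 * (u i - 1)\<^sup>2 - (z i - c)\<^sup>2 = (x i - c * (u i - 1))\<^sup>2"
      by (simp add: x_def power2_eq_square algebra_simps)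
    then show "(z i - c)\<^sup>2 \<le> 2 * (x i)\<^sup>2 + 2 * c\<^sup>2 * (u i - 1)\<^sup>2"
      using zero_le_power2[of "x i - c * (u i - 1)"] by linarith
  qed
  also have "\<dots> = 2 * Sx + 2 * c\<^sup>2 * (\<Sum>i<n. (u i - 1)\<^sup>2)"
    by (simp add: sum.distrib sum_distrib_left Sx_def)
  also have "\<dots> \<le> 2 * Sx + 2 * c\<^sup>2 * (2 * n * \<delta>\<^sup>2)" by (intro add_left_mono mult_left_mono sum_dev_sq) auto
  also have "\<dots> = 2 * Sx + 4 * \<delta>\<^sup>2 * (n * c\<^sup>2)" by simp
  also have "\<dots> \<le> 2 * Sx + 4 * \<delta>\<^sup>2 * Sz" by (intro add_left_mono mult_left_mono nc) auto
  finally have "\<gamma> / 2 * (\<Sum>i<n. (z i - (\<Sum>j<n. z j) / n)\<^sup>2) \<le> \<gamma> / 2 * (2 * Sx + 4 * \<delta>\<^sup>2 * Sz)"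
    using \<gamma> by (intro mult_left_mono) auto
  also have "\<dots> = \<gamma> * Sx + \<gamma> * (2 * \<delta>\<^sup>2 * Sz)" by (simp add: algebra_simps)
  also have "\<dots> \<le> \<gamma> * Sx + 1 * (2 * \<delta>\<^sup>2 * Sz)"
    using \<gamma> Sz0 by (intro add_left_mono mult_right_mono mult_nonneg_nonneg) auto
  finally have D: "\<gamma> / 2 * (\<Sum>i<n. (z i - (\<Sum>j<n. z j) / n)\<^sup>2) \<le> \<gamma> * Sx + 2 * \<delta>\<^sup>2 * Sz" by simp
  have "c\<^sup>2 * (lam * n) - n * c\<^sup>2 = (lam - 1) * (n * c\<^sup>2)" by (simp add: algebra_simps)
  also have "\<dots> \<le> (2 * \<delta>)\<^sup>2 * (n * c\<^sup>2)" using lam_near_one by (intro mult_right_mono) auto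
  also have "\<dots> \<le> (2 * \<delta>)\<^sup>2 * Sz" by (intro mult_left_mono nc) auto
  finally have "c\<^sup>2 * (lam * n) - n * c\<^sup>2 \<le> 4 * \<delta>\<^sup>2 * Sz" by (simp add: power_mult_distrib)
  then have "\<gamma> / 2 * (\<Sum>i<n. (z i - (\<Sum>j<n. z j) / n)\<^sup>2) - 6 * (\<delta>\<^sup>2 * Sz) \<le> Sz - (\<Sum>i<n. \<Sum>j<n. Q i j * z i * z j)"
    using form D unfolding S by (simp add: algebra_simps)
  moreover have "\<delta>\<^sup>2 * Sz \<le> \<delta> / 8 * Sz" using \<delta>_sq Sz0 by (intro mult_right_mono)
  moreover have "0 \<le> \<delta> * Sz" using \<delta> Sz0 by simp
  ultimately show ?thesis unfolding Sz_def by linarith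
qed

lemma near_regular:
  assumes "\<And>i. i < n \<Longrightarrow> Q i i = 0" "\<And>i. i < n \<Longrightarrow> \<bar>\<mu> i\<bar> \<le> 1" "0 < p" "p \<le> 1"
  shows "near_regular_ising n Q \<mu> u lam \<delta> p (2 * \<delta>) (\<gamma> / 2)"
proof (unfold_locales)
  show "\<bar>(\<Sum>i<n. u i) / n - 1\<bar> \<le> \<delta>"
    using a_bounds \<delta>_sq \<delta> unfolding a_def[symmetric] by linarith
  show "(2 * \<delta>)\<^sup>2 \<le> 1/2" using \<delta>_sq \<delta>(2) by (simp add: power_mult_distrib)
  show "\<bar>(\<Sum>j<n. Q i j) - 1\<bar> \<le> \<delta>" if "i < n" for i using rows[OF that] \<delta>(3) by linarith
  show "\<gamma> / 2 * (\<Sum>i<n. (z i - (\<Sum>j<n. z j) / n)\<^sup>2) - \<delta> * (\<Sum>i<n. (z i)\<^sup>2)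
    \<le> (\<Sum>i<n. (z i)\<^sup>2) - (\<Sum>i<n. \<Sum>j<n. Q i j * z i * z j)" for z by (rule spectral_gap)
qed (use assms n_pos Q_sym Q_nonneg Q_le u_near_one eigen lam_near_one \<delta> \<gamma> in auto)

end

subsection \<open>Ising models on graphs\<close>

lemma spin_configs_bij: "bij_betw (\<lambda>A. vec n (spin A)) (Pow {..<n}) (spin_configs n)"
proof (rule bij_betwI[where g = "\<lambda>x. {i. i < n \<and> x $ i = 1}"])
  show "(\<lambda>A. vec n (spin A)) \<in> Pow {..<n} \<rightarrow> spin_configs n"
    by (auto simp: spin_configs_def spin_def)
  show "(\<lambda>x. {i. i < n \<and> x $ i = 1}) \<in> spin_configs n \<rightarrow> Pow {..<n}" by auto
  show "{i. i < n \<and> vec n (spin A) $ i = 1} = A" if "A \<in> Pow {..<n}" for A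
    using that by (auto simp: spin_def split: if_splits)
  show "vec n (spin {i. i < n \<and> x $ i = 1}) = x" if "x \<in> spin_configs n" for x
    by (rule eq_vecI) (use that in \<open>auto simp: spin_configs_def spin_def\<close>)
qed

lemma ising_weight_spin:
  assumes "Q \<in> carrier_mat n n" "\<mu> \<in> carrier_vec n"
  shows "ising_weight 1 Q \<mu> (vec n (spin A)) = exp (energy n (\<lambda>i j. Q $$ (i, j)) (\<lambda>i. \<mu> $ i) A)"
proof -
  have "vec n (spin A) \<bullet> (Q *\<^sub>v vec n (spin A)) = (\<Sum>i<n. \<Sum>j<n. Q $$ (i, j) * spin A i * spin A j)"
    using assms by (simp add: scalar_prod_def lessThan_atLeast0 sum_distrib_left mult_ac)
  moreover have "\<mu> \<bullet> vec n (spin A) = (\<Sum>i<n. \<mu> $ i * spin A i)"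
    using assms by (simp add: scalar_prod_def lessThan_atLeast0)
  ultimately show ?thesis by (simp add: ising_weight_def energy_def)
qed

lemma prob_ising_eq_gibbs_mean:
  assumes Q: "Q \<in> carrier_mat n n" and \<mu>: "\<mu> \<in> carrier_vec n"
  shows "measure_pmf.prob (ising 1 Q \<mu>) {x. c \<le> vec_mean x}
    = gibbs_mean n (\<lambda>i j. Q $$ (i, j)) (\<lambda>i. \<mu> $ i) (\<lambda>A. if c \<le> (\<Sum>i<n. spin A i) / n then 1 else 0)"
proof -
  let ?P = "ising 1 Q \<mu>" and ?S = "spin_configs n"
  have dim: "dim_vec \<mu> = n" using \<mu> by simp
  have supp: "set_pmf ?P \<subseteq> ?S" using pmf_ising[of 1 Q \<mu>] dim by (auto simp: set_pmf_iff split: if_splits)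
  have "measure_pmf.prob ?P {x. c \<le> vec_mean x} = measure_pmf.prob ?P ({x. c \<le> vec_mean x} \<inter> ?S)"
    by (rule measure_prob_cong_0) (use supp in \<open>auto simp: set_pmf_iff\<close>)
  also have "\<dots> = (\<Sum>x\<in>{x. c \<le> vec_mean x} \<inter> ?S. pmf ?P x)"
    by (rule measure_measure_pmf_finite) (use finite_spin_configs in auto)
  also have "\<dots> = (\<Sum>x\<in>?S. if c \<le> vec_mean x then pmf ?P x else 0)"
    by (subst sum.inter_filter[symmetric]) (auto simp: finite_spin_configs intro!: sum.cong)
  also have "\<dots> = (\<Sum>x\<in>?S. ising_weight 1 Q \<mu> x * (if c \<le> vec_mean x then 1 else 0)) / ising_Z 1 Q \<mu>"
    unfolding sum_divide_distrib by (rule sum.cong) (auto simp: pmf_ising dim)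
  also have "(\<Sum>x\<in>?S. ising_weight 1 Q \<mu> x * (if c \<le> vec_mean x then 1 else 0))
      = (\<Sum>A\<in>Pow {..<n}. ising_weight 1 Q \<mu> (vec n (spin A)) * (if c \<le> vec_mean (vec n (spin A)) then 1 else 0))"
    by (rule sum.reindex_bij_betw[OF spin_configs_bij, symmetric])
  also have "ising_Z 1 Q \<mu> = (\<Sum>A\<in>Pow {..<n}. ising_weight 1 Q \<mu> (vec n (spin A)))"
    unfolding ising_Z_def dim by (rule sum.reindex_bij_betw[OF spin_configs_bij, symmetric])
  finally show ?thesis
    by (simp add: gibbs_mean_def gibbs_sum_def ising_weight_spin[OF Q \<mu>] vec_mean_def)
qed

lemma simple_graph_no_loop: "simple_graph n E \<Longrightarrow> {i, i} \<notin> E"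
  by (auto simp: simple_graph_def)

lemma sum_adjacency_eq_degree:
  assumes E: "simple_graph n E" and i: "i < n"
  shows "(\<Sum>j<n. if {i, j} \<in> E then 1 else 0 :: real) = degree_of E i"
proof -
  have "bij_betw (\<lambda>j. {i, j}) {j \<in> {..<n}. {i, j} \<in> E} {e \<in> E. i \<in> e}"
    unfolding bij_betw_def
  proof
    show "inj_on (\<lambda>j. {i, j}) {j \<in> {..<n}. {i, j} \<in> E}"
      by (auto simp: inj_on_def doubleton_eq_iff)
    show "(\<lambda>j. {i, j}) ` {j \<in> {..<n}. {i, j} \<in> E} = {e \<in> E. i \<in> e}"
    proof
      show "{e \<in> E. i \<in> e} \<subseteq> (\<lambda>j. {i, j}) ` {j \<in> {..<n}. {i, j} \<in> E}"
      proof
        fix e assume "e \<in> {e \<in> E. i \<in> e}"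
        then have e: "e \<in> E" "i \<in> e" "e \<subseteq> {..<n}" "card e = 2" using E by (auto simp: simple_graph_def)
        then obtain j where "e = {i, j}" by (metis card_2_iff insert_commute insertE singletonD)
        then show "e \<in> (\<lambda>j. {i, j}) ` {j \<in> {..<n}. {i, j} \<in> E}" using e by auto
      qed
    qed auto
  qed
  then have "card {j \<in> {..<n}. {i, j} \<in> E} = degree_of E i"
    unfolding degree_of_def by (rule bij_betw_same_card)
  then show ?thesis by (simp add: sum.If_cases Int_def)
qed

lemma graph_leading_eigenvector:
  fixes n E
  defines "d \<equiv> avg_degree n E" and "Q \<equiv> \<lambda>i j. scaled_adj n E $$ (i, j)"
  assumes E: "simple_graph n E" and n: "2 \<le> n" and d: "0 < d"
    and near: "\<And>i. i < n \<Longrightarrow> \<bar>degree_of E i / d - 1\<bar> \<le> \<epsilon>"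
    and \<gamma>: "0 < \<gamma>" "\<gamma> \<le> 1" and \<epsilon>: "0 < \<epsilon>" "8 * \<epsilon> \<le> \<gamma>"
    and gap: "second_largest_eigenvalue (scaled_adj n E) \<le> 1 - \<gamma>"
    and small: "192 * n * \<epsilon>\<^sup>2 \<le> \<gamma>\<^sup>2 * d"
  obtains u lam where "leading_eigenvector n Q u lam \<gamma> \<epsilon> (1 / sqrt d)"
proof -
  let ?A = "scaled_adj n E"
  have A: "?A \<in> carrier_mat n n" by (simp add: scaled_adj_def adj_matrix_def)
  have Qij: "Q i j = (if {i, j} \<in> E then 1 else 0) / d" if "i < n" "j < n" for i j
    using that by (simp add: Q_def scaled_adj_def adj_matrix_def d_def)
  have Qsym: "Q i j = Q j i" if "i < n" "j < n" for i j
    using that by (simp add: Qij insert_commute)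
  have sym: "transpose_mat ?A = ?A"
  proof (rule eq_matI)
    fix i j assume "i < dim_row ?A" "j < dim_col ?A"
    then show "transpose_mat ?A $$ (i, j) = ?A $$ (i, j)" using A Qsym[of i j] by (simp add: Q_def)
  qed (use A in auto)
  obtain v lam where v: "v \<in> carrier_vec n" "v \<bullet> v = 1" "?A *\<^sub>v v = lam \<cdot>\<^sub>v v"
    and orth: "\<And>x. x \<in> carrier_vec n \<Longrightarrow> v \<bullet> x = 0 \<Longrightarrow> x \<bullet> (?A *\<^sub>v x) \<le> second_largest_eigenvalue ?A * (x \<bullet> x)"
    using second_largest_eigenvalue_le[OF A sym n] by blast
  \<comment> \<open>The modulus gives \<open>u\<close> squared norm \<open>n\<close>; the sign makes
    its entries sum to a nonnegative number.\<close>
  define c where "c = (if 0 \<le> (\<Sum>i<n. v $ i) then sqrt n else - sqrt n)"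
  have c2: "c\<^sup>2 = n" by (simp add: c_def)
  have c0: "c \<noteq> 0" using n by (simp add: c_def)
  define u where "u i = c * v $ i" for i
  have row: "(\<Sum>j<n. Q i j) = degree_of E i / d" if i: "i < n" for i
  proof -
    have "(\<Sum>j<n. Q i j) = (\<Sum>j<n. if {i, j} \<in> E then 1 else 0 :: real) / d"
      unfolding sum_divide_distrib by (rule sum.cong) (use i in \<open>auto simp: Qij\<close>)
    then show ?thesis using sum_adjacency_eq_degree[OF E i] by simp
  qed
  have "leading_eigenvector n Q u lam \<gamma> \<epsilon> (1 / sqrt d)"
  proof
    show "0 < n" using n by simp
    show "0 \<le> Q i j" "Q i j \<le> (1 / sqrt d)\<^sup>2" if "i < n" "j < n" for i j
      using d that by (auto simp: Qij power_divide)
    show "\<bar>(\<Sum>j<n. Q i j) - 1\<bar> \<le> \<epsilon>" if "i < n" for i using near[OF that] row[OF that] by simp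
    show "(\<Sum>i<n. \<Sum>j<n. Q i j) = n"
    proof -
      have nd: "(\<Sum>i<n. real (degree_of E i)) = n * d" using n by (simp add: d_def avg_degree_def)
      have "(\<Sum>i<n. \<Sum>j<n. Q i j) = (\<Sum>i<n. degree_of E i / d)" by (rule sum.cong) (auto simp: row)
      also have "\<dots> = n * d / d" by (simp only: sum_divide_distrib[symmetric] nd)
      finally show ?thesis using d by simp
    qed
    show "(\<Sum>i<n. (u i)\<^sup>2) = n"
    proof -
      have "(\<Sum>i<n. (u i)\<^sup>2) = c\<^sup>2 * (v \<bullet> v)"
        using v(1) by (simp add: u_def scalar_prod_def lessThan_atLeast0 sum_distrib_left power2_eq_square mult_ac)
      then show ?thesis by (simp add: v c2)
    qed
    show "0 \<le> (\<Sum>i<n. u i)"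
      by (auto simp: u_def sum_distrib_left[symmetric] c_def mult_nonneg_nonpos)
    show "(\<Sum>j<n. Q i j * u j) = lam * u i" if i: "i < n" for i
    proof -
      have "(?A *\<^sub>v v) $ i = (\<Sum>j<n. Q i j * v $ j)"
        using i A v(1) by (simp add: scalar_prod_def lessThan_atLeast0 Q_def)
      then have "(\<Sum>j<n. Q i j * v $ j) = lam * v $ i" using v i by simp
      moreover have "(\<Sum>j<n. Q i j * u j) = c * (\<Sum>j<n. Q i j * v $ j)"
        by (simp add: u_def sum_distrib_left mult_ac)
      ultimately show ?thesis by (simp add: u_def)
    qed
    show "(\<Sum>i<n. \<Sum>j<n. Q i j * x i * x j) \<le> (1 - \<gamma>) * (\<Sum>i<n. (x i)\<^sup>2)"
      if x: "(\<Sum>i<n. x i * u i) = 0" for x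
    proof -
      define X where "X = vec n x"
      have X: "X \<in> carrier_vec n" by (simp add: X_def)
      have "c * (v \<bullet> X) = (\<Sum>i<n. x i * u i)"
        by (simp add: X_def scalar_prod_def lessThan_atLeast0 u_def sum_distrib_left mult_ac)
      then have "v \<bullet> X = 0" using x c0 by simp
      note * = orth[OF X this]
      have XX: "X \<bullet> X = (\<Sum>i<n. (x i)\<^sup>2)"
        by (simp add: X_def scalar_prod_def lessThan_atLeast0 power2_eq_square)
      have "X \<bullet> (?A *\<^sub>v X) = (\<Sum>i<n. \<Sum>j<n. Q i j * x i * x j)"
        using A by (simp add: X_def scalar_prod_def lessThan_atLeast0 Q_def sum_distrib_left mult_ac)
      moreover have "second_largest_eigenvalue ?A * (X \<bullet> X) \<le> (1 - \<gamma>) * (X \<bullet> X)"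
        by (intro mult_right_mono gap) (simp add: XX sum_nonneg)
      ultimately show ?thesis using * XX by simp
    qed
    show "192 * (1 / sqrt d)\<^sup>2 * n * \<epsilon>\<^sup>2 \<le> \<gamma>\<^sup>2" using small d by (simp add: power_divide field_simps)
  qed (use \<gamma> \<epsilon> Qsym in auto)
  then show ?thesis by (rule that)
qed

text \<open>The tail is bounded for the field equal to \<open>b\<close> on \<open>S\<close> and 0
  elsewhere, whose lowered version may be negative off \<open>S\<close>. This field lies below
  \<open>\<mu>\<close> and the event is increasing, so the bound passes to the actual field.\<close>

theorem ising_lower_tail:
  fixes n E s b \<gamma> \<epsilon> \<tau>
  defines "d \<equiv> avg_degree n E" and "\<iota> \<equiv> tolerance (\<gamma> / 2)" and "M \<equiv> real s * b"
  assumes E: "simple_graph n E" and n: "2 \<le> n" and d: "1 \<le> d"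
    and near: "\<And>i. i < n \<Longrightarrow> \<bar>degree_of E i / d - 1\<bar> \<le> \<epsilon>"
    and \<gamma>: "0 < \<gamma>" "\<gamma> \<le> 1" and \<epsilon>: "0 < \<epsilon>" "8 * \<epsilon> \<le> \<gamma>"
    and gap: "second_largest_eigenvalue (scaled_adj n E) \<le> 1 - \<gamma>"
    and small: "192 * n * \<epsilon>\<^sup>2 \<le> \<gamma>\<^sup>2 * d"
    and S: "S \<subseteq> {..<n}" "card S = s" "1 \<le> s"
    and \<mu>: "\<mu> \<in> carrier_vec n" "\<And>i. i < n \<Longrightarrow> 0 \<le> \<mu> $ i" "\<And>i. i \<in> S \<Longrightarrow> b \<le> \<mu> $ i"
    and b: "0 < b" "b \<le> 1" "2 * b\<^sup>2 \<le> \<iota>"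
    and \<tau>: "0 < \<tau>" "n * \<tau> ^ 3 = M"
    and tol: "1 / \<tau> \<le> \<iota> * M" "n * (2 * (\<epsilon> / \<gamma>)) ^ 3 \<le> \<iota> * M" "n * (1 / sqrt d) ^ 3 \<le> \<iota> * M"
      "\<epsilon> / \<gamma> \<le> \<iota>" "400 * (\<epsilon> / \<gamma>) \<le> \<tau>"
  shows "1 - exp (- (M * \<tau> / 3200))
    \<le> measure_pmf.prob (ising 1 (scaled_adj n E) \<mu>) {x. \<tau> / 400 \<le> vec_mean x}"
proof -
  define Q where "Q i j = scaled_adj n E $$ (i, j)" for i j
  define p where "p = 1 / sqrt d"
  have d0: "0 < d" using d by simp
  obtain u lam where ev: "leading_eigenvector n Q u lam \<gamma> \<epsilon> p"
    using graph_leading_eigenvector[of n E \<epsilon> \<gamma>, folded d_def, OF E n d0 near \<gamma> \<epsilon> gap small]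
    unfolding Q_def p_def by blast
  interpret ev: leading_eigenvector n Q u lam \<gamma> \<epsilon> p by (rule ev)
  have M: "0 < M" using S b by (simp add: M_def)
  have sn: "s \<le> n" using S card_mono[of "{..<n}" S] by simp
  define field where "field i = (if i \<in> S then b else 0)" for i
  \<comment> \<open>Lowering by \<open>r / n\<close> at each site takes at most \<open>M / 8\<close>
    from the weighted signal, which is at least \<open>M / 2\<close>, so more than
    \<open>M / 4\<close> is left.\<close>
  define r where "r = M / 8"
  define \<nu> where "\<nu> i = field i - r / n" for i
  have rn: "0 \<le> r / n" "r / n \<le> b"
  proof -
    show "0 \<le> r / n" using M by (simp add: r_def)
    have "s * b \<le> n * b" using sn b by simp
    then have "r \<le> n * b" using M unfolding r_def M_def by linarith
    then show "r / n \<le> b" using n by (simp add: field_simps)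
  qed
  have \<nu>b: "\<bar>\<nu> i\<bar> \<le> b" for i using rn b by (auto simp: \<nu>_def field_def)
  have sumf: "(\<Sum>i<n. c i * field i) = b * (\<Sum>i\<in>S. c i)" for c :: "nat \<Rightarrow> real"
  proof -
    have "(\<Sum>i<n. c i * field i) = (\<Sum>i\<in>{..<n}. if i \<in> S then b * c i else 0)"
      by (rule sum.cong) (auto simp: field_def)
    also have "\<dots> = (\<Sum>i\<in>{..<n} \<inter> S. b * c i)" by (simp add: sum.inter_restrict)
    also have "{..<n} \<inter> S = S" using S by auto
    finally show ?thesis by (simp add: sum_distrib_left)
  qed
  interpret near_regular_ising n Q \<nu> u lam ev.\<delta> p "2 * ev.\<delta>" "\<gamma> / 2"
  proof (rule ev.near_regular)
    show "Q i i = 0" if "i < n" for i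
      using that simple_graph_no_loop[OF E, of i] by (simp add: Q_def scaled_adj_def adj_matrix_def)
    show "\<bar>\<nu> i\<bar> \<le> 1" for i using \<nu>b[of i] b by linarith
    show "0 < p" "p \<le> 1" using d by (auto simp: p_def)
  qed
  have \<delta>: "ev.\<delta> = \<epsilon> / \<gamma>" by (rule ev.\<delta>_def)
  have su: "n * (1/2) \<le> (\<Sum>i<n. u i)" "(\<Sum>i<n. u i) \<le> n"
    unfolding ev.sum_u using mult_left_mono[OF ev.a_bounds(1), of n] mult_left_mono[OF ev.a_bounds(2), of n]
    by simp_all
  have sS: "s * (1/2) \<le> (\<Sum>i\<in>S. u i)" "(\<Sum>i\<in>S. u i) \<le> s * 2"
  proof -
    have "(\<Sum>i\<in>S. 1/2) \<le> (\<Sum>i\<in>S. u i)" by (rule sum_mono) (use S v_bounds in auto)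
    then show "s * (1/2) \<le> (\<Sum>i\<in>S. u i)" using S by simp
    have "(\<Sum>i\<in>S. u i) \<le> (\<Sum>i\<in>S. 2)" by (rule sum_mono) (use S v_bounds in auto)
    then show "(\<Sum>i\<in>S. u i) \<le> s * 2" using S by simp
  qed
  have uv: "(\<Sum>i<n. u i * \<nu> i) = b * (\<Sum>i\<in>S. u i) - r / n * (\<Sum>i<n. u i)"
    unfolding sumf[symmetric] by (simp add: \<nu>_def right_diff_distrib sum_subtractf sum_distrib_left sum_divide_distrib mult.commute)
  have bS: "M / 2 \<le> b * (\<Sum>i\<in>S. u i)" "b * (\<Sum>i\<in>S. u i) \<le> 2 * M"
    using mult_left_mono[OF sS(1), of b] mult_left_mono[OF sS(2), of b] b by (auto simp: M_def mult_ac)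
  have rU: "0 \<le> r / n * (\<Sum>i<n. u i)" "r / n * (\<Sum>i<n. u i) \<le> M / 8"
  proof -
    show "0 \<le> r / n * (\<Sum>i<n. u i)" using rn su by (intro mult_nonneg_nonneg) auto
    have "r / n * (\<Sum>i<n. u i) \<le> r / n * n" using rn su by (intro mult_left_mono) auto
    then show "r / n * (\<Sum>i<n. u i) \<le> M / 8" using n by (simp add: r_def)
  qed
  \<comment> \<open>Two of the three factors are bounded by \<open>b\<close>, so the cubes sum to at
    most b^2 times the total field; the smallness of \<open>b\<close> enters here.\<close>
  have cubes: "(\<Sum>i<n. \<bar>\<nu> i\<bar> ^ 3) \<le> \<iota> * M"
  proof -
    have "(\<Sum>i<n. \<bar>\<nu> i\<bar> ^ 3) \<le> (\<Sum>i<n. b\<^sup>2 * (field i + r / n))"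
    proof (rule sum_mono)
      fix i
      have "\<bar>\<nu> i\<bar> \<le> field i + r / n" using rn b by (auto simp: \<nu>_def field_def)
      moreover have "\<bar>\<nu> i\<bar>\<^sup>2 \<le> b\<^sup>2" using \<nu>b by (intro power_mono) auto
      ultimately have "\<bar>\<nu> i\<bar>\<^sup>2 * \<bar>\<nu> i\<bar> \<le> b\<^sup>2 * (field i + r / n)" by (intro mult_mono) auto
      then show "\<bar>\<nu> i\<bar> ^ 3 \<le> b\<^sup>2 * (field i + r / n)" by (simp add: power2_eq_square power3_eq_cube)
    qed
    also have "\<dots> = b\<^sup>2 * (M + r)"
      using sumf[of "\<lambda>_. 1"] S n by (simp add: sum_distrib_left[symmetric] sum.distrib M_def mult.commute)
    also have "\<dots> \<le> b\<^sup>2 * (2 * M)" using M by (intro mult_left_mono) (auto simp: r_def)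
    also have "\<dots> \<le> \<iota> * M" using mult_right_mono[OF b(3), of M] M by (simp add: mult_ac)
    finally show ?thesis .
  qed
  have mean: "\<tau> / 200 \<le> gibbs_mean n Q \<nu> (\<lambda>A. (\<Sum>i<n. spin A i) / n)"
  proof (rule mean_magnetization_ge[OF M \<tau>])
    show "1 / \<tau> \<le> tolerance (\<gamma> / 2) * M" using tol(1) by (simp add: \<iota>_def)
    show "n * (2 * ev.\<delta>) ^ 3 \<le> tolerance (\<gamma> / 2) * M" using tol(2) by (simp only: \<iota>_def \<delta>)
    show "n * p ^ 3 \<le> tolerance (\<gamma> / 2) * M" using tol(3) by (simp only: \<iota>_def p_def)
    show "ev.\<delta> \<le> tolerance (\<gamma> / 2)" using tol(4) by (simp only: \<iota>_def \<delta>)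
    show "M / 4 \<le> (\<Sum>i<n. u i * \<nu> i)" unfolding uv using bS(1) rU M by linarith
    show "(\<Sum>i<n. u i * \<nu> i) \<le> 3 * M" unfolding uv using bS(2) rU M by linarith
    show "(\<Sum>i<n. \<bar>\<nu> i\<bar> ^ 3) \<le> tolerance (\<gamma> / 2) * M" using cubes by (simp only: \<iota>_def)
    have "n * (400 * ev.\<delta>) \<le> n * \<tau>" unfolding \<delta> by (intro mult_left_mono tol(5)) simp
    then show "(\<Sum>i<n. \<bar>u i - 1\<bar>) \<le> n * \<tau> / 200" using ev.sum_abs_dev by simp
  qed
  let ?X = "\<lambda>A. (\<Sum>i<n. spin A i) / real n"
  have "gibbs_mean n Q field (\<lambda>A. if ?X A < \<tau> / 400 then 1 else 0) \<le> exp (r * (\<tau> / 400 - gibbs_mean n Q \<nu> ?X))"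
    using gibbs_lower_tail[of r n Q field "\<tau> / 400"] M unfolding \<nu>_def r_def by simp
  also have "\<dots> \<le> exp (- (M * \<tau> / 3200))"
  proof -
    \<comment> \<open>The mean exceeds the threshold by at least \<tau> / 400, which with
      \<open>r = M / 8\<close> gives the constant 3200.\<close>
    have "r * (\<tau> / 400 - gibbs_mean n Q \<nu> ?X) \<le> r * (\<tau> / 400 - \<tau> / 200)" using mean M by (intro mult_left_mono) (auto simp: r_def)
    also have "\<dots> = - (M * \<tau> / 3200)" by (simp add: r_def field_simps)
    finally show ?thesis by simp
  qed
  finally have tail: "gibbs_mean n Q field (\<lambda>A. if ?X A < \<tau> / 400 then 1 else 0) \<le> exp (- (M * \<tau> / 3200))" .
  have "gibbs_mean n Q field (\<lambda>A. if \<tau> / 400 \<le> ?X A then 1 else 0)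
      = gibbs_mean n Q field (\<lambda>A. 1 - (if ?X A < \<tau> / 400 then 1 else 0))"
    by (rule gibbs_mean_cong) auto
  also have "\<dots> = 1 - gibbs_mean n Q field (\<lambda>A. if ?X A < \<tau> / 400 then 1 else 0)"
    by (simp only: gibbs_mean_diff gibbs_mean_const)
  finally have "1 - exp (- (M * \<tau> / 3200)) \<le> gibbs_mean n Q field (\<lambda>A. if \<tau> / 400 \<le> ?X A then 1 else 0)"
    using tail by simp
  also have "\<dots> \<le> gibbs_mean n Q (\<lambda>i. \<mu> $ i) (\<lambda>A. if \<tau> / 400 \<le> ?X A then 1 else 0)"
  proof (rule gibbs_mean_mono_field)
    show "field i \<le> \<mu> $ i" if "i < n" for i using \<mu>(2)[OF that] \<mu>(3)[of i] by (simp add: field_def)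
    fix A B :: "nat set" assume "A \<subseteq> B"
    then have "?X A \<le> ?X B" by (intro divide_right_mono sum_mono spin_mono) auto
    then show "(if \<tau> / 400 \<le> ?X A then 1 else 0) \<le> (if \<tau> / 400 \<le> ?X B then 1 else (0::real))"
      using order_trans[of "\<tau> / 400" "?X A" "?X B"] by (simp del: divide_le_cancel)
  qed (use ev.Q_nonneg in auto)
  also have "\<dots> = measure_pmf.prob (ising 1 (scaled_adj n E) \<mu>) {x. \<tau> / 400 \<le> vec_mean x}"
    unfolding Q_def by (rule prob_ising_eq_gibbs_mean[symmetric]) (use \<mu> in \<open>auto simp: scaled_adj_def adj_matrix_def\<close>)
  finally show ?thesis .
qed

text \<open>In the application \<open>r\<close> is n^(1/4), \<open>L\<close> is ln n and
  \<open>\<delta>\<close> is B sqrt (L / d). Density gives \<delta> \<le> B / (r L^2) and 1 / sqrt d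
  \<le> 1 / r, so \<open>n\<close> times the cube of either is at most of order \<open>r\<close>,
  which the signal dominates. The powers of \<open>L\<close> swallow the constants.\<close>

lemma error_terms_small:
  fixes n d L r B \<iota> M \<tau> \<delta> :: real
  assumes r: "1 \<le> r" "r ^ 4 = n" and B: "0 < B" and \<iota>: "0 < \<iota>"
    and L: "1 \<le> L" "8 * B \<le> L" "192 * B\<^sup>2 \<le> L" "B / \<iota> \<le> L" "400 * B \<le> L"
    and d: "r\<^sup>2 * L ^ 5 \<le> d" and \<delta>: "0 \<le> \<delta>" "\<delta>\<^sup>2 = B\<^sup>2 * L / d"
    and M: "r \<le> M" "r \<le> \<iota> * M" "8 * B ^ 3 * r \<le> \<iota> * M"
    and \<tau>: "0 < \<tau>" "n * \<tau> ^ 3 = M"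
  shows "1 \<le> d" "8 * \<delta> \<le> 1" "192 * n * \<delta>\<^sup>2 \<le> d" "1 / r \<le> \<tau>" "1 / \<tau> \<le> \<iota> * M" "n * (2 * \<delta>) ^ 3 \<le> \<iota> * M"
    "n * (1 / sqrt d) ^ 3 \<le> \<iota> * M" "\<delta> \<le> \<iota>" "400 * \<delta> \<le> \<tau>"
proof -
  have Lp: "1 \<le> L ^ k" for k using L(1) by (rule one_le_power)
  have r0: "0 < r" and L0: "0 < L" using r L by auto
  have rd: "r\<^sup>2 \<le> d"
    using mult_left_mono[OF Lp[of 5], of "r\<^sup>2"] d by simp
  have "1 \<le> r\<^sup>2" using r by simp
  then show d1: "1 \<le> d" using rd by linarith
  have \<delta>2: "\<delta>\<^sup>2 \<le> (B / (r * L\<^sup>2))\<^sup>2"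
  proof -
    have "\<delta>\<^sup>2 \<le> B\<^sup>2 * L / (r\<^sup>2 * L ^ 5)" unfolding \<delta>(2)
      using d d1 r0 L0 by (intro divide_left_mono mult_pos_pos) auto
    also have "\<dots> = (B / (r * L\<^sup>2))\<^sup>2" using r0 L0 by (simp add: field_simps power2_eq_square eval_nat_numeral)
    finally show ?thesis .
  qed
  have \<delta>r: "\<delta> \<le> B / (r * L\<^sup>2)"
    by (rule power2_le_imp_le[OF \<delta>2]) (use B r0 L0 in auto)
  also have "\<dots> \<le> B / (r * L)"
  proof (rule divide_left_mono)
    show "r * L \<le> r * L\<^sup>2" using r0 L(1) L0 by (simp add: power2_eq_square)
  qed (use B r0 L0 in auto)
  finally have \<delta>rL: "\<delta> \<le> B / (r * L)" .
  also have "\<dots> \<le> B / L" using B r L0 by (intro divide_left_mono) auto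
  finally have \<delta>L: "\<delta> \<le> B / L" .
  show "8 * \<delta> \<le> 1"
  proof -
    have "8 * \<delta> \<le> 8 * B / L" using \<delta>L by simp
    also have "\<dots> \<le> 1" using L L0 by simp
    finally show ?thesis .
  qed
  show "\<delta> \<le> \<iota>"
  proof -
    have "B / L \<le> \<iota>" using L(4) L0 \<iota> by (simp add: field_simps)
    then show ?thesis using \<delta>L by linarith
  qed
  show rt: "1 / r \<le> \<tau>"
  proof -
    \<comment> \<open>With n = r^4 the defining relation of \<tau> reads r (r \<tau>)^3 = M, and M
      \<ge> r.\<close>
    have "r ^ 4 * \<tau> ^ 3 = M" using \<tau>(2) r(2) by simp
    then have "r * (r * \<tau>) ^ 3 = M" by (simp add: power_mult_distrib power3_eq_cube eval_nat_numeral mult_ac)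
    then have "r * 1 \<le> r * (r * \<tau>) ^ 3" using M(1) by simp
    then have "1 ^ 3 \<le> (r * \<tau>) ^ 3" using r0 by simp
    then have "1 \<le> r * \<tau>" using power_mono_iff[of 1 "r * \<tau>" 3] r0 \<tau> by simp
    then show ?thesis using r0 by (simp add: field_simps)
  qed
  show "1 / \<tau> \<le> \<iota> * M"
  proof -
    have "1 / \<tau> \<le> r" using rt r0 \<tau> by (simp add: field_simps)
    then show ?thesis using M by linarith
  qed
  show "400 * \<delta> \<le> \<tau>"
  proof -
    have "400 * \<delta> \<le> 400 * B / (r * L)" using \<delta>rL by simp
    also have "\<dots> \<le> L / (r * L)" using L r0 L0 by (intro divide_right_mono) auto
    also have "\<dots> = 1 / r" using L0 by simp
    finally show ?thesis using rt by linarith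
  qed
  show "n * (2 * \<delta>) ^ 3 \<le> \<iota> * M"
  proof -
    have "\<delta> \<le> B / r"
    proof -
      have "B / (r * L) \<le> B / r" using B r0 L by (intro divide_left_mono) auto
      then show ?thesis using \<delta>rL by linarith
    qed
    then have "(2 * \<delta>) ^ 3 \<le> (2 * (B / r)) ^ 3" using \<delta> by (intro power_mono) auto
    then have "n * (2 * \<delta>) ^ 3 \<le> r ^ 4 * (2 * (B / r)) ^ 3" unfolding r(2)[symmetric] using r0 by (intro mult_left_mono) auto
    also have "\<dots> = 8 * B ^ 3 * r" using r0 by (simp add: field_simps eval_nat_numeral)
    finally show ?thesis using M by linarith
  qed
  show "n * (1 / sqrt d) ^ 3 \<le> \<iota> * M"
  proof -
    have "r \<le> sqrt d" using rd by (simp add: real_le_rsqrt)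
    then have "1 / sqrt d \<le> 1 / r" using r0 d1 by (intro divide_left_mono) auto
    then have "(1 / sqrt d) ^ 3 \<le> (1 / r) ^ 3" using d1 by (intro power_mono) auto
    then have "n * (1 / sqrt d) ^ 3 \<le> r ^ 4 * (1 / r) ^ 3" unfolding r(2)[symmetric] using r0 by (intro mult_left_mono) auto
    also have "\<dots> = r" using r0 by (simp add: field_simps eval_nat_numeral)
    finally show ?thesis using M by linarith
  qed
  show "192 * n * \<delta>\<^sup>2 \<le> d"
  proof -
    have "192 * n * \<delta>\<^sup>2 \<le> 192 * r ^ 4 * (B / (r * L\<^sup>2))\<^sup>2"
      unfolding r(2)[symmetric] using r0 by (intro mult_left_mono \<delta>2) auto
    also have "\<dots> = r\<^sup>2 * (192 * B\<^sup>2) / L ^ 4" using r0 L0 by (simp add: field_simps eval_nat_numeral)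
    also have "\<dots> \<le> r\<^sup>2 * (192 * B\<^sup>2) / 1" using Lp[of 4] by (intro divide_left_mono) auto
    also have "\<dots> \<le> r\<^sup>2 * L ^ 5"
    proof -
      have "L ^ 1 \<le> L ^ 5" using L(1) by (intro power_increasing) auto
      then show ?thesis using L(3) by (simp add: mult_left_mono)
    qed
    finally show ?thesis using d by linarith
  qed
qed

lemma eventually_ln_ge: "eventually (\<lambda>n. c \<le> ln (real n)) sequentially"
  using filterlim_compose[OF ln_at_top filterlim_real_sequentially] by (simp add: filterlim_at_top)

theorem lemma11:
  fixes E :: "nat \<Rightarrow> nat set set"
    and s :: "nat \<Rightarrow> nat" and A :: "nat \<Rightarrow> real" and \<upsilon> :: real
    and \<C> :: "nat \<Rightarrow> nat set set" and \<mu> :: "nat \<Rightarrow> real vec"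
  assumes graph: "\<And>n. n \<ge> 1 \<Longrightarrow> simple_graph n (E n)"
    and s_range: "\<And>n. n \<ge> 1 \<Longrightarrow> s n \<in> {1..n}"
    and upsilon: "\<upsilon> > 0"
    and s_le: "\<And>n. n \<ge> 1 \<Longrightarrow> real (s n) \<le> real n powr (1 - \<upsilon>)"
    and A_pos: "\<And>n. n \<ge> 1 \<Longrightarrow> A n > 0"
    and A_bounded: "A \<in> O(\<lambda>_. 1)"
    and class_size: "\<And>n. n \<ge> 1 \<Longrightarrow> \<C> n \<subseteq> {S. S \<subseteq> {..<n} \<and> card S = s n}"
    and mu: "\<And>n. n \<ge> 1 \<Longrightarrow> \<mu> n \<in> signal_class n (\<C> n) (A n)"
    and dense: "(\<lambda>n. sqrt (real n) * ln (real n) ^ 5) \<in> o(\<lambda>n. avg_degree n (E n))"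
    and signal: "(\<lambda>n. real n powr (1/4)) \<in> o(\<lambda>n. real (s n) * A n)"
    and near_regular:
      "(\<lambda>n. Max ((\<lambda>i. \<bar>real (degree_of (E n) i) / avg_degree n (E n) - 1\<bar>) ` {..<n}))
         \<in> O(\<lambda>n. sqrt (ln (real n) / avg_degree n (E n)))"
    and gap: "limsup (\<lambda>n. ereal (second_largest_eigenvalue (scaled_adj n (E n)))) < 1"
  shows "\<exists>\<delta>>0. (\<lambda>n. measure_pmf.prob (ising 1 (scaled_adj n (E n)) (\<mu> n))
            {x. real n powr (1/4) * vec_mean x
                  \<ge> \<delta> * (real n powr (-1/4) * real (s n) * A n) powr (1/3)})
          \<longlonglongrightarrow> 1"
proof -
  define d where "d n = avg_degree n (E n)" for n
  define r where "r n = real n powr (1/4)" for n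
  define L where "L n = ln (real n)" for n
  \<comment> \<open>A real number strictly between the limsup and 1 makes the gap uniform for all
    large \<open>n\<close>.\<close>
  obtain C where C: "limsup (\<lambda>n. ereal (second_largest_eigenvalue (scaled_adj n (E n)))) < ereal C" "ereal C < 1"
    using ereal_dense2[OF gap] by blast
  define \<gamma> where "\<gamma> = min 1 (1 - C)"
  have \<gamma>: "0 < \<gamma>" "\<gamma> \<le> 1" using C(2) by (auto simp: \<gamma>_def)
  have ev_gap: "eventually (\<lambda>n. second_largest_eigenvalue (scaled_adj n (E n)) \<le> 1 - \<gamma>) sequentially"
    using Limsup_lessD[OF C(1)] by eventually_elim (auto simp: \<gamma>_def)
  define \<iota> where "\<iota> = tolerance (\<gamma> / 2)"
  have \<iota>: "0 < \<iota>" using \<gamma> by (simp add: \<iota>_def tolerance_def)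
  obtain K where K: "0 < K" "eventually (\<lambda>n. \<bar>A n\<bar> \<le> K) sequentially"
    using landau_o.bigE[OF A_bounded] by auto
  \<comment> \<open>The threshold \<open>a0\<close> encodes the smallness condition of
    \<open>ising_lower_tail\<close> on \<open>b = a * A n\<close>. Boundedness of \<open>A\<close>
    lets one constant \<open>a\<close> work for all large \<open>n\<close>, and
    \<open>a \<le> 1\<close> keeps the scaled field below \<open>\<mu>\<close>.\<close>
  define a0 where "a0 = min 1 (sqrt (\<iota> / 2))"
  define a where "a = min 1 (a0 / K)"
  have a0: "0 < a0" "a0 \<le> 1" "2 * a0\<^sup>2 \<le> \<iota>"
  proof -
    show "0 < a0" "a0 \<le> 1" using \<iota> by (auto simp: a0_def)
    then have "a0\<^sup>2 \<le> (sqrt (\<iota> / 2))\<^sup>2" by (intro power_mono) (auto simp: a0_def)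
    then show "2 * a0\<^sup>2 \<le> \<iota>" using \<iota> by simp
  qed
  have a: "0 < a" "a \<le> 1" "a * K \<le> a0" using a0 K by (auto simp: a_def min_def field_simps)
  obtain c where c: "0 < c" and ev_near: "eventually (\<lambda>n. norm (Max ((\<lambda>i. \<bar>real (degree_of (E n) i) / d n - 1\<bar>) ` {..<n}))
       \<le> c * norm (sqrt (L n / d n))) sequentially"
    using landau_o.bigE[OF near_regular] unfolding d_def L_def by blast
  define \<epsilon> where "\<epsilon> n = c * sqrt (L n / d n)" for n
  define B where "B = c / \<gamma>"
  have B: "0 < B" using c \<gamma> by (simp add: B_def)
  define M where "M n = real (s n) * (a * A n)" for n
  define \<tau> where "\<tau> n = (M n / real n) powr (1/3)" for n
  \<comment> \<open>The signal eventually beats every constant multiple of \<open>r\<close>: the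
    factors coming from \<iota> and B are covered, and so is the divergence of the exponent.\<close>
  have ev_M: "eventually (\<lambda>n. k * r n \<le> M n) sequentially" if k: "0 < k" for k
  proof -
    have "eventually (\<lambda>n. norm (real n powr (1/4)) \<le> a / k * norm (real (s n) * A n)) sequentially"
      by (rule landau_o.smallD[OF signal]) (use a k in simp)
    then show ?thesis using eventually_ge_at_top[of 1]
    proof eventually_elim
      case (elim n)
      have "norm (real (s n) * A n) = real (s n) * A n" using A_pos[OF elim(2)] by (simp add: abs_mult)
      then have "r n \<le> a / k * (real (s n) * A n)" using elim(1) by (simp add: r_def)
      then show ?case using k by (simp add: M_def field_simps)
    qed
  qed
  have ev_d: "eventually (\<lambda>n. (r n)\<^sup>2 * L n ^ 5 \<le> d n) sequentially"
  proof -
    have "eventually (\<lambda>n. norm (sqrt (real n) * ln (real n) ^ 5) \<le> 1 * norm (d n)) sequentially"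
      unfolding d_def by (rule landau_o.smallD[OF dense]) simp
    then show ?thesis using eventually_ge_at_top[of 1]
    proof eventually_elim
      case (elim n)
      have "0 \<le> d n" by (simp add: d_def avg_degree_def sum_nonneg)
      moreover have "(r n)\<^sup>2 = sqrt (real n)"
        by (simp add: r_def power2_eq_square powr_add[symmetric] powr_half_sqrt)
      moreover have "0 \<le> sqrt (real n) * ln (real n) ^ 5" using elim(2) by simp
      ultimately show ?case using elim(1) by (simp add: L_def)
    qed
  qed
  have k: "0 < 1 / \<iota>" "0 < 8 * B ^ 3 / \<iota>" using \<iota> B by auto
  \<comment> \<open>The exponent is weakened from \<open>M n * \<tau> n\<close> to
    \<open>M n / r n\<close>, using 1 / r \<le> \<tau>; the weaker one tends to infinity directly by
    \<open>ev_M\<close>.\<close>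
  have main: "eventually (\<lambda>n. 1 - exp (- (M n / r n / 3200))
      \<le> measure_pmf.prob (ising 1 (scaled_adj n (E n)) (\<mu> n)) {x. \<tau> n / 400 \<le> vec_mean x} \<and> 0 < M n) sequentially"
    using eventually_ge_at_top[of 2] ev_gap K(2) ev_near ev_d ev_M[of 1, simplified]
      ev_M[OF k(1)] ev_M[OF k(2)]
      eventually_ln_ge[of 1] eventually_ln_ge[of "8 * B"] eventually_ln_ge[of "192 * B\<^sup>2"]
      eventually_ln_ge[of "B / \<iota>"] eventually_ln_ge[of "400 * B"]
  proof eventually_elim
    case (elim n)
    have n1: "1 \<le> n" using elim(1) by simp
    have An: "0 < A n" "A n \<le> K" using A_pos[OF n1] elim(3) by auto
    have sn: "1 \<le> s n" using s_range[OF n1] by simp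
    have M0: "0 < M n" using An sn a by (simp add: M_def)
    have r1: "1 \<le> r n" using n1 by (simp add: r_def ge_one_powr_ge_zero)
    have r4: "r n ^ 4 = real n" using n1 by (simp add: r_def powr_realpow[symmetric] powr_powr)
    have L1: "1 \<le> L n" using elim by (simp add: L_def)
    have d0: "0 < d n"
    proof -
      have "0 < (r n)\<^sup>2 * L n ^ 5" using r1 L1 by (intro mult_pos_pos) auto
      then show ?thesis using elim(5) by linarith
    qed
    have \<epsilon>0: "0 < \<epsilon> n" using c L1 d0 by (simp add: \<epsilon>_def)
    have \<delta>2: "(\<epsilon> n / \<gamma>)\<^sup>2 = B\<^sup>2 * L n / d n"
      using L1 d0 by (simp add: \<epsilon>_def B_def power_divide power_mult_distrib)
    have \<tau>0: "0 < \<tau> n" using M0 n1 by (simp add: \<tau>_def)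
    have \<tau>3: "n * \<tau> n ^ 3 = M n" using M0 n1 by (simp add: \<tau>_def powr_realpow[symmetric] powr_powr)
    note T = error_terms_small[OF r1 r4 B \<iota> L1, where d = "d n" and \<delta> = "\<epsilon> n / \<gamma>" and M = "M n" and \<tau> = "\<tau> n"]
    have Ls: "8 * B \<le> L n" "192 * B\<^sup>2 \<le> L n" "B / \<iota> \<le> L n" "400 * B \<le> L n" using elim by (auto simp: L_def)
    have Ms: "r n \<le> M n" "r n \<le> \<iota> * M n" "8 * B ^ 3 * r n \<le> \<iota> * M n"
      using elim(6-8) \<iota> by (auto simp: field_simps)
    have \<delta>0: "0 \<le> \<epsilon> n / \<gamma>" using \<epsilon>0 \<gamma> by simp
    note T = T[OF Ls elim(5) \<delta>0 \<delta>2 Ms \<tau>0 \<tau>3]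
    let ?S = "vec_supp (\<mu> n)"
    have mu': "\<mu> n \<in> carrier_vec n" "\<forall>i<n. 0 \<le> \<mu> n $ i" "?S \<in> \<C> n" "\<forall>i\<in>?S. A n \<le> \<mu> n $ i"
      using mu[OF n1] by (auto simp: signal_class_def)
    have S: "?S \<subseteq> {..<n}" "card ?S = s n" using mu'(3) class_size[OF n1] by auto
    have aA: "a * A n \<le> a0" "a * A n \<le> A n"
    proof -
      have "a * A n \<le> a * K" using An a by simp
      then show "a * A n \<le> a0" using a by linarith
      show "a * A n \<le> A n" using An a by (simp add: mult_left_le_one_le)
    qed
    have "1 - exp (- (M n * \<tau> n / 3200))
      \<le> measure_pmf.prob (ising 1 (scaled_adj n (E n)) (\<mu> n)) {x. \<tau> n / 400 \<le> vec_mean x}"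
    proof (rule ising_lower_tail[where n = n and E = "E n" and s = "s n" and b = "a * A n" and \<gamma> = \<gamma>
          and \<epsilon> = "\<epsilon> n" and \<tau> = "\<tau> n" and S = ?S and \<mu> = "\<mu> n", folded d_def M_def \<iota>_def])
      show "\<bar>real (degree_of (E n) i) / d n - 1\<bar> \<le> \<epsilon> n" if "i < n" for i
      proof -
        have "\<bar>real (degree_of (E n) i) / d n - 1\<bar> \<le> Max ((\<lambda>i. \<bar>real (degree_of (E n) i) / d n - 1\<bar>) ` {..<n})"
          by (rule Max_ge) (use that in auto)
        also have "\<dots> \<le> c * norm (sqrt (L n / d n))" using elim(4) by (simp add: abs_le_iff)
        also have "\<dots> = \<epsilon> n" using L1 d0 by (simp add: \<epsilon>_def)
        finally show ?thesis .
      qed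
      show "8 * \<epsilon> n \<le> \<gamma>" using T(2) \<gamma> by (simp add: field_simps)
      show "192 * n * (\<epsilon> n)\<^sup>2 \<le> \<gamma>\<^sup>2 * d n"
        using T(3) \<gamma> by (simp add: power_divide field_simps)
      show "2 * (a * A n)\<^sup>2 \<le> \<iota>"
      proof -
        have "(a * A n)\<^sup>2 \<le> a0\<^sup>2" using aA An a by (intro power_mono) auto
        then show ?thesis using a0(3) by linarith
      qed
      show "a * A n \<le> 1" using aA a0 by linarith
      show "a * A n \<le> \<mu> n $ i" if "i \<in> ?S" for i using mu'(4) that aA by force
    qed (use T \<gamma> elim(1,2) graph[OF n1] S sn mu' An a \<epsilon>0 \<tau>0 \<tau>3 in auto)
    moreover have "M n / r n \<le> M n * \<tau> n"
      using mult_left_mono[OF T(4), of "M n"] M0 by simp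
    then have "1 - exp (- (M n / r n / 3200)) \<le> 1 - exp (- (M n * \<tau> n / 3200))" by simp
    ultimately show ?case using M0 by linarith
  qed
  have "filterlim (\<lambda>n. M n / r n) at_top sequentially"
    unfolding filterlim_at_top
  proof
    fix Z :: real
    have Z: "0 < max 1 Z" by simp
    show "eventually (\<lambda>n. Z \<le> M n / r n) sequentially"
      using ev_M[OF Z] eventually_ge_at_top[of 1]
    proof eventually_elim
      case (elim n)
      have "0 < r n" using elim(2) by (simp add: r_def)
      moreover have "Z * r n \<le> max 1 Z * r n" using \<open>0 < r n\<close> by (intro mult_right_mono) auto
      then have "Z * r n \<le> M n" using elim(1) by (rule order_trans)
      ultimately show ?case by (simp add: pos_le_divide_eq)
    qed
  qed
  then have "filterlim (\<lambda>n. 1 / 3200 * (M n / r n)) at_top sequentially"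
    by (intro filterlim_tendsto_pos_mult_at_top[OF tendsto_const]) auto
  then have "filterlim (\<lambda>n. - (M n / r n / 3200)) at_bot sequentially"
    by (simp add: filterlim_uminus_at_top mult.commute)
  then have "(\<lambda>n. exp (- (M n / r n / 3200))) \<longlonglongrightarrow> 0"
    by (rule filterlim_compose[OF exp_at_bot])
  then have low: "(\<lambda>n. 1 - exp (- (M n / r n / 3200))) \<longlonglongrightarrow> 1"
    using tendsto_diff[OF tendsto_const[of 1]] by fastforce
  \<comment> \<open>Multiplying \<open>\<tau> n\<close> by \<open>real n powr (1/4)\<close> gives
    exactly \<open>a powr (1/3)\<close> times the normalization in the statement, so with this
    \<delta> the two events coincide for n \<ge> 1.\<close>
  define \<delta> where "\<delta> = a powr (1/3) / 400"
  have \<delta>: "0 < \<delta>" using a by (simp add: \<delta>_def)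
  have set_eq: "eventually (\<lambda>n. {x. real n powr (1/4) * vec_mean x \<ge> \<delta> * (real n powr (-1/4) * real (s n) * A n) powr (1/3)}
      = {x. \<tau> n / 400 \<le> vec_mean x}) sequentially"
    using eventually_ge_at_top[of 1]
  proof eventually_elim
    case (elim n)
    have n0: "0 < real n" using elim by simp
    have An: "0 < A n" using A_pos elim by simp
    have sn: "0 < s n" using s_range[of n] elim by simp
    have "\<tau> n = (a * (real n powr (-3/4) * (real n powr (-1/4) * real (s n) * A n))) powr (1/3)"
    proof -
      have "real n powr (-3/4) * real n powr (-1/4) = real n powr (-1)" by (simp add: powr_add[symmetric])
      also have "\<dots> = 1 / real n" using n0 by (simp add: powr_minus_divide)
      finally have e: "real n powr (-3/4) * real n powr (-1/4) = 1 / real n" .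
      have "M n / real n = real (s n) * (a * A n) * (real n powr (-3/4) * real n powr (-1/4))"
        unfolding e by (simp add: M_def)
      also have "\<dots> = a * (real n powr (-3/4) * (real n powr (-1/4) * real (s n) * A n))" by simp
      finally show ?thesis unfolding \<tau>_def by simp
    qed
    also have "\<dots> = a powr (1/3) * ((real n powr (-3/4)) powr (1/3) * (real n powr (-1/4) * real (s n) * A n) powr (1/3))"
      using a An sn by (simp add: powr_mult)
    also have "(real n powr (-3/4)) powr (1/3) = 1 / real n powr (1/4)"
      unfolding powr_powr using powr_minus_divide[of "real n" "1/4"] by simp
    finally have t: "real n powr (1/4) * (\<tau> n / 400) = \<delta> * (real n powr (-1/4) * real (s n) * A n) powr (1/3)"
      using n0 by (simp add: \<delta>_def)
    have "0 < real n powr (1/4)" using n0 by simp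
    then show ?case unfolding t[symmetric] by simp
  qed
  have "(\<lambda>n. measure_pmf.prob (ising 1 (scaled_adj n (E n)) (\<mu> n)) {x. \<tau> n / 400 \<le> vec_mean x}) \<longlonglongrightarrow> 1"
  proof (rule tendsto_sandwich[OF _ _ low tendsto_const[of 1]])
    show "eventually (\<lambda>n. 1 - exp (- (M n / r n / 3200))
      \<le> measure_pmf.prob (ising 1 (scaled_adj n (E n)) (\<mu> n)) {x. \<tau> n / 400 \<le> vec_mean x}) sequentially"
      using main by eventually_elim simp
  qed simp
  then have "(\<lambda>n. measure_pmf.prob (ising 1 (scaled_adj n (E n)) (\<mu> n))
            {x. real n powr (1/4) * vec_mean x
                  \<ge> \<delta> * (real n powr (-1/4) * real (s n) * A n) powr (1/3)})
          \<longlonglongrightarrow> 1"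
    by (rule Lim_transform_eventually) (use set_eq in eventually_elim, simp)
  then show ?thesis using \<delta> by blast
qed

end
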